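(* Let $L\colon\mathbf{SMC}\to\mathbf{UTSMC}$ be the left adjoint of the forgetful functor $\mathbf{UTSMC}\to\mathbf{SMC}$. For every right strict rig category $(\mathcal{C},\oplus,0,\otimes,1)$, the uniformly traced monoidal category $L(\mathcal{C},\oplus,0)$ carries a rig structure (with $\otimes$ agreeing with that of $\mathcal{C}$ on objects and with structural isomorphisms the images of those of $\mathcal{C}$) making it a uniformly traced rig category, and the adjunction restricts to an adjunction $\mathbf{RIG}\rightleftarrows\mathbf{RIGUTr}$ whose right adjoint is the forgetful functor.
   Context: A rig category is a category with two symmetric monoidal structures $(\otimes,1,\sigma^{\otimes})$ and $(\oplus,0,\sigma^{\oplus})$ and natural isomorphisms $\delta^l_{X,Y,Z}\colon X\otimes(Y\oplus Z)\to(X\otimes Y)\oplus(X\otimes Z)$, $\delta^r_{X,Y,Z}\colon (X\oplus Y)\otimes Z\to(X\otimes Z)\oplus(Y\otimes Z)$, $\lambda^{\bullet}_X\colon 0\otimes X\to 0$, $\rho^{\bullet}_X\colon X\otimes 0\to 0$ satisfying Laplaza's coherence axioms. It is right strict if both monoidal structures are strict and $\lambda^\bullet,\rho^\bullet,\delta^r$ are identities. A right strict rig functor is a strict symmetric monoidal functor for both $\otimes$ and $\oplus$ preserving $\delta^l$. $\mathbf{RIG}$: right strict rig categories and right strict rig functors. A uniformly traced rig category is a rig category whose $(\mathcal{C},\oplus,0)$ is uniformly traced (trace $\mathsf{tr}_S\colon\mathcal{C}(S\oplus X,S\oplus Y)\to\mathcal{C}(X,Y)$ satisfying tightening, strength,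 joining, vanishing, sliding, yanking, and uniformity: $f;(r\oplus\mathrm{id}_Y)=(r\oplus\mathrm{id}_X);g$ implies $\mathsf{tr}_Sf=\mathsf{tr}_Tg$); $\mathbf{RIGUTr}$ has these as objects and as morphisms rig functors that preserve the trace. $\mathbf{SMC}$/$\mathbf{UTSMC}$: (uniformly traced) symmetric strict monoidal categories with (trace-preserving) strict symmetric monoidal functors. Composition is diagrammatic.
   Formalization: Uniformly traced rig categories are also required to satisfy tr_{S⊗Z}(f⊗id_Z)=tr_S(f)⊗id_Z, without which the adjunction fails, and objects and morphisms of RIGUTr are taken right strict so that the forgetful functor to RIG exists. *)

theory Defs
  imports "HOL-Library.FuncSet"
begin

text \<open>Composition is diagrammatic throughout: \<open>Cmp C f g\<close> is ``first \<open>f\<close>, then \<open>g\<close>''.\<close>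

record ('o, 'a) cat =
  Ob :: "'o set"
  Ar :: "'a set"
  Dom :: "'a \<Rightarrow> 'o"
  Cod :: "'a \<Rightarrow> 'o"
  Idt :: "'o \<Rightarrow> 'a"
  Cmp :: "'a \<Rightarrow> 'a \<Rightarrow> 'a"

definition hom :: "('o, 'a, 'm) cat_scheme \<Rightarrow> 'o \<Rightarrow> 'o \<Rightarrow> 'a set" where
  "hom C X Y = {f \<in> Ar C. Dom C f = X \<and> Cod C f = Y}"

locale cat_syntax =
  fixes C :: "('o, 'a, 'm) cat_scheme"
begin
abbreviation comp (infixl "\<Zsemi>" 55) where "f \<Zsemi> g \<equiv> Cmp C f g"
abbreviation ident ("\<i>") where "\<i> X \<equiv> Idt C X"
end

locale category = cat_syntax C for C :: "('o, 'a, 'm) cat_scheme" +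
  assumes dom_ob: "f \<in> Ar C \<Longrightarrow> Dom C f \<in> Ob C"
    and cod_ob: "f \<in> Ar C \<Longrightarrow> Cod C f \<in> Ob C"
    and id_hom: "X \<in> Ob C \<Longrightarrow> \<i> X \<in> hom C X X"
    and comp_hom: "\<lbrakk>f \<in> hom C X Y; g \<in> hom C Y Z\<rbrakk> \<Longrightarrow> f \<Zsemi> g \<in> hom C X Z"
    and id_comp: "f \<in> hom C X Y \<Longrightarrow> \<i> X \<Zsemi> f = f"
    and comp_id: "f \<in> hom C X Y \<Longrightarrow> f \<Zsemi> \<i> Y = f"
    and comp_assoc: "\<lbrakk>f \<in> hom C W X; g \<in> hom C X Y; h \<in> hom C Y Z\<rbrakk>
      \<Longrightarrow> (f \<Zsemi> g) \<Zsemi> h = f \<Zsemi> (g \<Zsemi> h)"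

definition inverse_arrows :: "('o, 'a, 'm) cat_scheme \<Rightarrow> 'a \<Rightarrow> 'a \<Rightarrow> bool" where
  "inverse_arrows C f g \<longleftrightarrow> f \<in> Ar C \<and> g \<in> hom C (Cod C f) (Dom C f)
     \<and> Cmp C f g = Idt C (Dom C f) \<and> Cmp C g f = Idt C (Cod C f)"

definition iso_hom :: "('o, 'a, 'm) cat_scheme \<Rightarrow> 'o \<Rightarrow> 'o \<Rightarrow> 'a set" where
  "iso_hom C X Y = {f \<in> hom C X Y. \<exists>g. inverse_arrows C f g}"

definition inv_arrow :: "('o, 'a, 'm) cat_scheme \<Rightarrow> 'a \<Rightarrow> 'a" where
  "inv_arrow C f = (THE g. inverse_arrows C f g)"

record ('o1, 'a1, 'o2, 'a2) fnctr =
  FOb :: "'o1 \<Rightarrow> 'o2"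
  FAr :: "'a1 \<Rightarrow> 'a2"

definition is_functor ::
  "('o1, 'a1, 'm1) cat_scheme \<Rightarrow> ('o2, 'a2, 'm2) cat_scheme \<Rightarrow> ('o1, 'a1, 'o2, 'a2) fnctr \<Rightarrow> bool" where
  "is_functor C D F \<longleftrightarrow> category C \<and> category D
     \<and> (\<forall>X\<in>Ob C. FOb F X \<in> Ob D)
     \<and> (\<forall>X Y. \<forall>f\<in>hom C X Y. FAr F f \<in> hom D (FOb F X) (FOb F Y))
     \<and> (\<forall>X\<in>Ob C. FAr F (Idt C X) = Idt D (FOb F X))
     \<and> (\<forall>X Y Z. \<forall>f\<in>hom C X Y. \<forall>g\<in>hom C Y Z. FAr F (Cmp C f g) = Cmp D (FAr F f) (FAr F g))"

definition id_fnctr :: "('o, 'a, 'o, 'a) fnctr" where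
  "id_fnctr = \<lparr>FOb = (\<lambda>X. X), FAr = (\<lambda>f. f)\<rparr>"

definition comp_fnctr ::
  "('o1, 'a1, 'o2, 'a2) fnctr \<Rightarrow> ('o2, 'a2, 'o3, 'a3) fnctr \<Rightarrow> ('o1, 'a1, 'o3, 'a3) fnctr" where
  "comp_fnctr F G = \<lparr>FOb = (\<lambda>X. FOb G (FOb F X)), FAr = (\<lambda>f. FAr G (FAr F f))\<rparr>"

definition nat_trans ::
  "('o1, 'a1, 'm1) cat_scheme \<Rightarrow> ('o2, 'a2, 'm2) cat_scheme \<Rightarrow>
   ('o1, 'a1, 'o2, 'a2) fnctr \<Rightarrow> ('o1, 'a1, 'o2, 'a2) fnctr \<Rightarrow> ('o1 \<Rightarrow> 'a2) \<Rightarrow> bool" where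
  "nat_trans C D F G \<tau> \<longleftrightarrow> is_functor C D F \<and> is_functor C D G
     \<and> (\<forall>X\<in>Ob C. \<tau> X \<in> hom D (FOb F X) (FOb G X))
     \<and> (\<forall>X Y. \<forall>f\<in>hom C X Y. Cmp D (FAr F f) (\<tau> Y) = Cmp D (\<tau> X) (FAr G f))"

text \<open>\<open>L\<close> is left adjoint to \<open>R\<close>, with unit \<open>\<eta>\<close> and counit \<open>\<epsilon>\<close>.\<close>

definition adjunction ::
  "('o1, 'a1, 'm1) cat_scheme \<Rightarrow> ('o2, 'a2, 'm2) cat_scheme \<Rightarrow>
   ('o1, 'a1, 'o2, 'a2) fnctr \<Rightarrow> ('o2, 'a2, 'o1, 'a1) fnctr \<Rightarrow>
   ('o1 \<Rightarrow> 'a1) \<Rightarrow> ('o2 \<Rightarrow> 'a2) \<Rightarrow> bool" where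
  "adjunction C D L R \<eta> \<epsilon> \<longleftrightarrow> is_functor C D L \<and> is_functor D C R
     \<and> nat_trans C C id_fnctr (comp_fnctr L R) \<eta>
     \<and> nat_trans D D (comp_fnctr R L) id_fnctr \<epsilon>
     \<and> (\<forall>X\<in>Ob C. Cmp D (FAr L (\<eta> X)) (\<epsilon> (FOb L X)) = Idt D (FOb L X))
     \<and> (\<forall>Y\<in>Ob D. Cmp C (\<eta> (FOb R Y)) (FAr R (\<epsilon> Y)) = Idt C (FOb R Y))"


section \<open>Symmetric monoidal structures\<close>

record ('o, 'a) monstr =
  TOb :: "'o \<Rightarrow> 'o \<Rightarrow> 'o"
  TAr :: "'a \<Rightarrow> 'a \<Rightarrow> 'a"
  TUnit :: "'o"
  Assoc :: "'o \<Rightarrow> 'o \<Rightarrow> 'o \<Rightarrow> 'a"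
  LUnit :: "'o \<Rightarrow> 'a"
  RUnit :: "'o \<Rightarrow> 'a"
  Symm :: "'o \<Rightarrow> 'o \<Rightarrow> 'a"

locale monoidal_syntax = cat_syntax C
  for C :: "('o, 'a, 'm) cat_scheme" +
  fixes M :: "('o, 'a) monstr"
begin
abbreviation tensor_ob (infixr "\<odot>" 70) where "X \<odot> Y \<equiv> TOb M X Y"
abbreviation tensor_ar (infixr "\<odot>\<^sub>a" 70) where "f \<odot>\<^sub>a g \<equiv> TAr M f g"
abbreviation unit_ob ("\<I>") where "\<I> \<equiv> TUnit M"
abbreviation assoc_ar ("\<alpha>") where "\<alpha> \<equiv> Assoc M"
abbreviation lunit_ar ("\<lambda>\<^sub>u") where "\<lambda>\<^sub>u \<equiv> LUnit M"
abbreviation runit_ar ("\<rho>\<^sub>u") where "\<rho>\<^sub>u \<equiv> RUnit M"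
abbreviation symm_ar ("\<sigma>") where "\<sigma> \<equiv> Symm M"
end

locale symmetric_monoidal = category C + monoidal_syntax C M
  for C :: "('o, 'a, 'm) cat_scheme" and M :: "('o, 'a) monstr" +
  assumes tensor_ob: "\<lbrakk>X \<in> Ob C; Y \<in> Ob C\<rbrakk> \<Longrightarrow> X \<odot> Y \<in> Ob C"
    and unit_ob: "\<I> \<in> Ob C"
    and tensor_hom: "\<lbrakk>f \<in> hom C X X'; g \<in> hom C Y Y'\<rbrakk> \<Longrightarrow> f \<odot>\<^sub>a g \<in> hom C (X \<odot> Y) (X' \<odot> Y')"
    and tensor_id: "\<lbrakk>X \<in> Ob C; Y \<in> Ob C\<rbrakk> \<Longrightarrow> \<i> X \<odot>\<^sub>a \<i> Y = \<i> (X \<odot> Y)"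
    and tensor_comp: "\<lbrakk>f \<in> hom C X X'; f' \<in> hom C X' X''; g \<in> hom C Y Y'; g' \<in> hom C Y' Y''\<rbrakk>
      \<Longrightarrow> (f \<Zsemi> f') \<odot>\<^sub>a (g \<Zsemi> g') = (f \<odot>\<^sub>a g) \<Zsemi> (f' \<odot>\<^sub>a g')"
    and assoc_iso: "\<lbrakk>X \<in> Ob C; Y \<in> Ob C; Z \<in> Ob C\<rbrakk>
      \<Longrightarrow> \<alpha> X Y Z \<in> iso_hom C ((X \<odot> Y) \<odot> Z) (X \<odot> (Y \<odot> Z))"
    and assoc_natural: "\<lbrakk>f \<in> hom C X X'; g \<in> hom C Y Y'; h \<in> hom C Z Z'\<rbrakk>
      \<Longrightarrow> ((f \<odot>\<^sub>a g) \<odot>\<^sub>a h) \<Zsemi> \<alpha> X' Y' Z' = \<alpha> X Y Z \<Zsemi> (f \<odot>\<^sub>a (g \<odot>\<^sub>a h))"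
    and lunit_iso: "X \<in> Ob C \<Longrightarrow> \<lambda>\<^sub>u X \<in> iso_hom C (\<I> \<odot> X) X"
    and lunit_natural: "f \<in> hom C X X' \<Longrightarrow> (\<i> \<I> \<odot>\<^sub>a f) \<Zsemi> \<lambda>\<^sub>u X' = \<lambda>\<^sub>u X \<Zsemi> f"
    and runit_iso: "X \<in> Ob C \<Longrightarrow> \<rho>\<^sub>u X \<in> iso_hom C (X \<odot> \<I>) X"
    and runit_natural: "f \<in> hom C X X' \<Longrightarrow> (f \<odot>\<^sub>a \<i> \<I>) \<Zsemi> \<rho>\<^sub>u X' = \<rho>\<^sub>u X \<Zsemi> f"
    and symm_hom: "\<lbrakk>X \<in> Ob C; Y \<in> Ob C\<rbrakk> \<Longrightarrow> \<sigma> X Y \<in> hom C (X \<odot> Y) (Y \<odot> X)"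
    and symm_natural: "\<lbrakk>f \<in> hom C X X'; g \<in> hom C Y Y'\<rbrakk>
      \<Longrightarrow> (f \<odot>\<^sub>a g) \<Zsemi> \<sigma> X' Y' = \<sigma> X Y \<Zsemi> (g \<odot>\<^sub>a f)"
    and symm_invol: "\<lbrakk>X \<in> Ob C; Y \<in> Ob C\<rbrakk> \<Longrightarrow> \<sigma> X Y \<Zsemi> \<sigma> Y X = \<i> (X \<odot> Y)"
    and pentagon: "\<lbrakk>W \<in> Ob C; X \<in> Ob C; Y \<in> Ob C; Z \<in> Ob C\<rbrakk>
      \<Longrightarrow> (\<alpha> W X Y \<odot>\<^sub>a \<i> Z) \<Zsemi> \<alpha> W (X \<odot> Y) Z \<Zsemi> (\<i> W \<odot>\<^sub>a \<alpha> X Y Z)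
        = \<alpha> (W \<odot> X) Y Z \<Zsemi> \<alpha> W X (Y \<odot> Z)"
    and triangle: "\<lbrakk>X \<in> Ob C; Y \<in> Ob C\<rbrakk>
      \<Longrightarrow> \<alpha> X \<I> Y \<Zsemi> (\<i> X \<odot>\<^sub>a \<lambda>\<^sub>u Y) = \<rho>\<^sub>u X \<odot>\<^sub>a \<i> Y"
    and hexagon: "\<lbrakk>X \<in> Ob C; Y \<in> Ob C; Z \<in> Ob C\<rbrakk>
      \<Longrightarrow> \<alpha> X Y Z \<Zsemi> \<sigma> X (Y \<odot> Z) \<Zsemi> \<alpha> Y Z X
        = (\<sigma> X Y \<odot>\<^sub>a \<i> Z) \<Zsemi> \<alpha> Y X Z \<Zsemi> (\<i> Y \<odot>\<^sub>a \<sigma> X Z)"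

text \<open>The equations between objects, such as \<open>(X \<odot> Y) \<odot> Z = X \<odot> (Y \<odot> Z)\<close>, follow from these by
  comparing domains and codomains.\<close>

locale strict_symmetric_monoidal = symmetric_monoidal C M
  for C :: "('o, 'a, 'm) cat_scheme" and M :: "('o, 'a) monstr" +
  assumes assoc_strict: "\<lbrakk>X \<in> Ob C; Y \<in> Ob C; Z \<in> Ob C\<rbrakk> \<Longrightarrow> \<alpha> X Y Z = \<i> ((X \<odot> Y) \<odot> Z)"
    and lunit_strict: "X \<in> Ob C \<Longrightarrow> \<lambda>\<^sub>u X = \<i> X"
    and runit_strict: "X \<in> Ob C \<Longrightarrow> \<rho>\<^sub>u X = \<i> X"

definition strict_sm_functor ::
  "('o1, 'a1, 'm1) cat_scheme \<Rightarrow> ('o1, 'a1) monstr \<Rightarrow> ('o2, 'a2, 'm2) cat_scheme \<Rightarrow> ('o2, 'a2) monstr \<Rightarrow>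
   ('o1, 'a1, 'o2, 'a2) fnctr \<Rightarrow> bool" where
  "strict_sm_functor C M D N F \<longleftrightarrow> is_functor C D F
     \<and> (\<forall>X\<in>Ob C. \<forall>Y\<in>Ob C. FOb F (TOb M X Y) = TOb N (FOb F X) (FOb F Y))
     \<and> (\<forall>f\<in>Ar C. \<forall>g\<in>Ar C. FAr F (TAr M f g) = TAr N (FAr F f) (FAr F g))
     \<and> FOb F (TUnit M) = TUnit N
     \<and> (\<forall>X\<in>Ob C. \<forall>Y\<in>Ob C. \<forall>Z\<in>Ob C.
          FAr F (Assoc M X Y Z) = Assoc N (FOb F X) (FOb F Y) (FOb F Z))
     \<and> (\<forall>X\<in>Ob C. FAr F (LUnit M X) = LUnit N (FOb F X))
     \<and> (\<forall>X\<in>Ob C. FAr F (RUnit M X) = RUnit N (FOb F X))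
     \<and> (\<forall>X\<in>Ob C. \<forall>Y\<in>Ob C. FAr F (Symm M X Y) = Symm N (FOb F X) (FOb F Y))"


section \<open>Uniform traces\<close>

text \<open>\<open>tr S X Y\<close> is the operator \<open>hom (S \<odot> X) (S \<odot> Y) \<Rightarrow> hom X Y\<close>. The objects \<open>X\<close>, \<open>Y\<close> are
  arguments because they are not determined by \<open>S \<odot> X\<close>, \<open>S \<odot> Y\<close>.\<close>

locale uniformly_traced = strict_symmetric_monoidal C M
  for C :: "('o, 'a, 'm) cat_scheme" and M :: "('o, 'a) monstr" +
  fixes tr :: "'o \<Rightarrow> 'o \<Rightarrow> 'o \<Rightarrow> 'a \<Rightarrow> 'a"
  assumes trace_hom: "\<lbrakk>S \<in> Ob C; X \<in> Ob C; Y \<in> Ob C; f \<in> hom C (S \<odot> X) (S \<odot> Y)\<rbrakk>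
      \<Longrightarrow> tr S X Y f \<in> hom C X Y"
    and tightening: "\<lbrakk>S \<in> Ob C; u \<in> hom C X' X; f \<in> hom C (S \<odot> X) (S \<odot> Y); v \<in> hom C Y Y'\<rbrakk>
      \<Longrightarrow> tr S X' Y' ((\<i> S \<odot>\<^sub>a u) \<Zsemi> f \<Zsemi> (\<i> S \<odot>\<^sub>a v)) = u \<Zsemi> tr S X Y f \<Zsemi> v"
    and strength: "\<lbrakk>S \<in> Ob C; X \<in> Ob C; Y \<in> Ob C; f \<in> hom C (S \<odot> X) (S \<odot> Y); g \<in> hom C X' Y'\<rbrakk>
      \<Longrightarrow> tr S (X \<odot> X') (Y \<odot> Y') (f \<odot>\<^sub>a g) = tr S X Y f \<odot>\<^sub>a g"
    and joining: "\<lbrakk>S \<in> Ob C; T \<in> Ob C; X \<in> Ob C; Y \<in> Ob C; f \<in> hom C (S \<odot> T \<odot> X) (S \<odot> T \<odot> Y)\<rbrakk>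
      \<Longrightarrow> tr T X Y (tr S (T \<odot> X) (T \<odot> Y) f) = tr (S \<odot> T) X Y f"
    and vanishing: "f \<in> hom C X Y \<Longrightarrow> tr \<I> X Y f = f"
    and sliding: "\<lbrakk>X \<in> Ob C; Y \<in> Ob C; f \<in> hom C (T \<odot> X) (S \<odot> Y); u \<in> hom C S T\<rbrakk>
      \<Longrightarrow> tr T X Y (f \<Zsemi> (u \<odot>\<^sub>a \<i> Y)) = tr S X Y ((u \<odot>\<^sub>a \<i> X) \<Zsemi> f)"
    and yanking: "S \<in> Ob C \<Longrightarrow> tr S S S (\<sigma> S S) = \<i> S"
    and uniformity: "\<lbrakk>X \<in> Ob C; Y \<in> Ob C; f \<in> hom C (S \<odot> X) (S \<odot> Y); g \<in> hom C (T \<odot> X) (T \<odot> Y);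
        r \<in> hom C S T; f \<Zsemi> (r \<odot>\<^sub>a \<i> Y) = (r \<odot>\<^sub>a \<i> X) \<Zsemi> g\<rbrakk>
      \<Longrightarrow> tr S X Y f = tr T X Y g"

definition preserves_trace ::
  "('o1, 'a1, 'm1) cat_scheme \<Rightarrow> ('o1, 'a1) monstr \<Rightarrow> ('o1 \<Rightarrow> 'o1 \<Rightarrow> 'o1 \<Rightarrow> 'a1 \<Rightarrow> 'a1) \<Rightarrow>
   ('o2 \<Rightarrow> 'o2 \<Rightarrow> 'o2 \<Rightarrow> 'a2 \<Rightarrow> 'a2) \<Rightarrow> ('o1, 'a1, 'o2, 'a2) fnctr \<Rightarrow> bool" where
  "preserves_trace C M t t' F \<longleftrightarrow>
     (\<forall>S\<in>Ob C. \<forall>X\<in>Ob C. \<forall>Y\<in>Ob C. \<forall>f\<in>hom C (TOb M S X) (TOb M S Y).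
        FAr F (t S X Y f) = t' (FOb F S) (FOb F X) (FOb F Y) (FAr F f))"


section \<open>Rig categories\<close>

record ('o, 'a) smcat = "('o, 'a) cat" +
  Plus :: "('o, 'a) monstr"

record ('o, 'a) utsmcat = "('o, 'a) smcat" +
  Trace :: "'o \<Rightarrow> 'o \<Rightarrow> 'o \<Rightarrow> 'a \<Rightarrow> 'a"

record ('o, 'a) rigcat = "('o, 'a) smcat" +
  Times :: "('o, 'a) monstr"
  DistL :: "'o \<Rightarrow> 'o \<Rightarrow> 'o \<Rightarrow> 'a"
  DistR :: "'o \<Rightarrow> 'o \<Rightarrow> 'o \<Rightarrow> 'a"
  AnnL :: "'o \<Rightarrow> 'a"
  AnnR :: "'o \<Rightarrow> 'a"

record ('o, 'a) utrigcat = "('o, 'a) rigcat" +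
  RTrace :: "'o \<Rightarrow> 'o \<Rightarrow> 'o \<Rightarrow> 'a \<Rightarrow> 'a"

locale rig_syntax = cat_syntax C for C :: "('o, 'a, 'm) rigcat_scheme"
begin
abbreviation plus_ob (infixr "\<oplus>" 65) where "X \<oplus> Y \<equiv> TOb (Plus C) X Y"
abbreviation plus_ar (infixr "\<oplus>\<^sub>a" 65) where "f \<oplus>\<^sub>a g \<equiv> TAr (Plus C) f g"
abbreviation times_ob (infixr "\<otimes>" 70) where "X \<otimes> Y \<equiv> TOb (Times C) X Y"
abbreviation times_ar (infixr "\<otimes>\<^sub>a" 70) where "f \<otimes>\<^sub>a g \<equiv> TAr (Times C) f g"
abbreviation zero_ob ("\<zero>") where "\<zero> \<equiv> TUnit (Plus C)"
abbreviation one_ob ("\<one>") where "\<one> \<equiv> TUnit (Times C)"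
abbreviation plus_assoc ("\<alpha>\<^sup>+") where "\<alpha>\<^sup>+ \<equiv> Assoc (Plus C)"
abbreviation plus_lunit ("\<lambda>\<^sup>+") where "\<lambda>\<^sup>+ \<equiv> LUnit (Plus C)"
abbreviation plus_runit ("\<rho>\<^sup>+") where "\<rho>\<^sup>+ \<equiv> RUnit (Plus C)"
abbreviation plus_symm ("\<sigma>\<^sup>+") where "\<sigma>\<^sup>+ \<equiv> Symm (Plus C)"
abbreviation times_assoc ("\<alpha>\<^sup>\<times>") where "\<alpha>\<^sup>\<times> \<equiv> Assoc (Times C)"
abbreviation times_lunit ("\<lambda>\<^sup>\<times>") where "\<lambda>\<^sup>\<times> \<equiv> LUnit (Times C)"
abbreviation times_runit ("\<rho>\<^sup>\<times>") where "\<rho>\<^sup>\<times> \<equiv> RUnit (Times C)"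
abbreviation times_symm ("\<sigma>\<^sup>\<times>") where "\<sigma>\<^sup>\<times> \<equiv> Symm (Times C)"
abbreviation dist_l ("\<delta>\<^sup>l") where "\<delta>\<^sup>l \<equiv> DistL C"
abbreviation dist_r ("\<delta>\<^sup>r") where "\<delta>\<^sup>r \<equiv> DistR C"
abbreviation ann_l ("\<lambda>\<^sup>\<bullet>") where "\<lambda>\<^sup>\<bullet> \<equiv> AnnL C"
abbreviation ann_r ("\<rho>\<^sup>\<bullet>") where "\<rho>\<^sup>\<bullet> \<equiv> AnnR C"

abbreviation plus_middle where \<comment> \<open>\<open>(P \<oplus> Q) \<oplus> (U \<oplus> V) \<rightarrow> (P \<oplus> U) \<oplus> (Q \<oplus> V)\<close>\<close>
  "plus_middle P Q U V \<equiv>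
     \<alpha>\<^sup>+ P Q (U \<oplus> V)
     \<Zsemi> (\<i> P \<oplus>\<^sub>a (inv_arrow C (\<alpha>\<^sup>+ Q U V) \<Zsemi> (\<sigma>\<^sup>+ Q U \<oplus>\<^sub>a \<i> V) \<Zsemi> \<alpha>\<^sup>+ U Q V))
     \<Zsemi> inv_arrow C (\<alpha>\<^sup>+ P U (Q \<oplus> V))"
end

text \<open>The assumptions \<open>laplaza1\<close>--\<open>laplaza24\<close> are the axioms (I)--(XXIV) of Laplaza,
  \<^emph>\<open>Coherence for distributivity\<close>, with his associators \<open>X(YZ) \<rightarrow> (XY)Z\<close> replaced by their inverses.\<close>

locale rig_category = rig_syntax C +
    additive: symmetric_monoidal C "Plus C" + multiplicative: symmetric_monoidal C "Times C"
  for C :: "('o, 'a, 'm) rigcat_scheme" +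
  assumes dist_l_iso: "\<lbrakk>X \<in> Ob C; Y \<in> Ob C; Z \<in> Ob C\<rbrakk>
      \<Longrightarrow> \<delta>\<^sup>l X Y Z \<in> iso_hom C (X \<otimes> (Y \<oplus> Z)) ((X \<otimes> Y) \<oplus> (X \<otimes> Z))"
    and dist_l_natural: "\<lbrakk>f \<in> hom C X X'; g \<in> hom C Y Y'; h \<in> hom C Z Z'\<rbrakk>
      \<Longrightarrow> (f \<otimes>\<^sub>a (g \<oplus>\<^sub>a h)) \<Zsemi> \<delta>\<^sup>l X' Y' Z' = \<delta>\<^sup>l X Y Z \<Zsemi> ((f \<otimes>\<^sub>a g) \<oplus>\<^sub>a (f \<otimes>\<^sub>a h))"
    and dist_r_iso: "\<lbrakk>X \<in> Ob C; Y \<in> Ob C; Z \<in> Ob C\<rbrakk>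
      \<Longrightarrow> \<delta>\<^sup>r X Y Z \<in> iso_hom C ((X \<oplus> Y) \<otimes> Z) ((X \<otimes> Z) \<oplus> (Y \<otimes> Z))"
    and dist_r_natural: "\<lbrakk>f \<in> hom C X X'; g \<in> hom C Y Y'; h \<in> hom C Z Z'\<rbrakk>
      \<Longrightarrow> ((f \<oplus>\<^sub>a g) \<otimes>\<^sub>a h) \<Zsemi> \<delta>\<^sup>r X' Y' Z' = \<delta>\<^sup>r X Y Z \<Zsemi> ((f \<otimes>\<^sub>a h) \<oplus>\<^sub>a (g \<otimes>\<^sub>a h))"
    and ann_l_iso: "X \<in> Ob C \<Longrightarrow> \<lambda>\<^sup>\<bullet> X \<in> iso_hom C (\<zero> \<otimes> X) \<zero>"
    and ann_l_natural: "f \<in> hom C X X' \<Longrightarrow> (\<i> \<zero> \<otimes>\<^sub>a f) \<Zsemi> \<lambda>\<^sup>\<bullet> X' = \<lambda>\<^sup>\<bullet> X"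
    and ann_r_iso: "X \<in> Ob C \<Longrightarrow> \<rho>\<^sup>\<bullet> X \<in> iso_hom C (X \<otimes> \<zero>) \<zero>"
    and ann_r_natural: "f \<in> hom C X X' \<Longrightarrow> (f \<otimes>\<^sub>a \<i> \<zero>) \<Zsemi> \<rho>\<^sup>\<bullet> X' = \<rho>\<^sup>\<bullet> X"
    and laplaza1: "\<lbrakk>X \<in> Ob C; Y \<in> Ob C; Z \<in> Ob C\<rbrakk>
      \<Longrightarrow> \<delta>\<^sup>l X Y Z \<Zsemi> \<sigma>\<^sup>+ (X \<otimes> Y) (X \<otimes> Z) = (\<i> X \<otimes>\<^sub>a \<sigma>\<^sup>+ Y Z) \<Zsemi> \<delta>\<^sup>l X Z Y"
    and laplaza2: "\<lbrakk>X \<in> Ob C; Y \<in> Ob C; Z \<in> Ob C\<rbrakk>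
      \<Longrightarrow> \<delta>\<^sup>r X Y Z \<Zsemi> (\<sigma>\<^sup>\<times> X Z \<oplus>\<^sub>a \<sigma>\<^sup>\<times> Y Z) = \<sigma>\<^sup>\<times> (X \<oplus> Y) Z \<Zsemi> \<delta>\<^sup>l Z X Y"
    and laplaza3: "\<lbrakk>X \<in> Ob C; Y \<in> Ob C; Z \<in> Ob C\<rbrakk>
      \<Longrightarrow> \<delta>\<^sup>r X Y Z \<Zsemi> \<sigma>\<^sup>+ (X \<otimes> Z) (Y \<otimes> Z) = (\<sigma>\<^sup>+ X Y \<otimes>\<^sub>a \<i> Z) \<Zsemi> \<delta>\<^sup>r Y X Z"
    and laplaza4: "\<lbrakk>W \<in> Ob C; X \<in> Ob C; Y \<in> Ob C; Z \<in> Ob C\<rbrakk>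
      \<Longrightarrow> \<delta>\<^sup>r (W \<oplus> X) Y Z \<Zsemi> (\<delta>\<^sup>r W X Z \<oplus>\<^sub>a \<i> (Y \<otimes> Z)) \<Zsemi> \<alpha>\<^sup>+ (W \<otimes> Z) (X \<otimes> Z) (Y \<otimes> Z)
        = (\<alpha>\<^sup>+ W X Y \<otimes>\<^sub>a \<i> Z) \<Zsemi> \<delta>\<^sup>r W (X \<oplus> Y) Z \<Zsemi> (\<i> (W \<otimes> Z) \<oplus>\<^sub>a \<delta>\<^sup>r X Y Z)"
    and laplaza5: "\<lbrakk>W \<in> Ob C; X \<in> Ob C; Y \<in> Ob C; Z \<in> Ob C\<rbrakk>
      \<Longrightarrow> \<delta>\<^sup>l W (X \<oplus> Y) Z \<Zsemi> (\<delta>\<^sup>l W X Y \<oplus>\<^sub>a \<i> (W \<otimes> Z)) \<Zsemi> \<alpha>\<^sup>+ (W \<otimes> X) (W \<otimes> Y) (W \<otimes> Z)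
        = (\<i> W \<otimes>\<^sub>a \<alpha>\<^sup>+ X Y Z) \<Zsemi> \<delta>\<^sup>l W X (Y \<oplus> Z) \<Zsemi> (\<i> (W \<otimes> X) \<oplus>\<^sub>a \<delta>\<^sup>l W Y Z)"
    and laplaza6: "\<lbrakk>W \<in> Ob C; X \<in> Ob C; Y \<in> Ob C; Z \<in> Ob C\<rbrakk>
      \<Longrightarrow> \<delta>\<^sup>l (W \<otimes> X) Y Z \<Zsemi> (\<alpha>\<^sup>\<times> W X Y \<oplus>\<^sub>a \<alpha>\<^sup>\<times> W X Z)
        = \<alpha>\<^sup>\<times> W X (Y \<oplus> Z) \<Zsemi> (\<i> W \<otimes>\<^sub>a \<delta>\<^sup>l X Y Z) \<Zsemi> \<delta>\<^sup>l W (X \<otimes> Y) (X \<otimes> Z)"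
    and laplaza7: "\<lbrakk>W \<in> Ob C; X \<in> Ob C; Y \<in> Ob C; Z \<in> Ob C\<rbrakk>
      \<Longrightarrow> (\<delta>\<^sup>r W X Y \<otimes>\<^sub>a \<i> Z) \<Zsemi> \<delta>\<^sup>r (W \<otimes> Y) (X \<otimes> Y) Z \<Zsemi> (\<alpha>\<^sup>\<times> W Y Z \<oplus>\<^sub>a \<alpha>\<^sup>\<times> X Y Z)
        = \<alpha>\<^sup>\<times> (W \<oplus> X) Y Z \<Zsemi> \<delta>\<^sup>r W X (Y \<otimes> Z)"
    and laplaza8: "\<lbrakk>W \<in> Ob C; X \<in> Ob C; Y \<in> Ob C; Z \<in> Ob C\<rbrakk>
      \<Longrightarrow> (\<delta>\<^sup>l W X Y \<otimes>\<^sub>a \<i> Z) \<Zsemi> \<delta>\<^sup>r (W \<otimes> X) (W \<otimes> Y) Z \<Zsemi> (\<alpha>\<^sup>\<times> W X Z \<oplus>\<^sub>a \<alpha>\<^sup>\<times> W Y Z)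
        = \<alpha>\<^sup>\<times> W (X \<oplus> Y) Z \<Zsemi> (\<i> W \<otimes>\<^sub>a \<delta>\<^sup>r X Y Z) \<Zsemi> \<delta>\<^sup>l W (X \<otimes> Z) (Y \<otimes> Z)"
    and laplaza9: "\<lbrakk>W \<in> Ob C; X \<in> Ob C; Y \<in> Ob C; Z \<in> Ob C\<rbrakk>
      \<Longrightarrow> \<delta>\<^sup>r W X (Y \<oplus> Z) \<Zsemi> (\<delta>\<^sup>l W Y Z \<oplus>\<^sub>a \<delta>\<^sup>l X Y Z)
          \<Zsemi> plus_middle (W \<otimes> Y) (W \<otimes> Z) (X \<otimes> Y) (X \<otimes> Z)
        = \<delta>\<^sup>l (W \<oplus> X) Y Z \<Zsemi> (\<delta>\<^sup>r W X Y \<oplus>\<^sub>a \<delta>\<^sup>r W X Z)"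
    and laplaza10: "\<lambda>\<^sup>\<bullet> \<zero> = \<rho>\<^sup>\<bullet> \<zero>"
    and laplaza11: "\<lbrakk>X \<in> Ob C; Y \<in> Ob C\<rbrakk>
      \<Longrightarrow> \<delta>\<^sup>l \<zero> X Y \<Zsemi> (\<lambda>\<^sup>\<bullet> X \<oplus>\<^sub>a \<lambda>\<^sup>\<bullet> Y) \<Zsemi> \<lambda>\<^sup>+ \<zero> = \<lambda>\<^sup>\<bullet> (X \<oplus> Y)"
    and laplaza12: "\<lbrakk>X \<in> Ob C; Y \<in> Ob C\<rbrakk>
      \<Longrightarrow> \<delta>\<^sup>r X Y \<zero> \<Zsemi> (\<rho>\<^sup>\<bullet> X \<oplus>\<^sub>a \<rho>\<^sup>\<bullet> Y) \<Zsemi> \<lambda>\<^sup>+ \<zero> = \<rho>\<^sup>\<bullet> (X \<oplus> Y)"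
    and laplaza13: "\<rho>\<^sup>\<times> \<zero> = \<lambda>\<^sup>\<bullet> \<one>"
    and laplaza14: "\<lambda>\<^sup>\<times> \<zero> = \<rho>\<^sup>\<bullet> \<one>"
    and laplaza15: "X \<in> Ob C \<Longrightarrow> \<rho>\<^sup>\<bullet> X = \<sigma>\<^sup>\<times> X \<zero> \<Zsemi> \<lambda>\<^sup>\<bullet> X"
    and laplaza16: "\<lbrakk>X \<in> Ob C; Y \<in> Ob C\<rbrakk>
      \<Longrightarrow> (\<lambda>\<^sup>\<bullet> X \<otimes>\<^sub>a \<i> Y) \<Zsemi> \<lambda>\<^sup>\<bullet> Y = \<alpha>\<^sup>\<times> \<zero> X Y \<Zsemi> \<lambda>\<^sup>\<bullet> (X \<otimes> Y)"
    and laplaza17: "\<lbrakk>X \<in> Ob C; Y \<in> Ob C\<rbrakk>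
      \<Longrightarrow> (\<rho>\<^sup>\<bullet> X \<otimes>\<^sub>a \<i> Y) \<Zsemi> \<lambda>\<^sup>\<bullet> Y = \<alpha>\<^sup>\<times> X \<zero> Y \<Zsemi> (\<i> X \<otimes>\<^sub>a \<lambda>\<^sup>\<bullet> Y) \<Zsemi> \<rho>\<^sup>\<bullet> X"
    and laplaza18: "\<lbrakk>X \<in> Ob C; Y \<in> Ob C\<rbrakk>
      \<Longrightarrow> \<rho>\<^sup>\<bullet> (X \<otimes> Y) = \<alpha>\<^sup>\<times> X Y \<zero> \<Zsemi> (\<i> X \<otimes>\<^sub>a \<rho>\<^sup>\<bullet> Y) \<Zsemi> \<rho>\<^sup>\<bullet> X"
    and laplaza19: "\<lbrakk>X \<in> Ob C; Y \<in> Ob C\<rbrakk>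
      \<Longrightarrow> \<delta>\<^sup>l X \<zero> Y \<Zsemi> (\<rho>\<^sup>\<bullet> X \<oplus>\<^sub>a \<i> (X \<otimes> Y)) \<Zsemi> \<lambda>\<^sup>+ (X \<otimes> Y) = \<i> X \<otimes>\<^sub>a \<lambda>\<^sup>+ Y"
    and laplaza20: "\<lbrakk>X \<in> Ob C; Y \<in> Ob C\<rbrakk>
      \<Longrightarrow> \<delta>\<^sup>r \<zero> Y X \<Zsemi> (\<lambda>\<^sup>\<bullet> X \<oplus>\<^sub>a \<i> (Y \<otimes> X)) \<Zsemi> \<lambda>\<^sup>+ (Y \<otimes> X) = \<lambda>\<^sup>+ Y \<otimes>\<^sub>a \<i> X"
    and laplaza21: "\<lbrakk>X \<in> Ob C; Y \<in> Ob C\<rbrakk>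
      \<Longrightarrow> \<delta>\<^sup>l X Y \<zero> \<Zsemi> (\<i> (X \<otimes> Y) \<oplus>\<^sub>a \<rho>\<^sup>\<bullet> X) \<Zsemi> \<rho>\<^sup>+ (X \<otimes> Y) = \<i> X \<otimes>\<^sub>a \<rho>\<^sup>+ Y"
    and laplaza22: "\<lbrakk>X \<in> Ob C; Y \<in> Ob C\<rbrakk>
      \<Longrightarrow> \<delta>\<^sup>r X \<zero> Y \<Zsemi> (\<i> (X \<otimes> Y) \<oplus>\<^sub>a \<lambda>\<^sup>\<bullet> Y) \<Zsemi> \<rho>\<^sup>+ (X \<otimes> Y) = \<rho>\<^sup>+ X \<otimes>\<^sub>a \<i> Y"
    and laplaza23: "\<lbrakk>X \<in> Ob C; Y \<in> Ob C\<rbrakk>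
      \<Longrightarrow> \<delta>\<^sup>l \<one> X Y \<Zsemi> (\<lambda>\<^sup>\<times> X \<oplus>\<^sub>a \<lambda>\<^sup>\<times> Y) = \<lambda>\<^sup>\<times> (X \<oplus> Y)"
    and laplaza24: "\<lbrakk>X \<in> Ob C; Y \<in> Ob C\<rbrakk>
      \<Longrightarrow> \<delta>\<^sup>r X Y \<one> \<Zsemi> (\<rho>\<^sup>\<times> X \<oplus>\<^sub>a \<rho>\<^sup>\<times> Y) = \<rho>\<^sup>\<times> (X \<oplus> Y)"

locale right_strict_rig = rig_category C +
    additive: strict_symmetric_monoidal C "Plus C" +
    multiplicative: strict_symmetric_monoidal C "Times C"
  for C :: "('o, 'a, 'm) rigcat_scheme" +
  assumes ann_l_strict: "X \<in> Ob C \<Longrightarrow> \<lambda>\<^sup>\<bullet> X = \<i> \<zero>"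
    and ann_r_strict: "X \<in> Ob C \<Longrightarrow> \<rho>\<^sup>\<bullet> X = \<i> \<zero>"
    and dist_r_strict: "\<lbrakk>X \<in> Ob C; Y \<in> Ob C; Z \<in> Ob C\<rbrakk> \<Longrightarrow> \<delta>\<^sup>r X Y Z = \<i> ((X \<oplus> Y) \<otimes> Z)"

definition right_strict_rig_functor ::
  "('o1, 'a1, 'm1) rigcat_scheme \<Rightarrow> ('o2, 'a2, 'm2) rigcat_scheme \<Rightarrow> ('o1, 'a1, 'o2, 'a2) fnctr \<Rightarrow> bool" where
  "right_strict_rig_functor C D F \<longleftrightarrow>
     strict_sm_functor C (Plus C) D (Plus D) F \<and> strict_sm_functor C (Times C) D (Times D) F
     \<and> (\<forall>X\<in>Ob C. \<forall>Y\<in>Ob C. \<forall>Z\<in>Ob C.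
          FAr F (DistL C X Y Z) = DistL D (FOb F X) (FOb F Y) (FOb F Z))"

text \<open>In a uniformly traced rig category the trace is understood relative to the rig structure:
  the functors \<open>- \<otimes> Z\<close>, which in the right strict case are strict symmetric monoidal for \<open>\<oplus>\<close>,
  preserve it. (For \<open>Z \<otimes> -\<close> this follows by conjugation with the symmetry.)

  This condition does not follow from the trace axioms for \<open>\<oplus>\<close>, and the adjunction between \<open>RIG\<close>
  and \<open>RIGUTr\<close> fails without it. Let \<open>R = {0 < 1 < w}\<close> be the commutative semiring with maximum as
  addition and \<open>w * w = w\<close>; put \<open>1* = 1\<close> (infinite sums are suprema) or \<open>1* = w\<close> (infinite sums with
  infinitely many nonzero terms are \<open>w\<close>). Each choice makes \<open>R\<close> a complete semiring and so gives a
  uniform trace on matrices over \<open>R\<close>. In the rig category of degree-preserving matrices between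
  finite lists of degrees (natural numbers, added by \<open>\<otimes>\<close>), use the first trace in degree \<open>0\<close> and
  the second one in all others: \<open>- \<otimes> Z\<close> does not preserve the trace when \<open>Z\<close> is the list \<open>[1]\<close>.\<close>

definition tensor_preserves_trace :: "('o, 'a, 'm) utrigcat_scheme \<Rightarrow> bool" where
  "tensor_preserves_trace C \<longleftrightarrow>
     (\<forall>Z\<in>Ob C. preserves_trace C (Plus C) (RTrace C) (RTrace C)
        \<lparr>FOb = (\<lambda>X. TOb (Times C) X Z), FAr = (\<lambda>f. TAr (Times C) f (Idt C Z))\<rparr>)"

definition uniformly_traced_rig :: "('o, 'a, 'm) utrigcat_scheme \<Rightarrow> bool" where
  "uniformly_traced_rig C \<longleftrightarrow> right_strict_rig C
     \<and> uniformly_traced C (Plus C) (RTrace C) \<and> tensor_preserves_trace C"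


section \<open>The categories of structured categories\<close>

text \<open>An arrow records its source and target. Smallness is relative to the types \<open>'o\<close> and \<open>'a\<close> of
  objects and arrows. The functors are extensional, so that HOL equality is equality of functors.\<close>

record ('x, 'o, 'a) marr =
  Src :: "'x"
  Trg :: "'x"
  Fun :: "('o, 'a, 'o, 'a) fnctr"

definition struct_cat ::
  "(('o, 'a, 'm) cat_scheme \<Rightarrow> bool) \<Rightarrow>
   (('o, 'a, 'm) cat_scheme \<Rightarrow> ('o, 'a, 'm) cat_scheme \<Rightarrow> ('o, 'a, 'o, 'a) fnctr \<Rightarrow> bool) \<Rightarrow>
   (('o, 'a, 'm) cat_scheme, (('o, 'a, 'm) cat_scheme, 'o, 'a) marr) cat" where
  "struct_cat P H = \<lparr>
     Ob = {C. P C},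
     Ar = {m. P (Src m) \<and> P (Trg m) \<and> H (Src m) (Trg m) (Fun m)
             \<and> FOb (Fun m) \<in> extensional (Ob (Src m)) \<and> FAr (Fun m) \<in> extensional (Ar (Src m))},
     Dom = Src,
     Cod = Trg,
     Idt = (\<lambda>C. \<lparr>Src = C, Trg = C, Fun = \<lparr>FOb = \<lambda>X\<in>Ob C. X, FAr = \<lambda>f\<in>Ar C. f\<rparr>\<rparr>),
     Cmp = (\<lambda>m n. \<lparr>Src = Src m, Trg = Trg n,
              Fun = \<lparr>FOb = compose (Ob (Src m)) (FOb (Fun n)) (FOb (Fun m)),
                     FAr = compose (Ar (Src m)) (FAr (Fun n)) (FAr (Fun m))\<rparr>\<rparr>)\<rparr>"

definition SMC :: "(('o, 'a) smcat, (('o, 'a) smcat, 'o, 'a) marr) cat" where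
  "SMC = struct_cat
     (\<lambda>C. strict_symmetric_monoidal C (Plus C))
     (\<lambda>C D. strict_sm_functor C (Plus C) D (Plus D))"

definition UTSMC :: "(('o, 'a) utsmcat, (('o, 'a) utsmcat, 'o, 'a) marr) cat" where
  "UTSMC = struct_cat
     (\<lambda>C. uniformly_traced C (Plus C) (Trace C))
     (\<lambda>C D F. strict_sm_functor C (Plus C) D (Plus D) F
        \<and> preserves_trace C (Plus C) (Trace C) (Trace D) F)"

definition RIG :: "(('o, 'a) rigcat, (('o, 'a) rigcat, 'o, 'a) marr) cat" where
  "RIG = struct_cat right_strict_rig right_strict_rig_functor"

definition RIGUTr :: "(('o, 'a) utrigcat, (('o, 'a) utrigcat, 'o, 'a) marr) cat" where
  "RIGUTr = struct_cat
     uniformly_traced_rig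
     (\<lambda>C D F. right_strict_rig_functor C D F
        \<and> preserves_trace C (Plus C) (RTrace C) (RTrace D) F)"

definition forget :: "('x \<Rightarrow> 'y) \<Rightarrow> ('x, ('x, 'o, 'a) marr, 'y, ('y, 'o, 'a) marr) fnctr" where
  "forget U = \<lparr>FOb = U, FAr = (\<lambda>m. \<lparr>Src = U (Src m), Trg = U (Trg m), Fun = Fun m\<rparr>)\<rparr>"

definition UTSMC_to_SMC ::
  "(('o, 'a) utsmcat, (('o, 'a) utsmcat, 'o, 'a) marr, ('o, 'a) smcat, (('o, 'a) smcat, 'o, 'a) marr) fnctr" where
  "UTSMC_to_SMC = forget smcat.truncate"

definition RIGUTr_to_RIG ::
  "(('o, 'a) utrigcat, (('o, 'a) utrigcat, 'o, 'a) marr, ('o, 'a) rigcat, (('o, 'a) rigcat, 'o, 'a) marr) fnctr" where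
  "RIGUTr_to_RIG = forget rigcat.truncate"

definition RIG_to_SMC ::
  "(('o, 'a) rigcat, (('o, 'a) rigcat, 'o, 'a) marr, ('o, 'a) smcat, (('o, 'a) smcat, 'o, 'a) marr) fnctr" where
  "RIG_to_SMC = forget smcat.truncate"

definition RIGUTr_to_UTSMC ::
  "(('o, 'a) utrigcat, (('o, 'a) utrigcat, 'o, 'a) marr, ('o, 'a) utsmcat, (('o, 'a) utsmcat, 'o, 'a) marr) fnctr" where
  "RIGUTr_to_UTSMC = forget (\<lambda>C. \<lparr>Ob = Ob C, Ar = Ar C, Dom = Dom C, Cod = Cod C, Idt = Idt C,
      Cmp = Cmp C, Plus = Plus C, Trace = RTrace C\<rparr>)"

text \<open>A left adjoint is determined only up to isomorphism, so the objects of \<open>D\<close> are identified with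
  those of \<open>C\<close> along the object part of \<open>h\<close>. The intended \<open>h\<close> is a component of the unit.\<close>

definition tensor_agrees_on_objects ::
  "('o, 'a, 'm) rigcat_scheme \<Rightarrow> ('o, 'a, 'n) rigcat_scheme \<Rightarrow> ('o, 'a, 'o, 'a) fnctr \<Rightarrow> bool" where
  "tensor_agrees_on_objects C D h \<longleftrightarrow> bij_betw (FOb h) (Ob C) (Ob D)
     \<and> (\<forall>X\<in>Ob C. \<forall>Y\<in>Ob C. TOb (Times D) (FOb h X) (FOb h Y) = FOb h (TOb (Times C) X Y))
     \<and> TUnit (Times D) = FOb h (TUnit (Times C))"

definition structural_isos_are_images ::
  "('o, 'a, 'm) rigcat_scheme \<Rightarrow> ('o, 'a, 'n) rigcat_scheme \<Rightarrow> ('o, 'a, 'o, 'a) fnctr \<Rightarrow> bool" where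
  "structural_isos_are_images C D h \<longleftrightarrow> (\<forall>X\<in>Ob C. \<forall>Y\<in>Ob C. \<forall>Z\<in>Ob C.
     (\<forall>(M, N)\<in>{(Plus C, Plus D), (Times C, Times D)}.
        Assoc N (FOb h X) (FOb h Y) (FOb h Z) = FAr h (Assoc M X Y Z)
      \<and> LUnit N (FOb h X) = FAr h (LUnit M X)
      \<and> RUnit N (FOb h X) = FAr h (RUnit M X)
      \<and> Symm N (FOb h X) (FOb h Y) = FAr h (Symm M X Y))
   \<and> DistL D (FOb h X) (FOb h Y) (FOb h Z) = FAr h (DistL C X Y Z)
   \<and> DistR D (FOb h X) (FOb h Y) (FOb h Z) = FAr h (DistR C X Y Z)
   \<and> AnnL D (FOb h X) = FAr h (AnnL C X)
   \<and> AnnR D (FOb h X) = FAr h (AnnR C X))"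

end

theory Submission
  imports Defs
begin

text \<open>Write \<open>D\<close> for the free uniformly traced category on \<open>(C, \<oplus>, 0)\<close>. By universality the unit \<open>C \<rightarrow> D\<close> is
  bijective on objects, and every arrow of \<open>D\<close> is obtained from images of arrows of \<open>C\<close> by composition,
  \<open>\<oplus>\<close> and trace. In a right strict rig category each \<open>- \<otimes> Z\<close> is a strict symmetric monoidal endofunctor
  for \<open>\<oplus>\<close>, so \<open>L\<close> extends it to \<open>D\<close>; conjugating with the symmetry gives \<open>Z \<otimes> -\<close>. That the two kinds of
  whiskering commute, so that \<open>\<otimes>\<close> is a bifunctor on \<open>D\<close>, is proved by induction over the generation of
  arrows, and the trace step is exactly uniformity. The same induction gives naturality of
  \<open>\<delta>\<^sup>l\<close>, while the coherence axioms only concern images of arrows of \<open>C\<close>. The unit, the counit and the functors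
  \<open>L F\<close> preserve \<open>\<otimes>\<close> by naturality and functoriality, so the adjunction lifts along the faithful forgetful
  functors.\<close>

section \<open>Strict monoidal categories and traces\<close>

text \<open>Nothing is known about \<open>L\<close> except the adjunction, so generation by traces
  and injectivity of the unit on objects have to be extracted from the universal property, and the
  rig structure has to be transported along the unit, because \<open>L C\<close> has objects of its
  own. The asymmetric shape of the construction comes from right strictness:
  \<open>- \<otimes> Z\<close> is an arrow of \<open>SMC\<close> to which \<open>L\<close> can be
  applied, whereas \<open>Z \<otimes> -\<close> is additive only up to
  \<open>\<delta>\<^sup>l\<close>. Left whiskering obtained by conjugation is compatible with the
  symmetry for free, but its additivity in the object \<open>Z\<close> is not automatic. That
  additivity rests on naturality of \<open>\<delta>\<^sup>l\<close> in its first argument, and the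
  interchange law needs it in its own induction, both for sums and to recognise the hypothesis of
  uniformity. This dictates the order: first naturality of \<open>\<delta>\<^sup>l\<close> in one
  argument, then additivity, then interchange, and only then the bifunctor.\<close>

context category
begin

lemma in_hom_iff: "f \<in> hom C X Y \<longleftrightarrow> f \<in> Ar C \<and> Dom C f = X \<and> Cod C f = Y"
  by (auto simp: hom_def)

lemma arr_ob [simp]: "f \<in> Ar C \<Longrightarrow> Dom C f \<in> Ob C" "f \<in> Ar C \<Longrightarrow> Cod C f \<in> Ob C"
  by (simp_all add: dom_ob cod_ob)

lemma ident_arr [simp]:
  assumes "X \<in> Ob C"
  shows "\<i> X \<in> Ar C" "Dom C (\<i> X) = X" "Cod C (\<i> X) = X"
  using id_hom[OF assms] by (auto simp: hom_def)

lemma comp_arr [simp]: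
  assumes "f \<in> Ar C" "g \<in> Ar C" "Cod C f = Dom C g"
  shows "f \<Zsemi> g \<in> Ar C" "Dom C (f \<Zsemi> g) = Dom C f" "Cod C (f \<Zsemi> g) = Cod C g"
  using comp_hom[of f "Dom C f" "Dom C g" g "Cod C g"] assms by (auto simp: hom_def)

lemma ident_comp [simp]: "f \<in> Ar C \<Longrightarrow> Dom C f = X \<Longrightarrow> \<i> X \<Zsemi> f = f"
  using id_comp[of f X "Cod C f"] by (simp add: hom_def)

lemma comp_ident [simp]: "f \<in> Ar C \<Longrightarrow> Cod C f = Y \<Longrightarrow> f \<Zsemi> \<i> Y = f"
  using comp_id[of f "Dom C f" Y] by (simp add: hom_def)

lemma arr_comp_assoc:
  "\<lbrakk>f \<in> Ar C; g \<in> Ar C; k \<in> Ar C; Cod C f = Dom C g; Cod C g = Dom C k\<rbrakk>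
    \<Longrightarrow> (f \<Zsemi> g) \<Zsemi> k = f \<Zsemi> (g \<Zsemi> k)"
  using comp_assoc[of f "Dom C f" "Dom C g" g "Dom C k" k "Cod C k"] by (simp add: hom_def)

lemma inv_arrow_eqI:
  assumes "inverse_arrows C f g"
  shows "inv_arrow C f = g"
  unfolding inv_arrow_def
proof (rule the_equality)
  show "inverse_arrows C f g" by fact
next
  fix g' assume g': "inverse_arrows C f g'"
  have "g' = g' \<Zsemi> (f \<Zsemi> g)" "g = (g' \<Zsemi> f) \<Zsemi> g"
    using assms g' by (auto simp: inverse_arrows_def in_hom_iff)
  then show "g' = g"
    using assms g' arr_comp_assoc[of g' f g] by (auto simp: inverse_arrows_def in_hom_iff)
qed

lemma inv_arrow_ident [simp]: "X \<in> Ob C \<Longrightarrow> inv_arrow C (\<i> X) = \<i> X"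
  by (rule inv_arrow_eqI) (simp add: inverse_arrows_def in_hom_iff)

text \<open>Read from left to right, this extracts object equations from strictness: a coherence
  isomorphism that happens to be an identity forces the two objects in its typing to
  coincide.\<close>

lemma ident_iso [simp]: "X \<in> Ob C \<Longrightarrow> \<i> X \<in> iso_hom C Y Z \<longleftrightarrow> Y = X \<and> Z = X"
  by (auto simp: iso_hom_def inverse_arrows_def in_hom_iff intro!: exI[of _ "\<i> X"])

lemma iso_homD: "f \<in> iso_hom C X Y \<Longrightarrow> f \<in> Ar C \<and> Dom C f = X \<and> Cod C f = Y"
  by (simp add: iso_hom_def hom_def)

end

context symmetric_monoidal
begin

declare tensor_ob [simp] unit_ob [simp] tensor_id [simp]

lemma tensor_arr [simp]:
  assumes "f \<in> Ar C" "g \<in> Ar C"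
  shows "f \<odot>\<^sub>a g \<in> Ar C" "Dom C (f \<odot>\<^sub>a g) = Dom C f \<odot> Dom C g" "Cod C (f \<odot>\<^sub>a g) = Cod C f \<odot> Cod C g"
  using tensor_hom[of f "Dom C f" "Cod C f" g "Dom C g" "Cod C g"] assms by (auto simp: hom_def)

lemma symm_arr [simp]:
  assumes "X \<in> Ob C" "Y \<in> Ob C"
  shows "\<sigma> X Y \<in> Ar C" "Dom C (\<sigma> X Y) = X \<odot> Y" "Cod C (\<sigma> X Y) = Y \<odot> X"
  using symm_hom[OF assms] by (auto simp: hom_def)

declare symm_invol [simp]

lemma tensor_arr_comp:
  "\<lbrakk>f \<in> Ar C; f' \<in> Ar C; g \<in> Ar C; g' \<in> Ar C; Cod C f = Dom C f'; Cod C g = Dom C g'\<rbrakk>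
    \<Longrightarrow> (f \<odot>\<^sub>a g) \<Zsemi> (f' \<odot>\<^sub>a g') = (f \<Zsemi> f') \<odot>\<^sub>a (g \<Zsemi> g')"
  using tensor_comp[of f "Dom C f" "Dom C f'" f' "Cod C f'" g "Dom C g" "Dom C g'" g' "Cod C g'"]
  by (simp add: hom_def)

lemma symm_arr_natural:
  "\<lbrakk>f \<in> Ar C; g \<in> Ar C\<rbrakk> \<Longrightarrow>
    (f \<odot>\<^sub>a g) \<Zsemi> \<sigma> (Cod C f) (Cod C g) = \<sigma> (Dom C f) (Dom C g) \<Zsemi> (g \<odot>\<^sub>a f)"
  by (rule symm_natural) (auto simp: hom_def)

end

context strict_symmetric_monoidal
begin

lemma tensor_ob_assoc [simp]:
  assumes "X \<in> Ob C" "Y \<in> Ob C" "Z \<in> Ob C"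
  shows "(X \<odot> Y) \<odot> Z = X \<odot> Y \<odot> Z"
  using assoc_iso[OF assms] assms by (simp add: assoc_strict)

lemma tensor_ob_unit [simp]:
  assumes "X \<in> Ob C"
  shows "\<I> \<odot> X = X" "X \<odot> \<I> = X"
  using lunit_iso[OF assms] runit_iso[OF assms] assms by (simp_all add: lunit_strict runit_strict)

lemma tensor_arr_assoc [simp]:
  assumes "f \<in> Ar C" "g \<in> Ar C" "k \<in> Ar C"
  shows "(f \<odot>\<^sub>a g) \<odot>\<^sub>a k = f \<odot>\<^sub>a g \<odot>\<^sub>a k"
  using assoc_natural[of f "Dom C f" "Cod C f" g "Dom C g" "Cod C g" k "Dom C k" "Cod C k"] assms
  by (simp add: hom_def assoc_strict)

lemma tensor_arr_unit [simp]:
  assumes "f \<in> Ar C"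
  shows "\<i> \<I> \<odot>\<^sub>a f = f" "f \<odot>\<^sub>a \<i> \<I> = f"
  using lunit_natural[of f "Dom C f" "Cod C f"] runit_natural[of f "Dom C f" "Cod C f"] assms
  by (simp_all add: hom_def lunit_strict runit_strict)

lemma symm_tensor_right:
  assumes "X \<in> Ob C" "Y \<in> Ob C" "Z \<in> Ob C"
  shows "\<sigma> X (Y \<odot> Z) = (\<sigma> X Y \<odot>\<^sub>a \<i> Z) \<Zsemi> (\<i> Y \<odot>\<^sub>a \<sigma> X Z)"
  using hexagon[OF assms] assms by (simp add: assoc_strict)

text \<open>Both sides are inverse to \<open>\<sigma> Z (X \<odot> Y)\<close>: the left one by
  involutivity, the right one because \<open>symm_tensor_right\<close> factors that symmetry into
  the two inverse swaps.\<close>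

lemma symm_tensor_left:
  assumes "X \<in> Ob C" "Y \<in> Ob C" "Z \<in> Ob C"
  shows "\<sigma> (X \<odot> Y) Z = (\<i> X \<odot>\<^sub>a \<sigma> Y Z) \<Zsemi> (\<sigma> X Z \<odot>\<^sub>a \<i> Y)"
proof -
  let ?r = "(\<i> X \<odot>\<^sub>a \<sigma> Y Z) \<Zsemi> (\<sigma> X Z \<odot>\<^sub>a \<i> Y)"
  have "\<sigma> Z (X \<odot> Y) \<Zsemi> ?r
      = (\<sigma> Z X \<odot>\<^sub>a \<i> Y) \<Zsemi> ((\<i> X \<odot>\<^sub>a \<sigma> Z Y) \<Zsemi> (\<i> X \<odot>\<^sub>a \<sigma> Y Z)) \<Zsemi> (\<sigma> X Z \<odot>\<^sub>a \<i> Y)"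
    using assms by (simp add: symm_tensor_right arr_comp_assoc)
  also have "\<dots> = \<i> (Z \<odot> X \<odot> Y)"
    using assms by (simp add: tensor_arr_comp)
  finally have eq: "\<sigma> Z (X \<odot> Y) \<Zsemi> ?r = \<i> (Z \<odot> X \<odot> Y)" .
  have "?r = (\<sigma> (X \<odot> Y) Z \<Zsemi> \<sigma> Z (X \<odot> Y)) \<Zsemi> ?r"
    using assms by (simp del: tensor_ob_assoc add: tensor_ob_assoc[symmetric])
  also have "\<dots> = \<sigma> (X \<odot> Y) Z \<Zsemi> (\<sigma> Z (X \<odot> Y) \<Zsemi> ?r)"
    using assms by (subst arr_comp_assoc) simp_all
  also have "\<dots> = \<sigma> (X \<odot> Y) Z"
    unfolding eq using assms by simp
  finally show ?thesis by simp
qed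

text \<open>The hexagon at two unit objects makes \<open>\<sigma> X \<I>\<close> idempotent, and an
  invertible idempotent is an identity.\<close>

lemma symm_unit [simp]:
  assumes X: "X \<in> Ob C"
  shows "\<sigma> X \<I> = \<i> X" "\<sigma> \<I> X = \<i> X"
proof -
  have *: "\<sigma> X \<I> \<Zsemi> \<sigma> X \<I> = \<sigma> X \<I>"
    using symm_tensor_right[OF X unit_ob unit_ob] X by simp
  have "\<sigma> X \<I> \<Zsemi> (\<sigma> X \<I> \<Zsemi> \<sigma> \<I> X) = \<sigma> X \<I> \<Zsemi> \<sigma> \<I> X"
    using X by (subst arr_comp_assoc[symmetric]) (simp_all only: *, simp_all)
  then show "\<sigma> X \<I> = \<i> X" using X by simp
  then show "\<sigma> \<I> X = \<i> X" using symm_invol[OF X unit_ob] X by simp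
qed

text \<open>A form of the Yang-Baxter equation: both sides reverse the order of three factors. It is
  naturality of the symmetry against \<open>\<sigma> Y Z\<close>. Together with its mirror image
  below it later shows that left whiskering by a product is iterated left whiskering.\<close>

lemma symm_braid:
  assumes [simp]: "X \<in> Ob C" "Y \<in> Ob C" "Z \<in> Ob C"
  shows "\<sigma> X (Y \<odot> Z) \<Zsemi> (\<sigma> Y Z \<odot>\<^sub>a \<i> X) = \<sigma> (X \<odot> Y) Z \<Zsemi> (\<i> Z \<odot>\<^sub>a \<sigma> X Y)"
proof -
  have "\<sigma> X (Y \<odot> Z) \<Zsemi> (\<sigma> Y Z \<odot>\<^sub>a \<i> X) = (\<i> X \<odot>\<^sub>a \<sigma> Y Z) \<Zsemi> \<sigma> X (Z \<odot> Y)"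
    using symm_arr_natural[of "\<i> X" "\<sigma> Y Z"] by simp
  also have "\<dots> = \<sigma> (X \<odot> Y) Z \<Zsemi> (\<i> Z \<odot>\<^sub>a \<sigma> X Y)"
    by (simp add: symm_tensor_left symm_tensor_right[of X Z Y] arr_comp_assoc)
  finally show ?thesis .
qed

lemma symm_braid':
  assumes [simp]: "X \<in> Ob C" "Y \<in> Ob C" "Z \<in> Ob C"
  shows "(\<sigma> Z Y \<odot>\<^sub>a \<i> X) \<Zsemi> \<sigma> (Y \<odot> Z) X = (\<i> Z \<odot>\<^sub>a \<sigma> Y X) \<Zsemi> \<sigma> Z (X \<odot> Y)"
proof -
  have "(\<sigma> Z Y \<odot>\<^sub>a \<i> X) \<Zsemi> \<sigma> (Y \<odot> Z) X = \<sigma> (Z \<odot> Y) X \<Zsemi> (\<i> X \<odot>\<^sub>a \<sigma> Z Y)"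
    using symm_arr_natural[of "\<sigma> Z Y" "\<i> X"] by simp
  also have "\<dots> = (\<i> Z \<odot>\<^sub>a \<sigma> Y X) \<Zsemi> \<sigma> Z (X \<odot> Y)"
    by (simp add: symm_tensor_left symm_tensor_right[of Z X Y] arr_comp_assoc)
  finally show ?thesis .
qed

abbreviation middle where \<comment> \<open>\<open>P \<odot> Q \<odot> U \<odot> V \<rightarrow> P \<odot> U \<odot> Q \<odot> V\<close>\<close>
  "middle P Q U V \<equiv> \<i> P \<odot>\<^sub>a \<sigma> Q U \<odot>\<^sub>a \<i> V"

lemma middle_invol:
  assumes "P \<in> Ob C" "Q \<in> Ob C" "U \<in> Ob C" "V \<in> Ob C"
  shows "middle P Q U V \<Zsemi> middle P U Q V = \<i> (P \<odot> Q \<odot> U \<odot> V)"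
  using assms by (simp add: tensor_arr_comp)

text \<open>After reassociation only the two inner factors are moved, so this is naturality of the
  symmetry. Associativity is kept out of the simplifier in between to preserve the grouping of
  \<open>q\<close> with \<open>u\<close>.\<close>

lemma middle_natural:
  assumes "p \<in> Ar C" "q \<in> Ar C" "u \<in> Ar C" "v \<in> Ar C"
  shows "((p \<odot>\<^sub>a q) \<odot>\<^sub>a (u \<odot>\<^sub>a v)) \<Zsemi> middle (Cod C p) (Cod C q) (Cod C u) (Cod C v)
    = middle (Dom C p) (Dom C q) (Dom C u) (Dom C v) \<Zsemi> ((p \<odot>\<^sub>a u) \<odot>\<^sub>a (q \<odot>\<^sub>a v))"
proof -
  have "(p \<odot>\<^sub>a (q \<odot>\<^sub>a u) \<odot>\<^sub>a v) \<Zsemi> middle (Cod C p) (Cod C q) (Cod C u) (Cod C v)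
    = p \<odot>\<^sub>a ((q \<odot>\<^sub>a u) \<Zsemi> \<sigma> (Cod C q) (Cod C u)) \<odot>\<^sub>a v"
    using assms by (simp add: tensor_arr_comp del: tensor_arr_assoc)
  also have "\<dots> = middle (Dom C p) (Dom C q) (Dom C u) (Dom C v) \<Zsemi> (p \<odot>\<^sub>a (u \<odot>\<^sub>a q) \<odot>\<^sub>a v)"
    using assms by (simp add: tensor_arr_comp symm_arr_natural del: tensor_arr_assoc)
  finally show ?thesis using assms by simp
qed

end

section \<open>Traces of tensor products\<close>

context uniformly_traced
begin

lemma trace_arr [simp]:
  assumes "S \<in> Ob C" "X \<in> Ob C" "Y \<in> Ob C" "f \<in> Ar C" "Dom C f = S \<odot> X" "Cod C f = S \<odot> Y"
  shows "tr S X Y f \<in> Ar C" "Dom C (tr S X Y f) = X" "Cod C (tr S X Y f) = Y"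
  using trace_hom[of S X Y f] assms by (auto simp: hom_def)

text \<open>Strength with the passive factor on the left. The body is rewritten as
  \<open>q \<odot>\<^sub>a \<i> X\<close> between symmetries that leave \<open>B\<close> fixed;
  these leave the trace by tightening, strength applies to the rest, and naturality of the symmetry
  carries the result back.\<close>

lemma strength_left:
  assumes "B \<in> Ob C" "X \<in> Ob C" "Y \<in> Ob C" "Y' \<in> Ob C" and q: "q \<in> hom C (B \<odot> Y) (B \<odot> Y')"
  shows "tr B (X \<odot> Y) (X \<odot> Y') ((\<sigma> B X \<odot>\<^sub>a \<i> Y) \<Zsemi> (\<i> X \<odot>\<^sub>a q) \<Zsemi> (\<sigma> X B \<odot>\<^sub>a \<i> Y'))
    = \<i> X \<odot>\<^sub>a tr B Y Y' q"
proof -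
  have qa [simp]: "q \<in> Ar C" "Dom C q = B \<odot> Y" "Cod C q = B \<odot> Y'"
    using q by (auto simp: hom_def)
  note [simp] = assms(1-4)
  have 1: "(\<i> B \<odot>\<^sub>a \<sigma> X Y) \<Zsemi> \<sigma> (B \<odot> Y) X = \<sigma> B X \<odot>\<^sub>a \<i> Y"
    by (simp add: symm_tensor_left arr_comp_assoc[symmetric] tensor_arr_comp)
  have 2: "\<sigma> X (B \<odot> Y') \<Zsemi> (\<i> B \<odot>\<^sub>a \<sigma> Y' X) = \<sigma> X B \<odot>\<^sub>a \<i> Y'"
    by (simp add: symm_tensor_right arr_comp_assoc tensor_arr_comp)
  have 3: "q \<odot>\<^sub>a \<i> X = \<sigma> (B \<odot> Y) X \<Zsemi> (\<i> X \<odot>\<^sub>a q) \<Zsemi> \<sigma> X (B \<odot> Y')"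
  proof -
    have "\<sigma> (B \<odot> Y) X \<Zsemi> (\<i> X \<odot>\<^sub>a q) \<Zsemi> \<sigma> X (B \<odot> Y')
      = \<sigma> (B \<odot> Y) X \<Zsemi> (\<sigma> X (B \<odot> Y) \<Zsemi> (q \<odot>\<^sub>a \<i> X))"
      using symm_arr_natural[of "\<i> X" q] by (simp add: arr_comp_assoc)
    also have "\<dots> = (\<sigma> (B \<odot> Y) X \<Zsemi> \<sigma> X (B \<odot> Y)) \<Zsemi> (q \<odot>\<^sub>a \<i> X)"
      by (subst arr_comp_assoc) simp_all
    finally show ?thesis by (simp add: symm_invol)
  qed
  have "(\<i> B \<odot>\<^sub>a \<sigma> X Y) \<Zsemi> (q \<odot>\<^sub>a \<i> X) \<Zsemi> (\<i> B \<odot>\<^sub>a \<sigma> Y' X)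
    = ((\<i> B \<odot>\<^sub>a \<sigma> X Y) \<Zsemi> \<sigma> (B \<odot> Y) X) \<Zsemi> (\<i> X \<odot>\<^sub>a q) \<Zsemi> (\<sigma> X (B \<odot> Y') \<Zsemi> (\<i> B \<odot>\<^sub>a \<sigma> Y' X))"
    unfolding 3 by (simp add: arr_comp_assoc)
  then have "tr B (X \<odot> Y) (X \<odot> Y') ((\<sigma> B X \<odot>\<^sub>a \<i> Y) \<Zsemi> (\<i> X \<odot>\<^sub>a q) \<Zsemi> (\<sigma> X B \<odot>\<^sub>a \<i> Y'))
    = tr B (X \<odot> Y) (X \<odot> Y') ((\<i> B \<odot>\<^sub>a \<sigma> X Y) \<Zsemi> (q \<odot>\<^sub>a \<i> X) \<Zsemi> (\<i> B \<odot>\<^sub>a \<sigma> Y' X))"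
    unfolding 1 2 by simp
  also have "\<dots> = \<sigma> X Y \<Zsemi> tr B (Y \<odot> X) (Y' \<odot> X) (q \<odot>\<^sub>a \<i> X) \<Zsemi> \<sigma> Y' X"
    by (rule tightening) (auto simp: hom_def)
  also have "\<dots> = \<sigma> X Y \<Zsemi> (tr B Y Y' q \<odot>\<^sub>a \<i> X) \<Zsemi> \<sigma> Y' X"
    by (subst strength) (auto simp: hom_def)
  also have "\<dots> = \<sigma> X Y \<Zsemi> (\<sigma> Y X \<Zsemi> (\<i> X \<odot>\<^sub>a tr B Y Y' q))"
    using symm_arr_natural[of "tr B Y Y' q" "\<i> X"] by (simp add: arr_comp_assoc)
  also have "\<dots> = \<i> X \<odot>\<^sub>a tr B Y Y' q"
    by (subst arr_comp_assoc[symmetric]) simp_all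
  finally show ?thesis .
qed

text \<open>By joining, the trace over \<open>A \<odot> B\<close> is a trace over \<open>A\<close>
  inside a trace over \<open>B\<close>; strength evaluates the inner one and
  \<open>strength_left\<close> the outer one. The result presents a tensor of two traces as a single
  trace, the form in which uniformity can compare it with another trace.\<close>

lemma trace_tensor:
  assumes "A \<in> Ob C" "B \<in> Ob C" "X \<in> Ob C" "X' \<in> Ob C" "Y \<in> Ob C" "Y' \<in> Ob C"
    and p: "p \<in> hom C (A \<odot> X) (A \<odot> X')" and q: "q \<in> hom C (B \<odot> Y) (B \<odot> Y')"
  shows "tr (A \<odot> B) (X \<odot> Y) (X' \<odot> Y') (middle A B X Y \<Zsemi> (p \<odot>\<^sub>a q) \<Zsemi> middle A X' B Y')
    = tr A X X' p \<odot>\<^sub>a tr B Y Y' q"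
proof -
  have [simp]: "p \<in> Ar C" "Dom C p = A \<odot> X" "Cod C p = A \<odot> X'"
    "q \<in> Ar C" "Dom C q = B \<odot> Y" "Cod C q = B \<odot> Y'"
    using p q by (auto simp: hom_def)
  note [simp] = assms(1-6)
  let ?k = "tr A X X' p"
  have "tr (A \<odot> B) (X \<odot> Y) (X' \<odot> Y') (middle A B X Y \<Zsemi> (p \<odot>\<^sub>a q) \<Zsemi> middle A X' B Y')
    = tr B (X \<odot> Y) (X' \<odot> Y') (tr A (B \<odot> X \<odot> Y) (B \<odot> X' \<odot> Y')
        (middle A B X Y \<Zsemi> (p \<odot>\<^sub>a q) \<Zsemi> middle A X' B Y'))"
    by (rule joining[symmetric]) (auto simp: hom_def)
  also have "tr A (B \<odot> X \<odot> Y) (B \<odot> X' \<odot> Y') (middle A B X Y \<Zsemi> (p \<odot>\<^sub>a q) \<Zsemi> middle A X' B Y')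
    = (\<sigma> B X \<odot>\<^sub>a \<i> Y) \<Zsemi> tr A (X \<odot> B \<odot> Y) (X' \<odot> B \<odot> Y') (p \<odot>\<^sub>a q) \<Zsemi> (\<sigma> X' B \<odot>\<^sub>a \<i> Y')"
    by (rule tightening) (auto simp: hom_def)
  also have "tr A (X \<odot> B \<odot> Y) (X' \<odot> B \<odot> Y') (p \<odot>\<^sub>a q) = ?k \<odot>\<^sub>a q"
    by (rule strength) (auto simp: hom_def)
  \<comment> \<open>The finished trace \<open>?k\<close> has to leave the trace over
    \<open>B\<close>. It is split off after \<open>q\<close> and moved past \<open>B\<close> by
    naturality of the symmetry, where tightening can pull it out.\<close>
  also have "(\<sigma> B X \<odot>\<^sub>a \<i> Y) \<Zsemi> (?k \<odot>\<^sub>a q) \<Zsemi> (\<sigma> X' B \<odot>\<^sub>a \<i> Y')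
    = (\<i> B \<odot>\<^sub>a \<i> (X \<odot> Y)) \<Zsemi> ((\<sigma> B X \<odot>\<^sub>a \<i> Y) \<Zsemi> (\<i> X \<odot>\<^sub>a q) \<Zsemi> (\<sigma> X B \<odot>\<^sub>a \<i> Y')) \<Zsemi> (\<i> B \<odot>\<^sub>a ?k \<odot>\<^sub>a \<i> Y')"
  proof -
    have "(?k \<odot>\<^sub>a q) \<Zsemi> (\<sigma> X' B \<odot>\<^sub>a \<i> Y') = (\<i> X \<odot>\<^sub>a q) \<Zsemi> (((?k \<odot>\<^sub>a \<i> B) \<Zsemi> \<sigma> X' B) \<odot>\<^sub>a \<i> Y')"
    proof -
      have "?k \<odot>\<^sub>a q = (\<i> X \<odot>\<^sub>a q) \<Zsemi> (?k \<odot>\<^sub>a \<i> (B \<odot> Y'))"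
        by (simp add: tensor_arr_comp)
      also have "\<dots> = (\<i> X \<odot>\<^sub>a q) \<Zsemi> ((?k \<odot>\<^sub>a \<i> B) \<odot>\<^sub>a \<i> Y')"
        by simp
      finally have "(?k \<odot>\<^sub>a q) \<Zsemi> (\<sigma> X' B \<odot>\<^sub>a \<i> Y')
        = (\<i> X \<odot>\<^sub>a q) \<Zsemi> (((?k \<odot>\<^sub>a \<i> B) \<odot>\<^sub>a \<i> Y') \<Zsemi> (\<sigma> X' B \<odot>\<^sub>a \<i> Y'))"
        by (simp add: arr_comp_assoc del: tensor_arr_assoc)
      then show ?thesis by (simp add: tensor_arr_comp del: tensor_arr_assoc)
    qed
    also have "(?k \<odot>\<^sub>a \<i> B) \<Zsemi> \<sigma> X' B = \<sigma> X B \<Zsemi> (\<i> B \<odot>\<^sub>a ?k)"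
      using symm_arr_natural[of ?k "\<i> B"] by simp
    also have "(\<sigma> X B \<Zsemi> (\<i> B \<odot>\<^sub>a ?k)) \<odot>\<^sub>a \<i> Y' = (\<sigma> X B \<odot>\<^sub>a \<i> Y') \<Zsemi> ((\<i> B \<odot>\<^sub>a ?k) \<odot>\<^sub>a \<i> Y')"
      by (simp add: tensor_arr_comp del: tensor_arr_assoc)
    finally show ?thesis by (simp add: arr_comp_assoc)
  qed
  also have "tr B (X \<odot> Y) (X' \<odot> Y') \<dots>
    = \<i> (X \<odot> Y) \<Zsemi> tr B (X \<odot> Y) (X \<odot> Y') ((\<sigma> B X \<odot>\<^sub>a \<i> Y) \<Zsemi> (\<i> X \<odot>\<^sub>a q) \<Zsemi> (\<sigma> X B \<odot>\<^sub>a \<i> Y')) \<Zsemi> (?k \<odot>\<^sub>a \<i> Y')"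
    by (rule tightening) (auto simp: hom_def)
  also have "\<dots> = ?k \<odot>\<^sub>a tr B Y Y' q"
    by (subst strength_left) (auto simp: hom_def tensor_arr_comp)
  finally show ?thesis .
qed

end

section \<open>Adjunctions and categories of structured categories\<close>

lemma functorD:
  assumes "is_functor C D F"
  shows functor_source: "category C" and functor_target: "category D"
    and functor_ob: "\<And>X. X \<in> Ob C \<Longrightarrow> FOb F X \<in> Ob D"
    and functor_hom: "\<And>f X Y. f \<in> hom C X Y \<Longrightarrow> FAr F f \<in> hom D (FOb F X) (FOb F Y)"
    and functor_ident: "\<And>X. X \<in> Ob C \<Longrightarrow> FAr F (Idt C X) = Idt D (FOb F X)"
    and functor_comp_hom: "\<And>f g X Y Z. f \<in> hom C X Y \<Longrightarrow> g \<in> hom C Y Z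
      \<Longrightarrow> FAr F (Cmp C f g) = Cmp D (FAr F f) (FAr F g)"
  using assms unfolding is_functor_def by blast+

lemma functor_arr:
  assumes "is_functor C D F" "f \<in> Ar C"
  shows "FAr F f \<in> Ar D" "Dom D (FAr F f) = FOb F (Dom C f)" "Cod D (FAr F f) = FOb F (Cod C f)"
  using functor_hom[OF assms(1), of f "Dom C f" "Cod C f"] assms(2) by (auto simp: hom_def)

lemma functor_comp:
  assumes "is_functor C D F" "f \<in> Ar C" "g \<in> Ar C" "Cod C f = Dom C g"
  shows "FAr F (Cmp C f g) = Cmp D (FAr F f) (FAr F g)"
  using functor_comp_hom[OF assms(1), of f "Dom C f" "Dom C g" g "Cod C g"] assms(2-)
  by (auto simp: hom_def)

lemma adjunctionD:
  assumes "adjunction C D L R \<eta> \<epsilon>"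
  shows adjunction_left: "is_functor C D L" and adjunction_right: "is_functor D C R"
    and unit_hom: "\<And>X. X \<in> Ob C \<Longrightarrow> \<eta> X \<in> hom C X (FOb R (FOb L X))"
    and counit_hom: "\<And>Y. Y \<in> Ob D \<Longrightarrow> \<epsilon> Y \<in> hom D (FOb L (FOb R Y)) Y"
    and unit_natural: "\<And>f X Y. f \<in> hom C X Y \<Longrightarrow> Cmp C f (\<eta> Y) = Cmp C (\<eta> X) (FAr R (FAr L f))"
    and counit_natural: "\<And>g X Y. g \<in> hom D X Y \<Longrightarrow> Cmp D (FAr L (FAr R g)) (\<epsilon> Y) = Cmp D (\<epsilon> X) g"
    and triangle_left: "\<And>X. X \<in> Ob C \<Longrightarrow> Cmp D (FAr L (\<eta> X)) (\<epsilon> (FOb L X)) = Idt D (FOb L X)"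
    and triangle_right: "\<And>Y. Y \<in> Ob D \<Longrightarrow> Cmp C (\<eta> (FOb R Y)) (FAr R (\<epsilon> Y)) = Idt C (FOb R Y)"
  using assms unfolding adjunction_def nat_trans_def id_fnctr_def comp_fnctr_def by auto

lemma adjunction_factor:
  assumes adj: "adjunction C D L R \<eta> \<epsilon>"
    and X: "X \<in> Ob C" and Y: "Y \<in> Ob D" and g: "g \<in> hom C X (FOb R Y)"
  shows "\<exists>G\<in>hom D (FOb L X) Y. Cmp C (\<eta> X) (FAr R G) = g"
proof
  note [simp] = X Y
  note L = adjunction_left[OF adj] and R = adjunction_right[OF adj]
  interpret C: category C by (rule functor_source[OF L])
  interpret D: category D by (rule functor_target[OF L])
  let ?G = "Cmp D (FAr L g) (\<epsilon> Y)"
  note Lg = functor_hom[OF L g] and e = counit_hom[OF adj Y]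
  note u = unit_hom[OF adj X]
  note uY = unit_hom[OF adj functor_ob[OF R Y]]
  show "?G \<in> hom D (FOb L X) Y"
    using Lg e by (rule D.comp_hom)
  have "Cmp C (\<eta> X) (FAr R ?G) = Cmp C (\<eta> X) (Cmp C (FAr R (FAr L g)) (FAr R (\<epsilon> Y)))"
    by (subst functor_comp_hom[OF R Lg e]) simp
  also have "\<dots> = Cmp C (Cmp C (\<eta> X) (FAr R (FAr L g))) (FAr R (\<epsilon> Y))"
    by (rule C.comp_assoc[symmetric, OF u functor_hom[OF R Lg] functor_hom[OF R e]])
  also have "Cmp C (\<eta> X) (FAr R (FAr L g)) = Cmp C g (\<eta> (FOb R Y))"
    by (rule unit_natural[OF adj g, symmetric])
  also have "Cmp C (Cmp C g (\<eta> (FOb R Y))) (FAr R (\<epsilon> Y)) = Cmp C g (Idt C (FOb R Y))"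
    by (subst C.comp_assoc[OF g uY functor_hom[OF R e]]) (simp add: triangle_right[OF adj Y])
  also have "\<dots> = g"
    by (rule C.comp_id[OF g])
  finally show "Cmp C (\<eta> X) (FAr R ?G) = g" .
qed

lemma adjunction_factor_unique:
  assumes adj: "adjunction C D L R \<eta> \<epsilon>" and X: "X \<in> Ob C"
    and "G \<in> hom D (FOb L X) Y" "G' \<in> hom D (FOb L X) Y"
    and eq: "Cmp C (\<eta> X) (FAr R G) = Cmp C (\<eta> X) (FAr R G')"
  shows "G = G'"
proof -
  note L = adjunction_left[OF adj] and R = adjunction_right[OF adj]
  interpret C: category C by (rule functor_source[OF L])
  interpret D: category D by (rule functor_target[OF L])
  have mate: "H = Cmp D (FAr L (Cmp C (\<eta> X) (FAr R H))) (\<epsilon> Y)" if H: "H \<in> hom D (FOb L X) Y" for H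
  proof -
    note u = unit_hom[OF adj X] and RH = functor_hom[OF R H]
    note Lu = functor_hom[OF L u] and LRH = functor_hom[OF L RH]
    have Y: "Y \<in> Ob D" using H by (auto simp: hom_def)
    note e = counit_hom[OF adj Y] and eX = counit_hom[OF adj functor_ob[OF L X]]
    have "Cmp D (FAr L (Cmp C (\<eta> X) (FAr R H))) (\<epsilon> Y)
        = Cmp D (FAr L (\<eta> X)) (Cmp D (FAr L (FAr R H)) (\<epsilon> Y))"
      by (subst functor_comp_hom[OF L u RH]) (rule D.comp_assoc[OF Lu LRH e])
    also have "\<dots> = Cmp D (FAr L (\<eta> X)) (Cmp D (\<epsilon> (FOb L X)) H)"
      by (simp add: counit_natural[OF adj H])
    also have "\<dots> = Cmp D (Cmp D (FAr L (\<eta> X)) (\<epsilon> (FOb L X))) H"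
      by (rule D.comp_assoc[symmetric, OF Lu eX H])
    also have "\<dots> = H"
      by (simp add: triangle_left[OF adj X] D.id_comp[OF H])
    finally show ?thesis by simp
  qed
  show ?thesis using mate[OF assms(3)] mate[OF assms(4)] eq by simp
qed

text \<open>Lifts of arrows and of unit and counit components are only assumed to exist one by one,
  and are picked by choice. No compatibility between them is assumed: functor laws, naturality and
  triangle identities are equations between parallel arrows, so faithfulness of \<open>P\<close> and
  \<open>Q\<close> reduces them to the corresponding equations of \<open>adj\<close>.\<close>

lemma lift_adjunction:
  assumes adj: "adjunction A B L R \<eta> \<epsilon>"
    and P: "is_functor A' A P" and Q: "is_functor B' B Q" and R': "is_functor B' A' R'"
    and P_faithful: "\<And>X Y f g. \<lbrakk>f \<in> hom A' X Y; g \<in> hom A' X Y; FAr P f = FAr P g\<rbrakk> \<Longrightarrow> f = g"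
    and Q_faithful: "\<And>X Y f g. \<lbrakk>f \<in> hom B' X Y; g \<in> hom B' X Y; FAr Q f = FAr Q g\<rbrakk> \<Longrightarrow> f = g"
    and square_ob: "\<And>Y. Y \<in> Ob B' \<Longrightarrow> FOb P (FOb R' Y) = FOb R (FOb Q Y)"
    and square_ar: "\<And>g. g \<in> Ar B' \<Longrightarrow> FAr P (FAr R' g) = FAr R (FAr Q g)"
    and lift_ob: "\<And>X. X \<in> Ob A' \<Longrightarrow> l X \<in> Ob B'" "\<And>X. X \<in> Ob A' \<Longrightarrow> FOb Q (l X) = FOb L (FOb P X)"
    and lift_ar: "\<And>f X Y. f \<in> hom A' X Y \<Longrightarrow> \<exists>f'\<in>hom B' (l X) (l Y). FAr Q f' = FAr L (FAr P f)"
    and lift_unit: "\<And>X. X \<in> Ob A' \<Longrightarrow> \<exists>u\<in>hom A' X (FOb R' (l X)). FAr P u = \<eta> (FOb P X)"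
    and lift_counit: "\<And>Y. Y \<in> Ob B' \<Longrightarrow> \<exists>c\<in>hom B' (l (FOb R' Y)) Y. FAr Q c = \<epsilon> (FOb Q Y)"
  shows "\<exists>L' \<eta>' \<epsilon>'. adjunction A' B' L' R' \<eta>' \<epsilon>' \<and> FOb L' = l
    \<and> (\<forall>f\<in>Ar A'. FAr Q (FAr L' f) = FAr L (FAr P f))
    \<and> (\<forall>X\<in>Ob A'. FAr P (\<eta>' X) = \<eta> (FOb P X))
    \<and> (\<forall>Y\<in>Ob B'. FAr Q (\<epsilon>' Y) = \<epsilon> (FOb Q Y))"
proof -
  note L = adjunction_left[OF adj] and R = adjunction_right[OF adj]
  interpret A': category A' by (rule functor_source[OF P])
  interpret B': category B' by (rule functor_source[OF Q])
  have "\<exists>a. \<forall>f\<in>Ar A'. a f \<in> hom B' (l (Dom A' f)) (l (Cod A' f)) \<and> FAr Q (a f) = FAr L (FAr P f)"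
    by (rule bchoice) (use lift_ar in \<open>auto simp: A'.in_hom_iff Bex_def\<close>)
  then obtain a where a: "\<And>f. f \<in> Ar A' \<Longrightarrow> a f \<in> hom B' (l (Dom A' f)) (l (Cod A' f))"
    and Qa: "\<And>f. f \<in> Ar A' \<Longrightarrow> FAr Q (a f) = FAr L (FAr P f)" by blast
  have "\<exists>u. \<forall>X\<in>Ob A'. u X \<in> hom A' X (FOb R' (l X)) \<and> FAr P (u X) = \<eta> (FOb P X)"
    by (rule bchoice) (use lift_unit in blast)
  then obtain u where u: "\<And>X. X \<in> Ob A' \<Longrightarrow> u X \<in> hom A' X (FOb R' (l X))"
    and Pu: "\<And>X. X \<in> Ob A' \<Longrightarrow> FAr P (u X) = \<eta> (FOb P X)" by blast
  have "\<exists>c. \<forall>Y\<in>Ob B'. c Y \<in> hom B' (l (FOb R' Y)) Y \<and> FAr Q (c Y) = \<epsilon> (FOb Q Y)"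
    by (rule bchoice) (use lift_counit in blast)
  then obtain c where c: "\<And>Y. Y \<in> Ob B' \<Longrightarrow> c Y \<in> hom B' (l (FOb R' Y)) Y"
    and Qc: "\<And>Y. Y \<in> Ob B' \<Longrightarrow> FAr Q (c Y) = \<epsilon> (FOb Q Y)" by blast
  define L' where "L' = \<lparr>FOb = l, FAr = a\<rparr>"
  have a_hom: "a f \<in> hom B' (l X) (l Y)" if "f \<in> hom A' X Y" for f X Y
    using a that by (auto simp: A'.in_hom_iff)
  have Qa_hom: "FAr Q (a f) = FAr L (FAr P f)" if "f \<in> hom A' X Y" for f X Y
    using Qa that by (auto simp: A'.in_hom_iff)
  have sq: "FAr P (FAr R' g) = FAr R (FAr Q g)" if "g \<in> hom B' X Y" for g X Y
    using square_ar that by (auto simp: B'.in_hom_iff)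
  have L': "is_functor A' B' L'"
    unfolding is_functor_def L'_def fnctr.simps
  proof (intro conjI allI ballI)
    fix X assume X: "X \<in> Ob A'"
    note i = A'.id_hom[OF X]
    show "a (Idt A' X) = Idt B' (l X)"
    proof (rule Q_faithful[OF a_hom[OF i] B'.id_hom[OF lift_ob(1)[OF X]]])
      show "FAr Q (a (Idt A' X)) = FAr Q (Idt B' (l X))"
        using X by (simp add: Qa_hom[OF i] functor_ident[OF P] functor_ident[OF Q] functor_ident[OF L]
            lift_ob functor_ob[OF P])
    qed
  next
    fix X Y Z f g assume f: "f \<in> hom A' X Y" and g: "g \<in> hom A' Y Z"
    show "a (Cmp A' f g) = Cmp B' (a f) (a g)"
      using f g
      by (intro Q_faithful[OF a_hom[OF A'.comp_hom[OF f g]] B'.comp_hom[OF a_hom[OF f] a_hom[OF g]]])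
        (simp add: Qa_hom[OF A'.comp_hom[OF f g]] functor_comp_hom[OF Q a_hom[OF f] a_hom[OF g]]
          Qa_hom[OF f] Qa_hom[OF g] functor_comp_hom[OF P f g]
          functor_comp_hom[OF L functor_hom[OF P f] functor_hom[OF P g]])
  qed (use a_hom lift_ob in \<open>auto intro: A'.category_axioms B'.category_axioms\<close>)
  have "is_functor A' A' id_fnctr" "is_functor B' B' id_fnctr"
    using A'.category_axioms B'.category_axioms by (auto simp: is_functor_def id_fnctr_def)
  moreover have "is_functor A' A' (comp_fnctr L' R')" "is_functor B' B' (comp_fnctr R' L')"
    using A'.category_axioms B'.category_axioms
    by (auto simp: is_functor_def comp_fnctr_def functor_ob[OF L'] functor_ob[OF R']
        functor_ident[OF L'] functor_ident[OF R']
        intro!: functor_hom[OF L'] functor_hom[OF R']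
        dest: functor_comp_hom[OF L'] functor_comp_hom[OF R'])
      (metis functor_comp_hom[OF L'] functor_comp_hom[OF R'] functor_hom[OF L'] functor_hom[OF R'])+
  moreover have "Cmp A' f (u Y) = Cmp A' (u X) (FAr R' (a f))" if f: "f \<in> hom A' X Y" for X Y f
  proof -
    have X: "X \<in> Ob A'" and Y: "Y \<in> Ob A'" using f by (auto simp: A'.in_hom_iff)
    note Ra = functor_hom[OF R' a_hom[OF f]]
    show ?thesis
      by (rule P_faithful[OF A'.comp_hom[OF f u[OF Y]] A'.comp_hom[OF u[OF X] Ra]])
        (simp add: functor_comp_hom[OF P f u[OF Y]] functor_comp_hom[OF P u[OF X] Ra]
          Pu X Y sq[OF a_hom[OF f]] Qa_hom[OF f] unit_natural[OF adj functor_hom[OF P f]])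
  qed
  moreover have "Cmp B' (a (FAr R' g)) (c Y) = Cmp B' (c X) g" if g: "g \<in> hom B' X Y" for X Y g
  proof -
    have X: "X \<in> Ob B'" and Y: "Y \<in> Ob B'" using g by (auto simp: B'.in_hom_iff)
    note aR = a_hom[OF functor_hom[OF R' g]]
    show ?thesis
      by (rule Q_faithful[OF B'.comp_hom[OF aR c[OF Y]] B'.comp_hom[OF c[OF X] g]])
        (simp add: functor_comp_hom[OF Q aR c[OF Y]] functor_comp_hom[OF Q c[OF X] g]
          Qc X Y sq[OF g] Qa_hom[OF functor_hom[OF R' g]] counit_natural[OF adj functor_hom[OF Q g]])
  qed
  moreover have "Cmp B' (a (u X)) (c (l X)) = Idt B' (l X)" if X: "X \<in> Ob A'" for X
  proof -
    note au = a_hom[OF u[OF X]] and lX = lift_ob(1)[OF X]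
    show ?thesis
      by (rule Q_faithful[OF B'.comp_hom[OF au c[OF lX]] B'.id_hom[OF lX]])
        (simp add: functor_comp_hom[OF Q au c[OF lX]] Qa_hom[OF u[OF X]] Pu[OF X] Qc[OF lX]
          lift_ob(2)[OF X] functor_ident[OF Q lX] triangle_left[OF adj functor_ob[OF P X]])
  qed
  moreover have "Cmp A' (u (FOb R' Y)) (FAr R' (c Y)) = Idt A' (FOb R' Y)" if Y: "Y \<in> Ob B'" for Y
  proof -
    note RY = functor_ob[OF R' Y] and Rc = functor_hom[OF R' c[OF Y]]
    show ?thesis
      by (rule P_faithful[OF A'.comp_hom[OF u[OF RY] Rc] A'.id_hom[OF RY]])
        (simp add: functor_comp_hom[OF P u[OF RY] Rc] Pu[OF RY] square_ob[OF Y] sq[OF c[OF Y]] Qc[OF Y]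
          functor_ident[OF P RY] triangle_right[OF adj functor_ob[OF Q Y]])
  qed
  ultimately have "adjunction A' B' L' R' u c"
    unfolding adjunction_def nat_trans_def using L' R' u c
    by (simp add: id_fnctr_def comp_fnctr_def L'_def)
  then show ?thesis
    using Qa Pu Qc by (intro exI[of _ L'] exI[of _ u] exI[of _ c]) (simp add: L'_def)
qed

section \<open>Categories of structured categories and extensional functors\<close>

lemma struct_cat_simps [simp]:
  "Ob (struct_cat P H) = {C. P C}"
  "Dom (struct_cat P H) = Src" "Cod (struct_cat P H) = Trg"
  "Idt (struct_cat P H) C = \<lparr>Src = C, Trg = C, Fun = \<lparr>FOb = \<lambda>X\<in>Ob C. X, FAr = \<lambda>f\<in>Ar C. f\<rparr>\<rparr>"
  "Cmp (struct_cat P H) m n = \<lparr>Src = Src m, Trg = Trg n,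
     Fun = \<lparr>FOb = compose (Ob (Src m)) (FOb (Fun n)) (FOb (Fun m)),
            FAr = compose (Ar (Src m)) (FAr (Fun n)) (FAr (Fun m))\<rparr>\<rparr>"
  by (simp_all add: struct_cat_def)

lemma struct_cat_hom:
  "m \<in> hom (struct_cat P H) C D \<longleftrightarrow> Src m = C \<and> Trg m = D \<and> P C \<and> P D \<and> H C D (Fun m)
     \<and> FOb (Fun m) \<in> extensional (Ob C) \<and> FAr (Fun m) \<in> extensional (Ar C)"
  by (auto simp: hom_def struct_cat_def)

text \<open>Composites are restricted to the carrier of the source, so the right unit law and
  associativity depend on functors mapping carriers into carriers. This is what
  \<open>H_functor\<close> provides; the left unit law comes from extensionality.\<close>

lemma struct_cat_category:
  assumes H_functor: "\<And>C D F. H C D F \<Longrightarrow> is_functor C D F"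
    and H_ident: "\<And>C. P C \<Longrightarrow> H C C \<lparr>FOb = \<lambda>X\<in>Ob C. X, FAr = \<lambda>f\<in>Ar C. f\<rparr>"
    and H_comp: "\<And>C D E F G. \<lbrakk>P C; P D; P E; H C D F; H D E G\<rbrakk> \<Longrightarrow>
      H C E \<lparr>FOb = compose (Ob C) (FOb G) (FOb F), FAr = compose (Ar C) (FAr G) (FAr F)\<rparr>"
  shows "category (struct_cat P H)"
proof
  show "Dom (struct_cat P H) m \<in> Ob (struct_cat P H)" "Cod (struct_cat P H) m \<in> Ob (struct_cat P H)"
    if "m \<in> Ar (struct_cat P H)" for m
    using that by (auto simp: struct_cat_def)
  show "Idt (struct_cat P H) X \<in> hom (struct_cat P H) X X" if "X \<in> Ob (struct_cat P H)" for X
    using that H_ident by (auto simp: struct_cat_hom)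
  show "Cmp (struct_cat P H) m n \<in> hom (struct_cat P H) X Z"
    if "m \<in> hom (struct_cat P H) X Y" "n \<in> hom (struct_cat P H) Y Z" for m n X Y Z
    using that H_comp by (auto simp: struct_cat_hom compose_def)
  show "Cmp (struct_cat P H) (Idt (struct_cat P H) X) m = m" if "m \<in> hom (struct_cat P H) X Y" for m X Y
    using that by (cases m; cases "Fun m") (auto simp: struct_cat_hom compose_def extensional_def fun_eq_iff)
  show "Cmp (struct_cat P H) m (Idt (struct_cat P H) Y) = m" if m: "m \<in> hom (struct_cat P H) X Y" for m X Y
  proof -
    have F: "is_functor X Y (Fun m)" using m H_functor by (auto simp: struct_cat_hom)
    show ?thesis using m functor_ob[OF F] functor_arr(1)[OF F]
      by (cases m; cases "Fun m") (auto simp: struct_cat_hom compose_def extensional_def fun_eq_iff)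
  qed
  show "Cmp (struct_cat P H) (Cmp (struct_cat P H) m n) k
      = Cmp (struct_cat P H) m (Cmp (struct_cat P H) n k)"
    if m: "m \<in> hom (struct_cat P H) W X" and n: "n \<in> hom (struct_cat P H) X Y"
      and k: "k \<in> hom (struct_cat P H) Y Z" for m n k W X Y Z
  proof -
    have F: "is_functor W X (Fun m)" using m H_functor by (auto simp: struct_cat_hom)
    show ?thesis using m n k functor_ob[OF F] functor_arr(1)[OF F]
      by (auto simp: struct_cat_hom compose_def fun_eq_iff)
  qed
qed

lemma functor_restrict_ident:
  assumes "category C"
  shows "is_functor C C \<lparr>FOb = \<lambda>X\<in>Ob C. X, FAr = \<lambda>f\<in>Ar C. f\<rparr>"
proof -
  interpret category C by fact
  show ?thesis
    unfolding is_functor_def using assms by (auto simp: in_hom_iff)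
qed

lemma functor_compose:
  assumes F: "is_functor C D F" and G: "is_functor D E G"
  shows "is_functor C E \<lparr>FOb = compose (Ob C) (FOb G) (FOb F), FAr = compose (Ar C) (FAr G) (FAr F)\<rparr>"
proof -
  interpret C: category C by (rule functor_source[OF F])
  interpret D: category D by (rule functor_source[OF G])
  interpret E: category E by (rule functor_target[OF G])
  show ?thesis
    unfolding is_functor_def using C.category_axioms E.category_axioms
    by (auto simp: C.in_hom_iff D.in_hom_iff E.in_hom_iff compose_def functor_ob[OF F] functor_ob[OF G]
      functor_arr[OF F] functor_arr[OF G] functor_ident[OF F] functor_ident[OF G]
      functor_comp[OF F] functor_comp[OF G])
qed

lemma strict_sm_functor_ident:
  assumes "symmetric_monoidal C M"
  shows "strict_sm_functor C M C M \<lparr>FOb = \<lambda>X\<in>Ob C. X, FAr = \<lambda>f\<in>Ar C. f\<rparr>"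
proof -
  interpret symmetric_monoidal C M by fact
  show ?thesis
    using iso_homD[OF assoc_iso] iso_homD[OF lunit_iso] iso_homD[OF runit_iso]
    by (simp add: strict_sm_functor_def functor_restrict_ident[OF category_axioms])
qed

lemma strict_sm_functorD:
  assumes "strict_sm_functor C M D N F"
  shows strict_sm_functor: "is_functor C D F"
    and sm_tensor_ob: "\<And>X Y. \<lbrakk>X \<in> Ob C; Y \<in> Ob C\<rbrakk> \<Longrightarrow> FOb F (TOb M X Y) = TOb N (FOb F X) (FOb F Y)"
    and sm_tensor_ar: "\<And>f g. \<lbrakk>f \<in> Ar C; g \<in> Ar C\<rbrakk> \<Longrightarrow> FAr F (TAr M f g) = TAr N (FAr F f) (FAr F g)"
    and sm_unit: "FOb F (TUnit M) = TUnit N"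
    and sm_assoc: "\<And>X Y Z. \<lbrakk>X \<in> Ob C; Y \<in> Ob C; Z \<in> Ob C\<rbrakk>
      \<Longrightarrow> FAr F (Assoc M X Y Z) = Assoc N (FOb F X) (FOb F Y) (FOb F Z)"
    and sm_lunit: "\<And>X. X \<in> Ob C \<Longrightarrow> FAr F (LUnit M X) = LUnit N (FOb F X)"
    and sm_runit: "\<And>X. X \<in> Ob C \<Longrightarrow> FAr F (RUnit M X) = RUnit N (FOb F X)"
    and sm_symm: "\<And>X Y. \<lbrakk>X \<in> Ob C; Y \<in> Ob C\<rbrakk> \<Longrightarrow> FAr F (Symm M X Y) = Symm N (FOb F X) (FOb F Y)"
  using assms unfolding strict_sm_functor_def by blast+

lemma strict_sm_functor_compose:
  assumes F: "strict_sm_functor C M D N F" and G: "strict_sm_functor D N E K G"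
    and C: "symmetric_monoidal C M"
  shows "strict_sm_functor C M E K
    \<lparr>FOb = compose (Ob C) (FOb G) (FOb F), FAr = compose (Ar C) (FAr G) (FAr F)\<rparr>"
proof -
  interpret symmetric_monoidal C M by fact
  note FF = strict_sm_functor[OF F] and GG = strict_sm_functor[OF G]
  show ?thesis
    unfolding strict_sm_functor_def
    using functor_compose[OF FF GG]
      iso_homD[OF assoc_iso] iso_homD[OF lunit_iso] iso_homD[OF runit_iso]
    by (auto simp: compose_def functor_ob[OF FF] functor_arr[OF FF] sm_tensor_ob[OF F] sm_tensor_ob[OF G]
      sm_tensor_ar[OF F] sm_tensor_ar[OF G] sm_unit[OF F] sm_unit[OF G] sm_assoc[OF F] sm_assoc[OF G]
      sm_lunit[OF F] sm_lunit[OF G] sm_runit[OF F] sm_runit[OF G] sm_symm[OF F] sm_symm[OF G])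
qed

section \<open>Independence of additional record fields\<close>

lemma cat_truncate_eqD:
  assumes "cat.truncate C = cat.truncate C'"
  shows "Ob C = Ob C'" "Ar C = Ar C'" "Dom C = Dom C'" "Cod C = Cod C'" "Idt C = Idt C'" "Cmp C = Cmp C'"
    "hom C = hom C'"
  using assms by (auto simp: cat.defs hom_def fun_eq_iff)

text \<open>The same category occurs in several record types, and the locales take the whole record.
  These congruences move facts between the types; the \<open>cat\<close> fields suffice because
  monoidal structures and traces are separate arguments.\<close>

lemma category_cong:
  assumes "cat.truncate C = cat.truncate C'"
  shows "category C \<longleftrightarrow> category C'"
  by (simp add: category_def cat_truncate_eqD[OF assms])

lemma iso_hom_cong:
  assumes "cat.truncate C = cat.truncate C'"
  shows "iso_hom C = iso_hom C'"
  by (simp add: fun_eq_iff iso_hom_def inverse_arrows_def cat_truncate_eqD[OF assms])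

lemma symmetric_monoidal_cong:
  assumes "cat.truncate C = cat.truncate C'"
  shows "symmetric_monoidal C M \<longleftrightarrow> symmetric_monoidal C' M"
  by (simp only: symmetric_monoidal_def symmetric_monoidal_axioms_def
      category_cong[OF assms] iso_hom_cong[OF assms] cat_truncate_eqD[OF assms])

lemma strict_symmetric_monoidal_cong:
  assumes "cat.truncate C = cat.truncate C'"
  shows "strict_symmetric_monoidal C M \<longleftrightarrow> strict_symmetric_monoidal C' M"
  by (simp only: strict_symmetric_monoidal_def strict_symmetric_monoidal_axioms_def
      symmetric_monoidal_cong[OF assms] cat_truncate_eqD[OF assms])

lemma uniformly_traced_cong:
  assumes "cat.truncate C = cat.truncate C'"
  shows "uniformly_traced C M t \<longleftrightarrow> uniformly_traced C' M t"
  by (simp only: uniformly_traced_def uniformly_traced_axioms_def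
      strict_symmetric_monoidal_cong[OF assms] cat_truncate_eqD[OF assms])

lemma strict_sm_functor_cong:
  assumes "cat.truncate C = cat.truncate C'" "cat.truncate D = cat.truncate D'"
  shows "strict_sm_functor C M D N F \<longleftrightarrow> strict_sm_functor C' M D' N F"
  by (simp only: strict_sm_functor_def is_functor_def category_cong[OF assms(1)] category_cong[OF assms(2)]
      cat_truncate_eqD[OF assms(1)] cat_truncate_eqD[OF assms(2)])

lemma preserves_trace_cong:
  assumes "cat.truncate C = cat.truncate C'"
  shows "preserves_trace C M t t' F \<longleftrightarrow> preserves_trace C' M t t' F"
  by (simp only: preserves_trace_def cat_truncate_eqD[OF assms])

lemma truncate_truncate [simp]:
  "cat.truncate (smcat.truncate C) = cat.truncate C" "Plus (smcat.truncate C) = Plus C"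
  "cat.truncate (rigcat.truncate D) = cat.truncate D" "smcat.truncate (rigcat.truncate D) = smcat.truncate D"
  "Plus (rigcat.truncate D) = Plus D" "Times (rigcat.truncate D) = Times D"
  "DistL (rigcat.truncate D) = DistL D" "DistR (rigcat.truncate D) = DistR D"
  "AnnL (rigcat.truncate D) = AnnL D" "AnnR (rigcat.truncate D) = AnnR D"
  by (simp_all add: cat.defs smcat.defs rigcat.defs)

lemma truncate_fields [simp]:
  "Ob (smcat.truncate C) = Ob C" "Ar (smcat.truncate C) = Ar C"
  "Ob (rigcat.truncate D) = Ob D" "Ar (rigcat.truncate D) = Ar D"
  by (simp_all add: cat.defs smcat.defs rigcat.defs)

lemma right_strict_rig_truncate [simp]: "right_strict_rig (rigcat.truncate C) \<longleftrightarrow> right_strict_rig C"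
proof -
  have *: "cat.truncate (rigcat.truncate C) = cat.truncate C" by simp
  show ?thesis
    by (simp only: right_strict_rig_def right_strict_rig_axioms_def rig_category_def rig_category_axioms_def
      symmetric_monoidal_cong[OF *] strict_symmetric_monoidal_cong[OF *] iso_hom_cong[OF *]
      cat_truncate_eqD[OF *] truncate_truncate inv_arrow_def inverse_arrows_def)
qed

lemma right_strict_rig_functor_truncate [simp]:
  "right_strict_rig_functor (rigcat.truncate C) (rigcat.truncate D) F \<longleftrightarrow> right_strict_rig_functor C D F"
  by (simp add: right_strict_rig_functor_def
      strict_sm_functor_cong[of "rigcat.truncate C" C "rigcat.truncate D" D])

lemma right_strict_rig_functor_truncate_target:
  "right_strict_rig_functor C (rigcat.truncate D) F \<longleftrightarrow> right_strict_rig_functor C D F"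
  by (simp add: right_strict_rig_functor_def strict_sm_functor_cong[of C C "rigcat.truncate D" D])

lemma right_strict_rig_functor_ident:
  assumes "right_strict_rig C"
  shows "right_strict_rig_functor C C \<lparr>FOb = \<lambda>X\<in>Ob C. X, FAr = \<lambda>f\<in>Ar C. f\<rparr>"
proof -
  interpret right_strict_rig C by fact
  show ?thesis
    unfolding right_strict_rig_functor_def
    using strict_sm_functor_ident[OF additive.symmetric_monoidal_axioms]
      strict_sm_functor_ident[OF multiplicative.symmetric_monoidal_axioms]
      additive.iso_homD[OF dist_l_iso]
    by simp
qed

lemma right_strict_rig_functorD:
  assumes "right_strict_rig_functor C D F"
  shows rig_functor_plus: "strict_sm_functor C (Plus C) D (Plus D) F"
    and rig_functor_times: "strict_sm_functor C (Times C) D (Times D) F"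
    and rig_functor_dist: "\<And>X Y Z. \<lbrakk>X \<in> Ob C; Y \<in> Ob C; Z \<in> Ob C\<rbrakk>
      \<Longrightarrow> FAr F (DistL C X Y Z) = DistL D (FOb F X) (FOb F Y) (FOb F Z)"
  using assms by (auto simp: right_strict_rig_functor_def)

lemma right_strict_rig_functor_compose:
  assumes F: "right_strict_rig_functor C D F" and G: "right_strict_rig_functor D E G"
    and C: "right_strict_rig C"
  shows "right_strict_rig_functor C E
    \<lparr>FOb = compose (Ob C) (FOb G) (FOb F), FAr = compose (Ar C) (FAr G) (FAr F)\<rparr>"
proof -
  interpret right_strict_rig C by fact
  note FF = strict_sm_functor[OF rig_functor_plus[OF F]]
  show ?thesis
    unfolding right_strict_rig_functor_def
    using strict_sm_functor_compose[OF rig_functor_plus[OF F] rig_functor_plus[OF G]]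
      strict_sm_functor_compose[OF rig_functor_times[OF F] rig_functor_times[OF G]]
      additive.symmetric_monoidal_axioms multiplicative.symmetric_monoidal_axioms
      additive.iso_homD[OF dist_l_iso] functor_ob[OF FF]
    by (simp add: compose_def rig_functor_dist[OF F] rig_functor_dist[OF G])
qed

lemma preserves_trace_ident:
  assumes "uniformly_traced C M t"
  shows "preserves_trace C M t t \<lparr>FOb = \<lambda>X\<in>Ob C. X, FAr = \<lambda>f\<in>Ar C. f\<rparr>"
proof -
  interpret uniformly_traced C M t by fact
  show ?thesis by (auto simp: preserves_trace_def in_hom_iff)
qed

lemma preserves_trace_compose:
  assumes F: "strict_sm_functor C M D N F" "preserves_trace C M t t' F"
    and G: "preserves_trace D N t' t'' G" and C: "uniformly_traced C M t"
  shows "preserves_trace C M t t''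
    \<lparr>FOb = compose (Ob C) (FOb G) (FOb F), FAr = compose (Ar C) (FAr G) (FAr F)\<rparr>"
proof -
  interpret uniformly_traced C M t by fact
  note FF = strict_sm_functor[OF F(1)]
  show ?thesis
    unfolding preserves_trace_def
  proof (intro ballI)
    fix S X Y f assume *: "S \<in> Ob C" "X \<in> Ob C" "Y \<in> Ob C" "f \<in> hom C (TOb M S X) (TOb M S Y)"
    have "FAr F f \<in> hom D (TOb N (FOb F S) (FOb F X)) (TOb N (FOb F S) (FOb F Y))"
      using functor_hom[OF FF *(4)] * by (simp add: sm_tensor_ob[OF F(1)])
    then show "FAr \<lparr>FOb = compose (Ob C) (FOb G) (FOb F), FAr = compose (Ar C) (FAr G) (FAr F)\<rparr> (t S X Y f)
      = t'' (FOb \<lparr>FOb = compose (Ob C) (FOb G) (FOb F), FAr = compose (Ar C) (FAr G) (FAr F)\<rparr> S)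
          (FOb \<lparr>FOb = compose (Ob C) (FOb G) (FOb F), FAr = compose (Ar C) (FAr G) (FAr F)\<rparr> X)
          (FOb \<lparr>FOb = compose (Ob C) (FOb G) (FOb F), FAr = compose (Ar C) (FAr G) (FAr F)\<rparr> Y)
          (FAr \<lparr>FOb = compose (Ob C) (FOb G) (FOb F), FAr = compose (Ar C) (FAr G) (FAr F)\<rparr> f)"
      using * F(2) G functor_ob[OF FF] by (simp add: preserves_trace_def compose_def in_hom_iff)
  qed
qed

lemma RIG_category: "category (RIG :: (('o, 'a) rigcat, (('o, 'a) rigcat, 'o, 'a) marr) cat)"
  unfolding RIG_def
  by (rule struct_cat_category)
    (simp_all add: right_strict_rig_functor_ident right_strict_rig_functor_compose
      strict_sm_functor[OF rig_functor_plus])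

lemma RIGUTr_category: "category (RIGUTr :: (('o, 'a) utrigcat, (('o, 'a) utrigcat, 'o, 'a) marr) cat)"
  unfolding RIGUTr_def
  by (rule struct_cat_category)
    (auto simp: uniformly_traced_rig_def right_strict_rig_functor_ident preserves_trace_ident
      intro: right_strict_rig_functor_compose preserves_trace_compose rig_functor_plus
      strict_sm_functor[OF rig_functor_plus])

lemma forget_simps [simp]: "FOb (forget U) = U"
  "FAr (forget U) m = \<lparr>Src = U (Src m), Trg = U (Trg m), Fun = Fun m\<rparr>"
  by (simp_all add: forget_def)

lemma forget_functor:
  assumes "category (struct_cat P H)" "category (struct_cat P' H')"
    and "\<And>C. P C \<Longrightarrow> P' (U C)"
    and "\<And>C D F. \<lbrakk>P C; P D; H C D F\<rbrakk> \<Longrightarrow> H' (U C) (U D) F"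
    and "\<And>C. Ob (U C) = Ob C" "\<And>C. Ar (U C) = Ar C"
  shows "is_functor (struct_cat P H) (struct_cat P' H') (forget U)"
  unfolding is_functor_def using assms by (auto simp: struct_cat_hom)

lemma forget_faithful:
  assumes "m \<in> hom (struct_cat P H) C D" "n \<in> hom (struct_cat P H) C D"
    and "FAr (forget U) m = FAr (forget U) n"
  shows "m = n"
  using assms by (auto simp: struct_cat_hom intro: marr.equality)

section \<open>The free uniformly traced category\<close>

text \<open>The equational axioms are universal and hence inherited, so only closure is at stake.
  Strictness makes associators and unitors identities, so closure under \<open>Idt\<close> also
  takes care of them and of their inverses.\<close>

lemma sub_uniformly_traced:
  fixes D :: "('o, 'a, 'm) cat_scheme"
  assumes D: "uniformly_traced D M t"
    and sub: "O' \<subseteq> Ob D" "A \<subseteq> Ar D"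
    and ends: "\<And>f. f \<in> A \<Longrightarrow> Dom D f \<in> O' \<and> Cod D f \<in> O'"
    and ident: "\<And>X. X \<in> O' \<Longrightarrow> Idt D X \<in> A"
    and comp: "\<And>f g. \<lbrakk>f \<in> A; g \<in> A; Cod D f = Dom D g\<rbrakk> \<Longrightarrow> Cmp D f g \<in> A"
    and sub_tensor_ob: "\<And>X Y. \<lbrakk>X \<in> O'; Y \<in> O'\<rbrakk> \<Longrightarrow> TOb M X Y \<in> O'"
    and sub_unit_ob: "TUnit M \<in> O'"
    and tensor_ar: "\<And>f g. \<lbrakk>f \<in> A; g \<in> A\<rbrakk> \<Longrightarrow> TAr M f g \<in> A"
    and symm: "\<And>X Y. \<lbrakk>X \<in> O'; Y \<in> O'\<rbrakk> \<Longrightarrow> Symm M X Y \<in> A"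
    and trace: "\<And>S X Y f. \<lbrakk>S \<in> O'; X \<in> O'; Y \<in> O'; f \<in> A; Dom D f = TOb M S X; Cod D f = TOb M S Y\<rbrakk>
      \<Longrightarrow> t S X Y f \<in> A"
  shows "uniformly_traced (D\<lparr>Ob := O', Ar := A\<rparr>) M t"
proof -
  interpret uniformly_traced D M t by fact
  let ?D = "D\<lparr>Ob := O', Ar := A\<rparr>"
  have hom_iff: "f \<in> hom ?D X Y \<longleftrightarrow> f \<in> A \<and> Dom D f = X \<and> Cod D f = Y" for f X Y
    by (auto simp: hom_def)
  have hom: "f \<in> hom ?D X Y \<Longrightarrow> f \<in> hom D X Y" for f X Y
    using sub by (auto simp: hom_def)
  have Ob [simp]: "X \<in> O' \<Longrightarrow> X \<in> Ob D" and Ar [simp]: "f \<in> A \<Longrightarrow> f \<in> Ar D" for X f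
    using sub by auto
  note [simp] = ident sub_tensor_ob sub_unit_ob tensor_ar symm
  interpret D': category ?D
    by unfold_locales (use ends comp_assoc[OF hom hom hom] in \<open>auto simp: hom_iff comp\<close>)
  have iso: "X \<in> O' \<Longrightarrow> Idt D X \<in> iso_hom ?D Y Z \<longleftrightarrow> Y = X \<and> Z = X" for X Y Z
    using D'.ident_iso[of X Y Z] by simp
  show ?thesis
    apply unfold_locales
    subgoal by simp
    subgoal by simp
    subgoal by (simp add: hom_iff)
    subgoal by simp
    subgoal using tensor_comp[OF hom hom hom hom] by simp
    subgoal by (simp add: assoc_strict iso)
    subgoal using assoc_natural[OF hom hom hom] by simp
    subgoal by (simp add: lunit_strict iso)
    subgoal using lunit_natural[OF hom] by simp
    subgoal by (simp add: runit_strict iso)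
    subgoal using runit_natural[OF hom] by simp
    subgoal by (simp add: hom_iff)
    subgoal using symm_natural[OF hom hom] by simp
    subgoal by simp
    subgoal using pentagon by simp
    subgoal using triangle by simp
    subgoal using hexagon by simp
    subgoal by (simp add: assoc_strict)
    subgoal by (simp add: lunit_strict)
    subgoal by (simp add: runit_strict)
    subgoal by (simp add: hom_iff trace)
    subgoal using tightening[OF _ hom hom hom] by simp
    subgoal using strength[OF _ _ _ hom hom] by simp
    subgoal using joining[OF _ _ _ _ hom] by simp
    subgoal using vanishing[OF hom] by simp
    subgoal using sliding[OF _ _ hom hom] by simp
    subgoal using yanking by simp
    subgoal using uniformity[OF _ _ hom hom hom] by simp
    done
qed

text \<open>Exactly one arrow joins any two objects. Arrows must inhabit a prescribed type
  \<open>'a\<close>, so the arrow from \<open>X\<close> to \<open>Y\<close> is a code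
  \<open>e (X, Y)\<close> of its endpoints, which \<open>Dom\<close> and \<open>Cod\<close> decode;
  injectivity of \<open>e\<close> is assumed where it is used.\<close>

definition codiscrete :: "'o set \<Rightarrow> ('o, 'b) monstr \<Rightarrow> ('o \<times> 'o \<Rightarrow> 'a) \<Rightarrow> ('o, 'a) utsmcat" where
  "codiscrete O' M e = (let d = inv_into (O' \<times> O') e in
     \<lparr>Ob = O', Ar = e ` (O' \<times> O'), Dom = (\<lambda>f. fst (d f)), Cod = (\<lambda>f. snd (d f)),
      Idt = (\<lambda>X. e (X, X)), Cmp = (\<lambda>f g. e (fst (d f), snd (d g))),
      Plus = \<lparr>TOb = TOb M,
        TAr = (\<lambda>f g. e (TOb M (fst (d f)) (fst (d g)), TOb M (snd (d f)) (snd (d g)))),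
        TUnit = TUnit M, Assoc = (\<lambda>X Y Z. e (TOb M (TOb M X Y) Z, TOb M (TOb M X Y) Z)),
        LUnit = (\<lambda>X. e (X, X)), RUnit = (\<lambda>X. e (X, X)), Symm = (\<lambda>X Y. e (TOb M X Y, TOb M Y X))\<rparr>,
      Trace = (\<lambda>S X Y f. e (X, Y))\<rparr>)"

context
  fixes C :: "('o, 'b, 'm) cat_scheme" and M :: "('o, 'b) monstr" and e :: "'o \<times> 'o \<Rightarrow> 'a"
  assumes C: "strict_symmetric_monoidal C M" and e: "inj_on e (Ob C \<times> Ob C)"
begin

interpretation strict_symmetric_monoidal C M by (rule C)

private abbreviation (input) "K \<equiv> codiscrete (Ob C) M e"

private lemma K_simps:
  "Ob K = Ob C" "Ar K = e ` (Ob C \<times> Ob C)" "Idt K X = e (X, X)" "Cmp K f g = e (Dom K f, Cod K g)"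
  "TOb (Plus K) X Y = TOb M X Y"
  "TAr (Plus K) f g = e (TOb M (Dom K f) (Dom K g), TOb M (Cod K f) (Cod K g))"
  "TUnit (Plus K) = TUnit M" "Assoc (Plus K) X Y Z = e (TOb M (TOb M X Y) Z, TOb M (TOb M X Y) Z)"
  "LUnit (Plus K) X = e (X, X)" "RUnit (Plus K) X = e (X, X)" "Symm (Plus K) X Y = e (TOb M X Y, TOb M Y X)"
  "Trace K S X Y f = e (X, Y)"
  by (simp_all add: codiscrete_def Let_def)

private lemma K_ends [simp]: "X \<in> Ob C \<Longrightarrow> Y \<in> Ob C \<Longrightarrow> Dom K (e (X, Y)) = X"
  "X \<in> Ob C \<Longrightarrow> Y \<in> Ob C \<Longrightarrow> Cod K (e (X, Y)) = Y"
  by (simp_all add: codiscrete_def Let_def inv_into_f_f[OF e])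

private lemma K_hom: "f \<in> hom K X Y \<longleftrightarrow> X \<in> Ob C \<and> Y \<in> Ob C \<and> f = e (X, Y)"
  unfolding hom_def by (auto simp: K_simps)

private lemma K_iso: "f \<in> iso_hom K X Y \<longleftrightarrow> X \<in> Ob C \<and> Y \<in> Ob C \<and> f = e (X, Y)"
  unfolding iso_hom_def inverse_arrows_def
  by (auto simp: K_hom K_simps intro!: exI[of _ "e (Y, X)"])

text \<open>Parallel arrows are equal, so each axiom, uniformity included, is only a matter of
  typing.\<close>

lemma codiscrete_uniformly_traced: "uniformly_traced K (Plus K) (Trace K)"
  by unfold_locales (auto simp: K_hom K_iso K_simps)

lemma codiscrete_functor:
  "strict_sm_functor C M K (Plus K) \<lparr>FOb = \<lambda>X\<in>Ob C. X, FAr = \<lambda>f\<in>Ar C. e (Dom C f, Cod C f)\<rparr>"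
proof -
  interpret K: uniformly_traced K "Plus K" "Trace K" by (rule codiscrete_uniformly_traced)
  show ?thesis
    unfolding strict_sm_functor_def is_functor_def
    using category_axioms K.category_axioms
    by (auto simp: K_hom K_simps in_hom_iff assoc_strict lunit_strict runit_strict)
qed

end

section \<open>Consequences of the universal property\<close>

locale free_uniform_trace =
  fixes L :: "(('o, 'a) smcat, (('o, 'a) smcat, 'o, 'a) marr,
               ('o, 'a) utsmcat, (('o, 'a) utsmcat, 'o, 'a) marr) fnctr"
    and \<eta> :: "('o, 'a) smcat \<Rightarrow> (('o, 'a) smcat, 'o, 'a) marr"
    and \<epsilon> :: "('o, 'a) utsmcat \<Rightarrow> (('o, 'a) utsmcat, 'o, 'a) marr"
  assumes universe: "infinite (UNIV :: 'a set)"
    and adj: "adjunction SMC UTSMC L UTSMC_to_SMC \<eta> \<epsilon>"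
begin

lemma SMC_hom: "m \<in> hom SMC C D \<longleftrightarrow> Src m = C \<and> Trg m = D
    \<and> strict_symmetric_monoidal C (Plus C) \<and> strict_symmetric_monoidal D (Plus D)
    \<and> strict_sm_functor C (Plus C) D (Plus D) (Fun m)
    \<and> FOb (Fun m) \<in> extensional (Ob C) \<and> FAr (Fun m) \<in> extensional (Ar C)"
  by (simp add: SMC_def struct_cat_hom)

lemma UTSMC_hom: "m \<in> hom UTSMC C D \<longleftrightarrow> Src m = C \<and> Trg m = D
    \<and> uniformly_traced C (Plus C) (Trace C) \<and> uniformly_traced D (Plus D) (Trace D)
    \<and> strict_sm_functor C (Plus C) D (Plus D) (Fun m)
    \<and> preserves_trace C (Plus C) (Trace C) (Trace D) (Fun m)
    \<and> FOb (Fun m) \<in> extensional (Ob C) \<and> FAr (Fun m) \<in> extensional (Ar C)"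
  by (auto simp: UTSMC_def struct_cat_hom)

lemma Ob_SMC: "C \<in> Ob SMC \<longleftrightarrow> strict_symmetric_monoidal C (Plus C)"
  and Ob_UTSMC: "D \<in> Ob UTSMC \<longleftrightarrow> uniformly_traced D (Plus D) (Trace D)"
  by (simp_all add: SMC_def UTSMC_def)

lemma SMC_category: "category (SMC :: (('o, 'a) smcat, (('o, 'a) smcat, 'o, 'a) marr) cat)"
  and UTSMC_category: "category (UTSMC :: (('o, 'a) utsmcat, (('o, 'a) utsmcat, 'o, 'a) marr) cat)"
  using adjunction_left[OF adj] by (auto dest: functorD(1,2))

context
  fixes C :: "('o, 'a) smcat"
  assumes C: "strict_symmetric_monoidal C (Plus C)"
begin

abbreviation "free \<equiv> FOb L C"
abbreviation "incl \<equiv> Fun (\<eta> C)"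

lemma free_uniformly_traced: "uniformly_traced free (Plus free) (Trace free)"
  using functor_ob[OF adjunction_left[OF adj]] C by (simp add: Ob_SMC Ob_UTSMC)

lemma unit_hom_SMC: "\<eta> C \<in> hom SMC C (smcat.truncate free)"
  using unit_hom[OF adj] C by (simp add: Ob_SMC UTSMC_to_SMC_def)

lemma incl_functor: "strict_sm_functor C (Plus C) free (Plus free) incl"
  using unit_hom_SMC strict_sm_functor_cong[of C C "smcat.truncate free" free]
  by (simp add: SMC_hom)

lemma universal_existence:
  assumes D: "uniformly_traced D (Plus D) (Trace D)" and F: "strict_sm_functor C (Plus C) D (Plus D) F"
  shows "\<exists>G. G \<in> hom UTSMC free D
    \<and> (\<forall>X\<in>Ob C. FOb (Fun G) (FOb incl X) = FOb F X) \<and> (\<forall>f\<in>Ar C. FAr (Fun G) (FAr incl f) = FAr F f)"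
proof -
  interpret D: uniformly_traced D "Plus D" "Trace D" by fact
  interpret C: strict_symmetric_monoidal C "Plus C" by (rule C)
  \<comment> \<open>Arrows of \<open>SMC\<close> carry extensional functors, so \<open>F\<close> is
    first cut down to the carriers of \<open>C\<close>.\<close>
  let ?F = "\<lparr>FOb = restrict (FOb F) (Ob C), FAr = restrict (FAr F) (Ar C)\<rparr>"
  let ?g = "\<lparr>Src = C, Trg = smcat.truncate D, Fun = ?F\<rparr>"
  note FF = strict_sm_functor[OF F]
  \<comment> \<open>Restriction is precomposition with the extensional identity, so strictness of
    \<open>?F\<close> follows from closure under composition.\<close>
  have "?F = \<lparr>FOb = compose (Ob C) (FOb F) (\<lambda>X\<in>Ob C. X), FAr = compose (Ar C) (FAr F) (\<lambda>f\<in>Ar C. f)\<rparr>"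
    by (auto simp: compose_def fun_eq_iff)
  then have "strict_sm_functor C (Plus C) D (Plus D) ?F"
    using strict_sm_functor_compose[OF strict_sm_functor_ident F] C.symmetric_monoidal_axioms by simp
  then have "?g \<in> hom SMC C (smcat.truncate D)"
    using C D.strict_symmetric_monoidal_axioms
    by (simp add: SMC_hom strict_sm_functor_cong[of C C "smcat.truncate D" D]
        strict_symmetric_monoidal_cong[of "smcat.truncate D" D])
  then obtain G where G: "G \<in> hom UTSMC free D" and eq: "Cmp SMC (\<eta> C) (FAr UTSMC_to_SMC G) = ?g"
    using adjunction_factor[OF adj, of C D ?g] C D by (auto simp: Ob_SMC Ob_UTSMC UTSMC_to_SMC_def)
  have "Src (\<eta> C) = C" using unit_hom_SMC by (simp add: SMC_hom)
  then have "compose (Ob C) (FOb (Fun G)) (FOb incl) = restrict (FOb F) (Ob C)"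
    "compose (Ar C) (FAr (Fun G)) (FAr incl) = restrict (FAr F) (Ar C)"
    using eq by (simp_all add: SMC_def UTSMC_to_SMC_def)
  then have "(\<forall>X\<in>Ob C. FOb (Fun G) (FOb incl X) = FOb F X) \<and> (\<forall>f\<in>Ar C. FAr (Fun G) (FAr incl f) = FAr F f)"
    by (auto simp: compose_def restrict_def fun_eq_iff split: if_splits)
  with G show ?thesis by blast
qed

lemma universal_uniqueness:
  assumes G: "G \<in> hom UTSMC free D" and G': "G' \<in> hom UTSMC free D"
    and ob: "\<And>X. X \<in> Ob C \<Longrightarrow> FOb (Fun G) (FOb incl X) = FOb (Fun G') (FOb incl X)"
    and ar: "\<And>f. f \<in> Ar C \<Longrightarrow> FAr (Fun G) (FAr incl f) = FAr (Fun G') (FAr incl f)"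
  shows "G = G'"
proof (rule adjunction_factor_unique[OF adj _ G G'])
  show "C \<in> Ob SMC" using C by (simp add: Ob_SMC)
  have "Src (\<eta> C) = C" using unit_hom_SMC by (simp add: SMC_hom)
  then show "Cmp SMC (\<eta> C) (FAr UTSMC_to_SMC G) = Cmp SMC (\<eta> C) (FAr UTSMC_to_SMC G')"
    using ob ar G G' by (auto simp: SMC_def UTSMC_to_SMC_def UTSMC_hom compose_def)
qed

text \<open>The free category is compared with the codiscrete category on the objects of \<open>C\<close>, which
  carries a unique trace; this is where the arrow type has to have room for pairs of objects.\<close>

lemma incl_inj: "inj_on (FOb incl) (Ob C)"
proof -
  interpret strict_symmetric_monoidal C "Plus C" by (rule C)
  obtain p :: "'a \<times> 'a \<Rightarrow> 'a" where "bij_betw p (UNIV \<times> UNIV) UNIV"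
    using card_of_Times_same_infinite[OF universe] card_of_ordIso by blast
  then have p: "inj p" by (simp add: bij_betw_def)
  \<comment> \<open>Objects are represented by their identity arrows, so a code for pairs of arrows
    also codes pairs of objects; only the cardinality of the arrow type matters.\<close>
  define e where "e = p \<circ> map_prod (Idt C) (Idt C)"
  have "inj_on (Idt C) (Ob C)"
    by (rule inj_on_inverseI[of _ "Dom C"]) simp
  then have e: "inj_on e (Ob C \<times> Ob C)"
    unfolding e_def using p by (intro comp_inj_on map_prod_inj_on) (auto intro: inj_on_subset)
  \<comment> \<open>The factorisation through the codiscrete category is a left inverse of the unit
    on objects.\<close>
  obtain G :: "(('o, 'a) utsmcat, 'o, 'a) marr" where "\<forall>X\<in>Ob C. FOb (Fun G) (FOb incl X) = X"
    using universal_existence[OF codiscrete_uniformly_traced[OF C e] codiscrete_functor[OF C e]] by auto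
  then show ?thesis by (intro inj_on_inverseI[of _ "FOb (Fun G)"]) simp
qed

text \<open>The arrows satisfying \<open>P\<close> form a uniformly traced subcategory through which the unit factors, and
  the factorisation followed by the inclusion is the identity by universality.\<close>

lemma generated:
  assumes base: "\<And>f. f \<in> Ar C \<Longrightarrow> P (FAr incl f)"
    and comp: "\<And>f g. \<lbrakk>f \<in> Ar free; g \<in> Ar free; Cod free f = Dom free g; P f; P g\<rbrakk> \<Longrightarrow> P (Cmp free f g)"
    and tensor: "\<And>f g. \<lbrakk>f \<in> Ar free; g \<in> Ar free; P f; P g\<rbrakk> \<Longrightarrow> P (TAr (Plus free) f g)"
    and trace: "\<And>S X Y f. \<lbrakk>S \<in> Ob free; X \<in> Ob free; Y \<in> Ob free; f \<in> Ar free;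
        Dom free f = TOb (Plus free) S X; Cod free f = TOb (Plus free) S Y; P f\<rbrakk>
      \<Longrightarrow> P (Trace free S X Y f)"
  shows "FOb incl ` Ob C = Ob free" and "\<And>f. f \<in> Ar free \<Longrightarrow> P f"
proof -
  interpret C: strict_symmetric_monoidal C "Plus C" by (rule C)
  interpret D: uniformly_traced free "Plus free" "Trace free" by (rule free_uniformly_traced)
  note h = incl_functor
  note hF = strict_sm_functor[OF h]
  let ?O = "FOb incl ` Ob C"
  \<comment> \<open>The endpoints are required to be images of objects, so that the same subcategory
    yields surjectivity on objects and the induction over arrows.\<close>
  let ?A = "{f \<in> Ar free. Dom free f \<in> ?O \<and> Cod free f \<in> ?O \<and> P f}"
  let ?S = "free\<lparr>Ob := ?O, Ar := ?A\<rparr>"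
  have O: "?O \<subseteq> Ob free" using functor_ob[OF hF] by blast
  have S: "uniformly_traced ?S (Plus free) (Trace free)"
  proof (rule sub_uniformly_traced[OF D.uniformly_traced_axioms O])
    fix X assume "X \<in> ?O"
    then obtain X0 where "X0 \<in> Ob C" "X = FOb incl X0" by blast
    then show "Idt free X \<in> ?A"
      using base[of "Idt C X0"] functor_ident[OF hF, of X0] functor_ob[OF hF, of X0] by auto
  next
    fix X Y assume "X \<in> ?O" "Y \<in> ?O"
    then obtain X0 Y0 where *: "X0 \<in> Ob C" "X = FOb incl X0" "Y0 \<in> Ob C" "Y = FOb incl Y0" by blast
    then have "TOb (Plus C) X0 Y0 \<in> Ob C" "TOb (Plus free) X Y = FOb incl (TOb (Plus C) X0 Y0)"
      "TOb (Plus C) Y0 X0 \<in> Ob C" "TOb (Plus free) Y X = FOb incl (TOb (Plus C) Y0 X0)"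
      by (simp_all add: sm_tensor_ob[OF h])
    then show XY: "TOb (Plus free) X Y \<in> ?O" and "Symm (Plus free) X Y \<in> ?A"
      using base[of "Symm (Plus C) X0 Y0"] sm_symm[OF h, of X0 Y0] functor_ob[OF hF, of X0]
        functor_ob[OF hF, of Y0] * by auto
  next
    show "TUnit (Plus free) \<in> ?O"
      using C.unit_ob sm_unit[OF h] by (metis imageI)
  next
    fix f g assume "f \<in> ?A" "g \<in> ?A"
    moreover have "TOb (Plus free) X Y \<in> ?O" if "X \<in> ?O" "Y \<in> ?O" for X Y
    proof -
      from that obtain X0 Y0 where *: "X0 \<in> Ob C" "X = FOb incl X0" "Y0 \<in> Ob C" "Y = FOb incl Y0" by blast
      then have "TOb (Plus C) X0 Y0 \<in> Ob C" "TOb (Plus free) X Y = FOb incl (TOb (Plus C) X0 Y0)"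
        by (simp_all add: sm_tensor_ob[OF h])
      then show ?thesis by blast
    qed
    ultimately show "TAr (Plus free) f g \<in> ?A"
      using tensor by simp
  next
    fix S X Y f assume *: "S \<in> ?O" "X \<in> ?O" "Y \<in> ?O" "f \<in> ?A"
      "Dom free f = TOb (Plus free) S X" "Cod free f = TOb (Plus free) S Y"
    then have "S \<in> Ob free" "X \<in> Ob free" "Y \<in> Ob free" "f \<in> Ar free" "P f"
      using O by blast+
    then show "Trace free S X Y f \<in> ?A"
      using trace[of S X Y f] * by simp
  qed (use comp in auto)
  interpret S: uniformly_traced ?S "Plus free" "Trace free" by (rule S)
  have hS: "strict_sm_functor C (Plus C) ?S (Plus free) incl"
    unfolding strict_sm_functor_def is_functor_def
    using C.category_axioms S.category_axioms
    by (auto simp: C.in_hom_iff S.in_hom_iff base functor_arr[OF hF] functor_ident[OF hF]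
        functor_comp[OF hF] sm_tensor_ob[OF h] sm_tensor_ar[OF h] sm_unit[OF h] sm_assoc[OF h]
        sm_lunit[OF h] sm_runit[OF h] sm_symm[OF h])
  have "uniformly_traced ?S (Plus ?S) (Trace ?S)" "strict_sm_functor C (Plus C) ?S (Plus ?S) incl"
    using S hS by simp_all
  then obtain G where G: "G \<in> hom UTSMC free ?S"
    and Gob: "\<And>X. X \<in> Ob C \<Longrightarrow> FOb (Fun G) (FOb incl X) = FOb incl X"
    and Gar: "\<And>f. f \<in> Ar C \<Longrightarrow> FAr (Fun G) (FAr incl f) = FAr incl f"
    using universal_existence by blast
  \<comment> \<open>The same functor with its target enlarged from the subcategory to the whole free
    category, which makes it comparable with the identity.\<close>
  let ?G = "\<lparr>Src = free, Trg = free, Fun = Fun G\<rparr>"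
  have GS: "strict_sm_functor free (Plus free) ?S (Plus free) (Fun G)"
    "preserves_trace free (Plus free) (Trace free) (Trace free) (Fun G)"
    "FOb (Fun G) \<in> extensional (Ob free)" "FAr (Fun G) \<in> extensional (Ar free)"
    using G by (auto simp: UTSMC_hom)
  note GF = strict_sm_functor[OF GS(1)]
  have "strict_sm_functor free (Plus free) free (Plus free) (Fun G)"
    unfolding strict_sm_functor_def is_functor_def
    using D.category_axioms functor_ob[OF GF] functor_arr[OF GF] O
    by (simp add: D.in_hom_iff functor_ident[OF GF] functor_comp[OF GF] subset_iff
        sm_tensor_ob[OF GS(1)] sm_tensor_ar[OF GS(1)] sm_unit[OF GS(1)] sm_assoc[OF GS(1)]
        sm_lunit[OF GS(1)] sm_runit[OF GS(1)] sm_symm[OF GS(1)])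
  then have "?G \<in> hom UTSMC free free"
    using GS D.uniformly_traced_axioms by (simp add: UTSMC_hom)
  moreover have "Idt UTSMC free \<in> hom UTSMC free free"
    using D.uniformly_traced_axioms by (intro category.id_hom UTSMC_category) (simp add: Ob_UTSMC)
  ultimately have "?G = Idt UTSMC free"
    by (rule universal_uniqueness)
      (auto simp: Gob Gar UTSMC_def functor_ob[OF hF] functor_arr[OF hF])
  then have FG: "Fun G = \<lparr>FOb = \<lambda>X\<in>Ob free. X, FAr = \<lambda>f\<in>Ar free. f\<rparr>"
    by (simp add: UTSMC_def)
  have "X \<in> ?O" if "X \<in> Ob free" for X
    using functor_ob[OF GF that] that by (simp add: FG)
  with O show "FOb incl ` Ob C = Ob free" by blast
  show "P f" if "f \<in> Ar free" for f
    using functor_arr(1)[OF GF that] that by (simp add: FG)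
qed

lemma incl_bij: "bij_betw (FOb incl) (Ob C) (Ob free)"
  using incl_inj generated(1)[of "\<lambda>_. True"] by (simp add: bij_betw_def)

end

end

section \<open>The rig structure on the free uniformly traced category\<close>

context right_strict_rig
begin

lemma times_plus_ob [simp]:
  "\<lbrakk>X \<in> Ob C; Y \<in> Ob C; Z \<in> Ob C\<rbrakk> \<Longrightarrow> (X \<oplus> Y) \<otimes> Z = X \<otimes> Z \<oplus> Y \<otimes> Z"
  using dist_r_iso[of X Y Z] by (simp add: dist_r_strict)

lemma times_zero_ob [simp]:
  "X \<in> Ob C \<Longrightarrow> \<zero> \<otimes> X = \<zero>" "X \<in> Ob C \<Longrightarrow> X \<otimes> \<zero> = \<zero>"
  using ann_l_iso[of X] ann_r_iso[of X] by (simp_all add: ann_l_strict ann_r_strict)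

lemma times_plus_ar:
  "\<lbrakk>f \<in> Ar C; g \<in> Ar C; k \<in> Ar C\<rbrakk> \<Longrightarrow> (f \<oplus>\<^sub>a g) \<otimes>\<^sub>a k = f \<otimes>\<^sub>a k \<oplus>\<^sub>a g \<otimes>\<^sub>a k"
  using dist_r_natural[of f "Dom C f" "Cod C f" g "Dom C g" "Cod C g" k "Dom C k" "Cod C k"]
  by (simp add: additive.in_hom_iff dist_r_strict)

lemma times_zero_ar:
  "f \<in> Ar C \<Longrightarrow> \<i> \<zero> \<otimes>\<^sub>a f = \<i> \<zero>" "f \<in> Ar C \<Longrightarrow> f \<otimes>\<^sub>a \<i> \<zero> = \<i> \<zero>"
  using ann_l_natural[of f "Dom C f" "Cod C f"] ann_r_natural[of f "Dom C f" "Cod C f"]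
  by (simp_all add: additive.in_hom_iff ann_l_strict ann_r_strict)

lemma dist_l_arr [simp]:
  assumes "X \<in> Ob C" "Y \<in> Ob C" "Z \<in> Ob C"
  shows "\<delta>\<^sup>l X Y Z \<in> Ar C" "Dom C (\<delta>\<^sup>l X Y Z) = X \<otimes> (Y \<oplus> Z)" "Cod C (\<delta>\<^sup>l X Y Z) = X \<otimes> Y \<oplus> X \<otimes> Z"
  using additive.iso_homD[OF dist_l_iso[OF assms]] by auto

lemma symm_zero [simp]: "X \<in> Ob C \<Longrightarrow> \<sigma>\<^sup>\<times> X \<zero> = \<i> \<zero>" "X \<in> Ob C \<Longrightarrow> \<sigma>\<^sup>\<times> \<zero> X = \<i> \<zero>"
proof -
  assume [simp]: "X \<in> Ob C"
  show "\<sigma>\<^sup>\<times> X \<zero> = \<i> \<zero>"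
    using laplaza15[of X] by (simp add: ann_l_strict ann_r_strict)
  then show "\<sigma>\<^sup>\<times> \<zero> X = \<i> \<zero>"
    using multiplicative.symm_invol[of X \<zero>] by simp
qed

lemmas strict_simps [simp] =
  ann_l_strict ann_r_strict dist_r_strict
  additive.assoc_strict additive.lunit_strict additive.runit_strict
  multiplicative.assoc_strict multiplicative.lunit_strict multiplicative.runit_strict

text \<open>The right strict form of Laplaza's axioms (II) and (IX).\<close>

lemma symm_dist_l:
  "\<lbrakk>X \<in> Ob C; Y \<in> Ob C; Z \<in> Ob C\<rbrakk> \<Longrightarrow> \<sigma>\<^sup>\<times> (X \<oplus> Y) Z \<Zsemi> \<delta>\<^sup>l Z X Y = \<sigma>\<^sup>\<times> X Z \<oplus>\<^sub>a \<sigma>\<^sup>\<times> Y Z"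
  using laplaza2[of X Y Z] by simp

lemma dist_l_plus:
  "\<lbrakk>W \<in> Ob C; X \<in> Ob C; Y \<in> Ob C; Z \<in> Ob C\<rbrakk> \<Longrightarrow>
    \<delta>\<^sup>l (W \<oplus> X) Y Z = (\<delta>\<^sup>l W Y Z \<oplus>\<^sub>a \<delta>\<^sup>l X Y Z) \<Zsemi> additive.middle (W \<otimes> Y) (W \<otimes> Z) (X \<otimes> Y) (X \<otimes> Z)"
  using laplaza9[of W X Y Z] by simp

text \<open>This is the use of right strictness: the comparison maps of \<open>- \<otimes> Z\<close>
  for sums and for the zero object are \<open>DistR\<close> and \<open>AnnL\<close>, both
  identities. Compatibility with the additive symmetry is axiom (III).\<close>

lemma right_times_functor:
  assumes [simp]: "Z \<in> Ob C"
  shows "strict_sm_functor C (Plus C) C (Plus C) \<lparr>FOb = \<lambda>X\<in>Ob C. X \<otimes> Z, FAr = \<lambda>f\<in>Ar C. f \<otimes>\<^sub>a \<i> Z\<rparr>"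
  unfolding strict_sm_functor_def is_functor_def
  using laplaza3[of _ _ Z] additive.category_axioms
  by (auto simp: additive.in_hom_iff times_plus_ar multiplicative.tensor_arr_comp)

end

text \<open>Isolates what the construction of the rig takes from the adjunction: a traced category,
  the unit \<open>h\<close>, the induction over generated arrows, and for each object
  \<open>Z\<close> an extension \<open>R Z\<close> of \<open>- \<otimes> Z\<close>. Universality
  itself returns only when rig functors are lifted.\<close>

locale free_rig_data =
  fixes A :: "('o, 'a, 'm) rigcat_scheme" and D :: "('p, 'b) utsmcat"
    and h :: "('o, 'a, 'p, 'b) fnctr" and R :: "'o \<Rightarrow> ('p, 'b, 'p, 'b) fnctr"
  assumes C: "right_strict_rig A"
    and D: "uniformly_traced D (Plus D) (Trace D)"
    and h: "strict_sm_functor A (Plus A) D (Plus D) h"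
    and h_bij: "bij_betw (FOb h) (Ob A) (Ob D)"
    and generated [consumes 1, case_names base comp tensor trace]:
      "\<And>P f. \<lbrakk>f \<in> Ar D; \<And>f. f \<in> Ar A \<Longrightarrow> P (FAr h f);
        \<And>f g. \<lbrakk>f \<in> Ar D; g \<in> Ar D; Cod D f = Dom D g; P f; P g\<rbrakk> \<Longrightarrow> P (Cmp D f g);
        \<And>f g. \<lbrakk>f \<in> Ar D; g \<in> Ar D; P f; P g\<rbrakk> \<Longrightarrow> P (TAr (Plus D) f g);
        \<And>S X Y f. \<lbrakk>S \<in> Ob D; X \<in> Ob D; Y \<in> Ob D; f \<in> Ar D; Dom D f = TOb (Plus D) S X;
            Cod D f = TOb (Plus D) S Y; P f\<rbrakk> \<Longrightarrow> P (Trace D S X Y f)\<rbrakk> \<Longrightarrow> P f"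
    and R_functor: "Z \<in> Ob A \<Longrightarrow> strict_sm_functor D (Plus D) D (Plus D) (R Z)"
    and R_trace: "Z \<in> Ob A \<Longrightarrow> preserves_trace D (Plus D) (Trace D) (Trace D) (R Z)"
    and R_ob: "\<lbrakk>X \<in> Ob A; Z \<in> Ob A\<rbrakk> \<Longrightarrow> FOb (R Z) (FOb h X) = FOb h (TOb (Times A) X Z)"
    and R_ar: "\<lbrakk>f \<in> Ar A; Z \<in> Ob A\<rbrakk> \<Longrightarrow> FAr (R Z) (FAr h f) = FAr h (TAr (Times A) f (Idt A Z))"
begin

sublocale C: right_strict_rig A by (rule C)
sublocale D: uniformly_traced D "Plus D" "Trace D" by (rule D)

text \<open>The objects of \<open>D\<close> are renamed objects of \<open>A\<close>. Reading the
  name back lets the product of objects and all structural arrows be defined as images under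
  \<open>h\<close>.\<close>

definition k where "k = inv_into (Ob A) (FOb h)"

abbreviation comp (infixl "\<Zsemi>" 55) where "f \<Zsemi> g \<equiv> Cmp D f g"
abbreviation ident ("\<i>") where "\<i> X \<equiv> Idt D X"
abbreviation plus_ob (infixr "\<oplus>" 65) where "X \<oplus> Y \<equiv> TOb (Plus D) X Y"
abbreviation plus_ar (infixr "\<oplus>\<^sub>a" 65) where "f \<oplus>\<^sub>a g \<equiv> TAr (Plus D) f g"
abbreviation zero ("\<zero>") where "\<zero> \<equiv> TUnit (Plus D)"
abbreviation tr where "tr \<equiv> Trace D"

definition times_ob (infixr "\<otimes>" 70) where "X \<otimes> Y = FOb h (TOb (Times A) (k X) (k Y))"
definition one ("\<one>") where "\<one> = FOb h (TUnit (Times A))"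
definition rtimes (infixl "\<ltimes>" 70) where "f \<ltimes> Z = FAr (R (k Z)) f"
definition symm ("\<s>") where "\<s> X Y = FAr h (Symm (Times A) (k X) (k Y))"
definition dist ("\<d>") where "\<d> X Y Z = FAr h (DistL A (k X) (k Y) (k Z))"
text \<open>The conjugated form makes \<open>ltimes_symm\<close> and \<open>rtimes_symm\<close> hold
  for every arrow of \<open>D\<close>, image or not; the price is paid in
  \<open>ltimes_plus_left\<close> and \<open>interchange\<close>.\<close>

definition ltimes (infixr "\<rtimes>" 70) where "X \<rtimes> g = \<s> X (Dom D g) \<Zsemi> (g \<ltimes> X) \<Zsemi> \<s> (Cod D g) X"
definition times_ar (infixr "\<otimes>\<^sub>a" 70) where "f \<otimes>\<^sub>a g = (f \<ltimes> Dom D g) \<Zsemi> (Cod D f \<rtimes> g)"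

definition rig :: "('p, 'b) utrigcat" where
  "rig = \<lparr>Ob = Ob D, Ar = Ar D, Dom = Dom D, Cod = Cod D, Idt = Idt D, Cmp = Cmp D, Plus = Plus D,
     Times = \<lparr>TOb = (\<otimes>), TAr = (\<otimes>\<^sub>a), TUnit = \<one>,
       Assoc = (\<lambda>X Y Z. FAr h (Assoc (Times A) (k X) (k Y) (k Z))),
       LUnit = (\<lambda>X. FAr h (LUnit (Times A) (k X))),
       RUnit = (\<lambda>X. FAr h (RUnit (Times A) (k X))), Symm = \<s>\<rparr>,
     DistL = \<d>, DistR = (\<lambda>X Y Z. FAr h (DistR A (k X) (k Y) (k Z))),
     AnnL = (\<lambda>X. FAr h (AnnL A (k X))), AnnR = (\<lambda>X. FAr h (AnnR A (k X))), RTrace = Trace D\<rparr>"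

lemma k_h [simp]: "X \<in> Ob A \<Longrightarrow> k (FOb h X) = X"
  using h_bij by (simp add: k_def bij_betw_def inv_into_f_f)

lemma ob_cases:
  assumes "X \<in> Ob D"
  obtains X0 where "X = FOb h X0" "X0 \<in> Ob A"
  using assms h_bij by (auto simp: bij_betw_def)

lemma k_ob [simp]: "X \<in> Ob D \<Longrightarrow> k X \<in> Ob A"
  by (erule ob_cases) simp

lemmas h_functor = strict_sm_functor[OF h]

lemmas h_arr [simp] = functor_ob[OF h_functor] functor_arr[OF h_functor]

text \<open>Oriented so that an expression built from images collapses to the image of one object or
  arrow of \<open>A\<close>. Together with \<open>ob_cases\<close> this reduces statements about
  structural arrows of \<open>D\<close> to the same statements in \<open>A\<close>.\<close>

lemma h_simps:
  "X \<in> Ob A \<Longrightarrow> Y \<in> Ob A \<Longrightarrow> FOb h X \<oplus> FOb h Y = FOb h (TOb (Plus A) X Y)"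
  "f \<in> Ar A \<Longrightarrow> g \<in> Ar A \<Longrightarrow> FAr h f \<oplus>\<^sub>a FAr h g = FAr h (TAr (Plus A) f g)"
  "\<zero> = FOb h (TUnit (Plus A))"
  "X \<in> Ob A \<Longrightarrow> Y \<in> Ob A \<Longrightarrow> Symm (Plus D) (FOb h X) (FOb h Y) = FAr h (Symm (Plus A) X Y)"
  "X \<in> Ob A \<Longrightarrow> \<i> (FOb h X) = FAr h (Idt A X)"
  "f \<in> Ar A \<Longrightarrow> g \<in> Ar A \<Longrightarrow> Cod A f = Dom A g \<Longrightarrow> FAr h f \<Zsemi> FAr h g = FAr h (Cmp A f g)"
  "X \<in> Ob A \<Longrightarrow> Y \<in> Ob A \<Longrightarrow> FOb h X \<otimes> FOb h Y = FOb h (TOb (Times A) X Y)"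
  "X \<in> Ob A \<Longrightarrow> Y \<in> Ob A \<Longrightarrow> \<s> (FOb h X) (FOb h Y) = FAr h (Symm (Times A) X Y)"
  "X \<in> Ob A \<Longrightarrow> Y \<in> Ob A \<Longrightarrow> Z \<in> Ob A \<Longrightarrow> \<d> (FOb h X) (FOb h Y) (FOb h Z) = FAr h (DistL A X Y Z)"
  "f \<in> Ar A \<Longrightarrow> Z \<in> Ob A \<Longrightarrow> FAr h f \<ltimes> FOb h Z = FAr h (TAr (Times A) f (Idt A Z))"
  by (simp_all add: sm_tensor_ob[OF h] sm_tensor_ar[OF h] sm_unit[OF h] sm_symm[OF h] functor_ident[OF h_functor]
      functor_comp[OF h_functor] times_ob_def symm_def dist_def rtimes_def R_ar)

text \<open>In \<open>A\<close> the symmetry is natural and involutive for \<open>\<otimes>\<close>,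
  so conjugating right whiskering gives back left whiskering.\<close>

lemma h_ltimes:
  assumes [simp]: "X \<in> Ob A" "g \<in> Ar A"
  shows "FOb h X \<rtimes> FAr h g = FAr h (TAr (Times A) (Idt A X) g)"
proof -
  have "Cmp A (Cmp A (Symm (Times A) X (Dom A g)) (TAr (Times A) g (Idt A X))) (Symm (Times A) (Cod A g) X)
      = Cmp A (Cmp A (TAr (Times A) (Idt A X) g) (Symm (Times A) X (Cod A g))) (Symm (Times A) (Cod A g) X)"
    using C.multiplicative.symm_arr_natural[of "Idt A X" g] by simp
  also have "\<dots> = TAr (Times A) (Idt A X) g"
    by (simp add: C.additive.arr_comp_assoc)
  finally show ?thesis
    by (simp add: ltimes_def h_simps)
qed

lemma h_times_ar:
  assumes [simp]: "f \<in> Ar A" "g \<in> Ar A"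
  shows "FAr h f \<otimes>\<^sub>a FAr h g = FAr h (TAr (Times A) f g)"
  by (simp add: times_ar_def h_simps h_ltimes C.multiplicative.tensor_arr_comp)

lemma times_ob_ob [simp]: "X \<in> Ob D \<Longrightarrow> Y \<in> Ob D \<Longrightarrow> X \<otimes> Y \<in> Ob D" "\<one> \<in> Ob D"
  by (simp_all add: times_ob_def one_def)

lemma times_ob_laws [simp]:
  "\<lbrakk>X \<in> Ob D; Y \<in> Ob D; Z \<in> Ob D\<rbrakk> \<Longrightarrow> (X \<otimes> Y) \<otimes> Z = X \<otimes> Y \<otimes> Z"
  "\<lbrakk>X \<in> Ob D; Y \<in> Ob D; Z \<in> Ob D\<rbrakk> \<Longrightarrow> (X \<oplus> Y) \<otimes> Z = X \<otimes> Z \<oplus> Y \<otimes> Z"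
  "X \<in> Ob D \<Longrightarrow> \<one> \<otimes> X = X" "X \<in> Ob D \<Longrightarrow> X \<otimes> \<one> = X"
  "X \<in> Ob D \<Longrightarrow> \<zero> \<otimes> X = \<zero>" "X \<in> Ob D \<Longrightarrow> X \<otimes> \<zero> = \<zero>"
  by (auto elim!: ob_cases simp: h_simps one_def)

lemma symm_arr [simp]:
  assumes "X \<in> Ob D" "Y \<in> Ob D"
  shows "\<s> X Y \<in> Ar D" "Dom D (\<s> X Y) = X \<otimes> Y" "Cod D (\<s> X Y) = Y \<otimes> X"
  using assms by (auto simp: symm_def times_ob_def)

lemma dist_arr [simp]:
  assumes "X \<in> Ob D" "Y \<in> Ob D" "Z \<in> Ob D"
  shows "\<d> X Y Z \<in> Ar D" "Dom D (\<d> X Y Z) = X \<otimes> (Y \<oplus> Z)" "Cod D (\<d> X Y Z) = X \<otimes> Y \<oplus> X \<otimes> Z"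
  using assms by (auto elim!: ob_cases simp: h_simps)

lemma symm_laws [simp]:
  "X \<in> Ob D \<Longrightarrow> Y \<in> Ob D \<Longrightarrow> \<s> X Y \<Zsemi> \<s> Y X = \<i> (X \<otimes> Y)"
  "X \<in> Ob D \<Longrightarrow> \<s> X \<zero> = \<i> \<zero>" "X \<in> Ob D \<Longrightarrow> \<s> \<zero> X = \<i> \<zero>"
  "X \<in> Ob D \<Longrightarrow> \<s> X \<one> = \<i> X" "X \<in> Ob D \<Longrightarrow> \<s> \<one> X = \<i> X"
  by (auto elim!: ob_cases simp: h_simps one_def)

lemma symm_symm_comp [simp]:
  "X \<in> Ob D \<Longrightarrow> Y \<in> Ob D \<Longrightarrow> f \<in> Ar D \<Longrightarrow> Dom D f = X \<otimes> Y \<Longrightarrow> \<s> X Y \<Zsemi> (\<s> Y X \<Zsemi> f) = f"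
  by (subst D.arr_comp_assoc[symmetric]) simp_all

section \<open>Right whiskering\<close>

lemma rtimes_arr [simp]:
  assumes "f \<in> Ar D" "Z \<in> Ob D"
  shows "f \<ltimes> Z \<in> Ar D" "Dom D (f \<ltimes> Z) = Dom D f \<otimes> Z" "Cod D (f \<ltimes> Z) = Cod D f \<otimes> Z"
proof -
  have *: "FOb (R (k Z)) X = X \<otimes> Z" if "X \<in> Ob D" for X
    using that assms(2) by (auto elim!: ob_cases simp: R_ob h_simps)
  note F = strict_sm_functor[OF R_functor[OF k_ob[OF assms(2)]]]
  show "f \<ltimes> Z \<in> Ar D" "Dom D (f \<ltimes> Z) = Dom D f \<otimes> Z" "Cod D (f \<ltimes> Z) = Cod D f \<otimes> Z"
    using functor_arr[OF F assms(1)] assms(1) by (simp_all add: rtimes_def *)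
qed

lemma rtimes_laws:
  assumes Z: "Z \<in> Ob D"
  shows rtimes_ident: "X \<in> Ob D \<Longrightarrow> \<i> X \<ltimes> Z = \<i> (X \<otimes> Z)"
    and rtimes_comp: "\<lbrakk>f \<in> Ar D; g \<in> Ar D; Cod D f = Dom D g\<rbrakk> \<Longrightarrow> (f \<Zsemi> g) \<ltimes> Z = (f \<ltimes> Z) \<Zsemi> (g \<ltimes> Z)"
    and rtimes_plus: "\<lbrakk>f \<in> Ar D; g \<in> Ar D\<rbrakk> \<Longrightarrow> (f \<oplus>\<^sub>a g) \<ltimes> Z = f \<ltimes> Z \<oplus>\<^sub>a g \<ltimes> Z"
    and rtimes_trace: "\<lbrakk>S \<in> Ob D; X \<in> Ob D; Y \<in> Ob D; f \<in> Ar D; Dom D f = S \<oplus> X; Cod D f = S \<oplus> Y\<rbrakk>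
      \<Longrightarrow> tr S X Y f \<ltimes> Z = tr (S \<otimes> Z) (X \<otimes> Z) (Y \<otimes> Z) (f \<ltimes> Z)"
proof -
  have *: "FOb (R (k Z)) X = X \<otimes> Z" if "X \<in> Ob D" for X
    using that Z by (auto elim!: ob_cases simp: R_ob h_simps)
  note R = R_functor[OF k_ob[OF Z]]
  note F = strict_sm_functor[OF R]
  show "X \<in> Ob D \<Longrightarrow> \<i> X \<ltimes> Z = \<i> (X \<otimes> Z)"
    by (simp add: rtimes_def functor_ident[OF F] *)
  show "\<lbrakk>f \<in> Ar D; g \<in> Ar D; Cod D f = Dom D g\<rbrakk> \<Longrightarrow> (f \<Zsemi> g) \<ltimes> Z = (f \<ltimes> Z) \<Zsemi> (g \<ltimes> Z)"
    by (simp add: rtimes_def functor_comp[OF F])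
  show "\<lbrakk>f \<in> Ar D; g \<in> Ar D\<rbrakk> \<Longrightarrow> (f \<oplus>\<^sub>a g) \<ltimes> Z = f \<ltimes> Z \<oplus>\<^sub>a g \<ltimes> Z"
    by (simp add: rtimes_def sm_tensor_ar[OF R])
  show "\<lbrakk>S \<in> Ob D; X \<in> Ob D; Y \<in> Ob D; f \<in> Ar D; Dom D f = S \<oplus> X; Cod D f = S \<oplus> Y\<rbrakk>
      \<Longrightarrow> tr S X Y f \<ltimes> Z = tr (S \<otimes> Z) (X \<otimes> Z) (Y \<otimes> Z) (f \<ltimes> Z)"
    using R_trace[OF k_ob[OF Z]] by (simp add: rtimes_def preserves_trace_def D.in_hom_iff *)
qed

text \<open>Both sides preserve composition, sums and traces in \<open>f\<close> and agree on
  images, so the induction has content only in its base case. The next lemma follows the same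
  pattern.\<close>

lemma rtimes_rtimes:
  assumes "f \<in> Ar D" and YZ: "Y \<in> Ob D" "Z \<in> Ob D"
  shows "f \<ltimes> Y \<ltimes> Z = f \<ltimes> (Y \<otimes> Z)"
  using assms(1)
proof (induction rule: generated)
  case (base f)
  with YZ show ?case by (auto elim!: ob_cases simp: h_simps)
qed (use YZ in \<open>simp_all add: rtimes_comp rtimes_plus rtimes_trace\<close>)

lemma rtimes_one: "f \<in> Ar D \<Longrightarrow> f \<ltimes> \<one> = f"
proof (induction rule: generated)
  case (base f)
  then show ?case by (simp add: one_def h_simps)
qed (simp_all add: rtimes_comp rtimes_plus rtimes_trace)

text \<open>Whiskering by zero is constant at the identity of zero. In the trace case the traced
  object itself becomes zero, so vanishing applies.\<close>

lemma rtimes_zero: "f \<in> Ar D \<Longrightarrow> f \<ltimes> \<zero> = \<i> \<zero>"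
proof (induction rule: generated)
  case (base f)
  then show ?case by (simp add: h_simps C.times_zero_ar)
qed (simp_all add: rtimes_comp rtimes_plus rtimes_trace D.vanishing D.in_hom_iff)

lemma dist_plus:
  "\<lbrakk>W \<in> Ob D; X \<in> Ob D; Y \<in> Ob D; Z \<in> Ob D\<rbrakk> \<Longrightarrow>
    \<d> (W \<oplus> X) Y Z = (\<d> W Y Z \<oplus>\<^sub>a \<d> X Y Z) \<Zsemi> D.middle (W \<otimes> Y) (W \<otimes> Z) (X \<otimes> Y) (X \<otimes> Z)"
  by (auto elim!: ob_cases simp: h_simps C.dist_l_plus)

lemma symm_dist:
  "\<lbrakk>X \<in> Ob D; Y \<in> Ob D; Z \<in> Ob D\<rbrakk> \<Longrightarrow> \<s> (X \<oplus> Y) Z \<Zsemi> \<d> Z X Y = \<s> X Z \<oplus>\<^sub>a \<s> Y Z"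
  by (auto elim!: ob_cases simp: h_simps C.symm_dist_l)

section \<open>Left whiskering and naturality of the left distributor\<close>

lemma ltimes_arr [simp]:
  assumes "X \<in> Ob D" "g \<in> Ar D"
  shows "X \<rtimes> g \<in> Ar D" "Dom D (X \<rtimes> g) = X \<otimes> Dom D g" "Cod D (X \<rtimes> g) = X \<otimes> Cod D g"
  using assms by (simp_all add: ltimes_def)

lemma ltimes_ident: "X \<in> Ob D \<Longrightarrow> Y \<in> Ob D \<Longrightarrow> X \<rtimes> \<i> Y = \<i> (X \<otimes> Y)"
  by (simp add: ltimes_def rtimes_ident)

lemma ltimes_comp:
  "\<lbrakk>X \<in> Ob D; f \<in> Ar D; g \<in> Ar D; Cod D f = Dom D g\<rbrakk> \<Longrightarrow> X \<rtimes> (f \<Zsemi> g) = (X \<rtimes> f) \<Zsemi> (X \<rtimes> g)"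
  by (simp add: ltimes_def rtimes_comp D.arr_comp_assoc)

lemma ltimes_symm:
  "\<lbrakk>X \<in> Ob D; g \<in> Ar D\<rbrakk> \<Longrightarrow> (X \<rtimes> g) \<Zsemi> \<s> X (Cod D g) = \<s> X (Dom D g) \<Zsemi> (g \<ltimes> X)"
  by (simp add: ltimes_def D.arr_comp_assoc)

lemma rtimes_symm:
  "\<lbrakk>X \<in> Ob D; g \<in> Ar D\<rbrakk> \<Longrightarrow> (g \<ltimes> X) \<Zsemi> \<s> (Cod D g) X = \<s> (Dom D g) X \<Zsemi> (X \<rtimes> g)"
  by (simp add: ltimes_def D.arr_comp_assoc)

text \<open>The trace case is uniformity along \<open>\<d> S Y Z\<close>; Laplaza's axiom (IX) identifies the trace of the sum.\<close>

lemma dist_natural_first: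
  assumes "f \<in> Ar D" and YZ [simp]: "Y \<in> Ob D" "Z \<in> Ob D"
  shows "(f \<ltimes> (Y \<oplus> Z)) \<Zsemi> \<d> (Cod D f) Y Z = \<d> (Dom D f) Y Z \<Zsemi> (f \<ltimes> Y \<oplus>\<^sub>a f \<ltimes> Z)"
  using assms(1)
proof (induction rule: generated)
  case (base f)
  obtain Y0 Z0 where [simp]: "Y = FOb h Y0" "Y0 \<in> Ob A" "Z = FOb h Z0" "Z0 \<in> Ob A"
    using YZ by (metis ob_cases)
  have "Cmp A (TAr (Times A) f (Idt A (TOb (Plus A) Y0 Z0))) (DistL A (Cod A f) Y0 Z0)
      = Cmp A (DistL A (Dom A f) Y0 Z0)
          (TAr (Plus A) (TAr (Times A) f (Idt A Y0)) (TAr (Times A) f (Idt A Z0)))"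
    using C.dist_l_natural[of f "Dom A f" "Cod A f" "Idt A Y0" Y0 Y0 "Idt A Z0" Z0 Z0] base
    by (simp add: C.additive.in_hom_iff)
  with base show ?case by (simp add: h_simps)
next
  case (comp f g)
  note [simp] = comp(1-3)
  let ?W = "Y \<oplus> Z"
  have "((f \<Zsemi> g) \<ltimes> ?W) \<Zsemi> \<d> (Cod D g) Y Z = (f \<ltimes> ?W) \<Zsemi> ((g \<ltimes> ?W) \<Zsemi> \<d> (Cod D g) Y Z)"
    by (simp add: rtimes_comp D.arr_comp_assoc)
  also have "\<dots> = (f \<ltimes> ?W) \<Zsemi> (\<d> (Dom D g) Y Z \<Zsemi> (g \<ltimes> Y \<oplus>\<^sub>a g \<ltimes> Z))"
    by (simp only: comp(5))
  also have "\<dots> = ((f \<ltimes> ?W) \<Zsemi> \<d> (Cod D f) Y Z) \<Zsemi> (g \<ltimes> Y \<oplus>\<^sub>a g \<ltimes> Z)"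
    by (simp add: D.arr_comp_assoc)
  also have "\<dots> = \<d> (Dom D f) Y Z \<Zsemi> (f \<ltimes> Y \<oplus>\<^sub>a f \<ltimes> Z) \<Zsemi> (g \<ltimes> Y \<oplus>\<^sub>a g \<ltimes> Z)"
    by (simp only: comp(4))
  also have "\<dots> = \<d> (Dom D f) Y Z \<Zsemi> ((f \<Zsemi> g) \<ltimes> Y \<oplus>\<^sub>a (f \<Zsemi> g) \<ltimes> Z)"
    by (simp add: D.arr_comp_assoc D.tensor_arr_comp rtimes_comp)
  finally show ?case by simp
next
  case (tensor f g)
  note [simp] = tensor(1-2)
  let ?W = "Y \<oplus> Z"
  \<comment> \<open>By \<open>dist_plus\<close> the distributor at a sum is the sum of the
    distributors followed by this shuffle, which commutes with the whiskered arrows by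
    \<open>middle_natural\<close>.\<close>
  let ?m = "\<lambda>X X'. D.middle (X \<otimes> Y) (X \<otimes> Z) (X' \<otimes> Y) (X' \<otimes> Z)"
  have "((f \<oplus>\<^sub>a g) \<ltimes> ?W) \<Zsemi> \<d> (Cod D f \<oplus> Cod D g) Y Z
    = (((f \<ltimes> ?W) \<Zsemi> \<d> (Cod D f) Y Z) \<oplus>\<^sub>a ((g \<ltimes> ?W) \<Zsemi> \<d> (Cod D g) Y Z)) \<Zsemi> ?m (Cod D f) (Cod D g)"
    by (simp add: rtimes_plus dist_plus D.arr_comp_assoc[symmetric] D.tensor_arr_comp)
  also have "\<dots> = ((\<d> (Dom D f) Y Z \<Zsemi> (f \<ltimes> Y \<oplus>\<^sub>a f \<ltimes> Z)) \<oplus>\<^sub>a (\<d> (Dom D g) Y Z \<Zsemi> (g \<ltimes> Y \<oplus>\<^sub>a g \<ltimes> Z)))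
      \<Zsemi> ?m (Cod D f) (Cod D g)"
    by (simp only: tensor(3,4))
  also have "\<dots> = (\<d> (Dom D f) Y Z \<oplus>\<^sub>a \<d> (Dom D g) Y Z)
      \<Zsemi> (((f \<ltimes> Y \<oplus>\<^sub>a f \<ltimes> Z) \<oplus>\<^sub>a (g \<ltimes> Y \<oplus>\<^sub>a g \<ltimes> Z)) \<Zsemi> ?m (Cod D f) (Cod D g))"
    by (subst D.tensor_arr_comp[symmetric]) (simp_all del: D.tensor_arr_assoc add: D.arr_comp_assoc)
  also have "((f \<ltimes> Y \<oplus>\<^sub>a f \<ltimes> Z) \<oplus>\<^sub>a (g \<ltimes> Y \<oplus>\<^sub>a g \<ltimes> Z)) \<Zsemi> ?m (Cod D f) (Cod D g)
      = ?m (Dom D f) (Dom D g) \<Zsemi> ((f \<ltimes> Y \<oplus>\<^sub>a g \<ltimes> Y) \<oplus>\<^sub>a (f \<ltimes> Z \<oplus>\<^sub>a g \<ltimes> Z))"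
    using D.middle_natural[of "f \<ltimes> Y" "f \<ltimes> Z" "g \<ltimes> Y" "g \<ltimes> Z"] by (simp del: D.tensor_arr_assoc)
  also have "(\<d> (Dom D f) Y Z \<oplus>\<^sub>a \<d> (Dom D g) Y Z) \<Zsemi> \<dots>
      = \<d> (Dom D f \<oplus> Dom D g) Y Z \<Zsemi> ((f \<oplus>\<^sub>a g) \<ltimes> Y \<oplus>\<^sub>a (f \<oplus>\<^sub>a g) \<ltimes> Z)"
    by (simp add: dist_plus rtimes_plus D.arr_comp_assoc)
  finally show ?case by simp
next
  case (trace S X X' f)
  note [simp] = trace(1-6)
  let ?W = "Y \<oplus> Z"
  let ?m = "D.middle (S \<otimes> Y) (S \<otimes> Z)" and ?m' = "D.middle (S \<otimes> Y) (X' \<otimes> Y) (S \<otimes> Z) (X' \<otimes> Z)"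
  \<comment> \<open>\<open>?q\<close> is the body of the single trace to which
    \<open>trace_tensor\<close> reduces the sum of the two whiskered traces; \<open>?l\<close> and
    \<open>?r\<close> arise when tightening absorbs the distributors on the two sides of the
    claim.\<close>
  let ?l = "(f \<ltimes> ?W) \<Zsemi> (\<i> (S \<otimes> ?W) \<oplus>\<^sub>a \<d> X' Y Z)"
  let ?q = "?m (X \<otimes> Y) (X \<otimes> Z) \<Zsemi> (f \<ltimes> Y \<oplus>\<^sub>a f \<ltimes> Z) \<Zsemi> ?m'"
  let ?r = "(\<i> (S \<otimes> Y \<oplus> S \<otimes> Z) \<oplus>\<^sub>a \<d> X Y Z) \<Zsemi> ?q"
  have lhs: "(tr S X X' f \<ltimes> ?W) \<Zsemi> \<d> X' Y Z = tr (S \<otimes> ?W) (X \<otimes> ?W) (X' \<otimes> Y \<oplus> X' \<otimes> Z) ?l"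
    using D.tightening[of "S \<otimes> ?W" "\<i> (X \<otimes> ?W)" "X \<otimes> ?W" "X \<otimes> ?W" "f \<ltimes> ?W" "X' \<otimes> ?W"
        "\<d> X' Y Z" "X' \<otimes> Y \<oplus> X' \<otimes> Z"]
    by (simp add: rtimes_trace D.in_hom_iff)
  have "f \<ltimes> Y \<in> hom D (S \<otimes> Y \<oplus> X \<otimes> Y) (S \<otimes> Y \<oplus> X' \<otimes> Y)"
    "f \<ltimes> Z \<in> hom D (S \<otimes> Z \<oplus> X \<otimes> Z) (S \<otimes> Z \<oplus> X' \<otimes> Z)"
    by (simp_all add: D.in_hom_iff)
  then have "tr S X X' f \<ltimes> Y \<oplus>\<^sub>a tr S X X' f \<ltimes> Z
      = tr (S \<otimes> Y \<oplus> S \<otimes> Z) (X \<otimes> Y \<oplus> X \<otimes> Z) (X' \<otimes> Y \<oplus> X' \<otimes> Z) ?q"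
    by (simp add: rtimes_trace D.trace_tensor)
  then have rhs: "\<d> X Y Z \<Zsemi> (tr S X X' f \<ltimes> Y \<oplus>\<^sub>a tr S X X' f \<ltimes> Z)
      = tr (S \<otimes> Y \<oplus> S \<otimes> Z) (X \<otimes> ?W) (X' \<otimes> Y \<oplus> X' \<otimes> Z) ?r"
    using D.tightening[of "S \<otimes> Y \<oplus> S \<otimes> Z" "\<d> X Y Z" "X \<otimes> ?W" "X \<otimes> Y \<oplus> X \<otimes> Z" ?q
        "X' \<otimes> Y \<oplus> X' \<otimes> Z" "\<i> (X' \<otimes> Y \<oplus> X' \<otimes> Z)" "X' \<otimes> Y \<oplus> X' \<otimes> Z"]
    by (simp add: D.in_hom_iff)
  have "tr (S \<otimes> ?W) (X \<otimes> ?W) (X' \<otimes> Y \<oplus> X' \<otimes> Z) ?l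
    = tr (S \<otimes> Y \<oplus> S \<otimes> Z) (X \<otimes> ?W) (X' \<otimes> Y \<oplus> X' \<otimes> Z) ?r"
  proof (rule D.uniformity[where r = "\<d> S Y Z"])
    \<comment> \<open>\<open>dist_plus\<close> is used at both ends. Before \<open>f\<close> it
      assembles \<open>\<d> (S \<oplus> X) Y Z\<close>, which the induction hypothesis exchanges
      with \<open>f\<close>; afterwards it splits \<open>\<d> (S \<oplus> X') Y Z\<close>, whose
      shuffle cancels against \<open>?m'\<close>.\<close>
    have "(\<d> S Y Z \<oplus>\<^sub>a \<i> (X \<otimes> ?W)) \<Zsemi> ?r
      = (((\<d> S Y Z \<oplus>\<^sub>a \<i> (X \<otimes> ?W)) \<Zsemi> (\<i> (S \<otimes> Y \<oplus> S \<otimes> Z) \<oplus>\<^sub>a \<d> X Y Z))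
          \<Zsemi> ?m (X \<otimes> Y) (X \<otimes> Z)) \<Zsemi> (f \<ltimes> Y \<oplus>\<^sub>a f \<ltimes> Z) \<Zsemi> ?m'"
      by (simp add: D.arr_comp_assoc)
    also have "\<dots> = \<d> (S \<oplus> X) Y Z \<Zsemi> (f \<ltimes> Y \<oplus>\<^sub>a f \<ltimes> Z) \<Zsemi> ?m'"
      by (simp add: D.tensor_arr_comp dist_plus)
    also have "\<dots> = (f \<ltimes> ?W) \<Zsemi> \<d> (S \<oplus> X') Y Z \<Zsemi> ?m'"
      using trace(7) by simp
    also have "\<dots> = (f \<ltimes> ?W) \<Zsemi> ((\<d> S Y Z \<oplus>\<^sub>a \<d> X' Y Z) \<Zsemi> (?m (X' \<otimes> Y) (X' \<otimes> Z) \<Zsemi> ?m'))"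
      by (simp add: dist_plus D.arr_comp_assoc)
    also have "\<dots> = (f \<ltimes> ?W) \<Zsemi> (\<d> S Y Z \<oplus>\<^sub>a \<d> X' Y Z)"
      by (simp add: D.middle_invol)
    also have "\<dots> = ?l \<Zsemi> (\<d> S Y Z \<oplus>\<^sub>a \<i> (X' \<otimes> Y \<oplus> X' \<otimes> Z))"
      by (simp add: D.arr_comp_assoc D.tensor_arr_comp)
    finally show "?l \<Zsemi> (\<d> S Y Z \<oplus>\<^sub>a \<i> (X' \<otimes> Y \<oplus> X' \<otimes> Z)) = (\<d> S Y Z \<oplus>\<^sub>a \<i> (X \<otimes> ?W)) \<Zsemi> ?r"
      by simp
  qed (simp_all add: D.in_hom_iff)
  then show ?case using lhs rhs by simp
qed

text \<open>Since left whiskering is a conjugate, \<open>symm_dist\<close> turns this into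
  naturality of \<open>\<d>\<close> in its first argument for the arrow \<open>g\<close>. The
  auxiliary equation is the claim followed by a sum of two symmetries, which is invertible and
  cancelled at the end.\<close>

lemma ltimes_plus_left:
  assumes [simp]: "X \<in> Ob D" "Y \<in> Ob D" "g \<in> Ar D"
  shows "(X \<oplus> Y) \<rtimes> g = X \<rtimes> g \<oplus>\<^sub>a Y \<rtimes> g"
proof -
  let ?A = "Dom D g" and ?B = "Cod D g"
  have "((X \<oplus> Y) \<rtimes> g) \<Zsemi> (\<s> X ?B \<oplus>\<^sub>a \<s> Y ?B) = ((X \<oplus> Y) \<rtimes> g) \<Zsemi> \<s> (X \<oplus> Y) ?B \<Zsemi> \<d> ?B X Y"
    by (simp add: symm_dist D.arr_comp_assoc)
  also have "\<dots> = \<s> (X \<oplus> Y) ?A \<Zsemi> ((g \<ltimes> (X \<oplus> Y)) \<Zsemi> \<d> ?B X Y)"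
    by (simp only: ltimes_symm D.tensor_ob assms) (simp add: D.arr_comp_assoc)
  also have "\<dots> = (\<s> (X \<oplus> Y) ?A \<Zsemi> \<d> ?A X Y) \<Zsemi> (g \<ltimes> X \<oplus>\<^sub>a g \<ltimes> Y)"
    by (simp add: dist_natural_first D.arr_comp_assoc)
  also have "\<dots> = (\<s> X ?A \<Zsemi> (g \<ltimes> X)) \<oplus>\<^sub>a (\<s> Y ?A \<Zsemi> (g \<ltimes> Y))"
    by (simp add: symm_dist D.tensor_arr_comp)
  finally have *: "((X \<oplus> Y) \<rtimes> g) \<Zsemi> (\<s> X ?B \<oplus>\<^sub>a \<s> Y ?B) = (\<s> X ?A \<Zsemi> (g \<ltimes> X)) \<oplus>\<^sub>a (\<s> Y ?A \<Zsemi> (g \<ltimes> Y))" .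
  have "(X \<oplus> Y) \<rtimes> g = ((X \<oplus> Y) \<rtimes> g) \<Zsemi> ((\<s> X ?B \<oplus>\<^sub>a \<s> Y ?B) \<Zsemi> (\<s> ?B X \<oplus>\<^sub>a \<s> ?B Y))"
    by (simp add: D.tensor_arr_comp)
  also have "\<dots> = ((\<s> X ?A \<Zsemi> (g \<ltimes> X)) \<oplus>\<^sub>a (\<s> Y ?A \<Zsemi> (g \<ltimes> Y))) \<Zsemi> (\<s> ?B X \<oplus>\<^sub>a \<s> ?B Y)"
    by (subst *[symmetric], subst D.arr_comp_assoc) simp_all
  also have "\<dots> = X \<rtimes> g \<oplus>\<^sub>a Y \<rtimes> g"
    by (simp add: D.tensor_arr_comp ltimes_def)
  finally show ?thesis .
qed

section \<open>Interchange of the two whiskerings\<close>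

definition commutes where
  "commutes f g \<longleftrightarrow> (f \<ltimes> Dom D g) \<Zsemi> (Cod D f \<rtimes> g) = (Dom D f \<rtimes> g) \<Zsemi> (f \<ltimes> Cod D g)"

text \<open>Conjugation by symmetries exchanges the two kinds of whiskering. The swap is needed
  because the induction below varies the first arrow only.\<close>

lemma commutes_sym:
  assumes [simp]: "f \<in> Ar D" "g \<in> Ar D" and fg: "commutes f g"
  shows "commutes g f"
proof -
  let ?X = "Dom D f" and ?X' = "Cod D f" and ?Y = "Dom D g" and ?Y' = "Cod D g"
  have "(g \<ltimes> ?X) \<Zsemi> (?Y' \<rtimes> f) = ((g \<ltimes> ?X) \<Zsemi> \<s> ?Y' ?X) \<Zsemi> ((f \<ltimes> ?Y') \<Zsemi> \<s> ?X' ?Y')"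
    by (simp add: ltimes_def[of ?Y'] D.arr_comp_assoc)
  also have "\<dots> = \<s> ?Y ?X \<Zsemi> ((?X \<rtimes> g) \<Zsemi> (f \<ltimes> ?Y')) \<Zsemi> \<s> ?X' ?Y'"
    by (simp add: rtimes_symm D.arr_comp_assoc)
  also have "\<dots> = \<s> ?Y ?X \<Zsemi> ((f \<ltimes> ?Y) \<Zsemi> (?X' \<rtimes> g)) \<Zsemi> \<s> ?X' ?Y'"
    using fg by (simp add: commutes_def)
  also have "\<dots> = \<s> ?Y ?X \<Zsemi> (f \<ltimes> ?Y) \<Zsemi> ((?X' \<rtimes> g) \<Zsemi> \<s> ?X' ?Y')"
    by (simp add: D.arr_comp_assoc)
  also have "\<dots> = (\<s> ?Y ?X \<Zsemi> (f \<ltimes> ?Y) \<Zsemi> \<s> ?X' ?Y) \<Zsemi> (g \<ltimes> ?X')"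
    by (simp add: ltimes_symm D.arr_comp_assoc)
  finally show ?thesis by (simp add: commutes_def ltimes_def)
qed

text \<open>The trace case is uniformity along \<open>S \<rtimes> g\<close>.\<close>

lemma commutes_if_commutes_base:
  assumes "f \<in> Ar D" and g [simp]: "g \<in> Ar D" and base: "\<And>f. f \<in> Ar A \<Longrightarrow> commutes (FAr h f) g"
  shows "commutes f g"
  using assms(1)
proof (induction rule: generated)
  case (base f)
  then show ?case by (rule assms(3))
next
  case (comp f f')
  note [simp] = comp(1-3)
  let ?Y = "Dom D g" and ?Y' = "Cod D g"
  have "((f \<Zsemi> f') \<ltimes> ?Y) \<Zsemi> (Cod D f' \<rtimes> g) = (f \<ltimes> ?Y) \<Zsemi> ((f' \<ltimes> ?Y) \<Zsemi> (Cod D f' \<rtimes> g))"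
    by (simp add: rtimes_comp D.arr_comp_assoc)
  also have "\<dots> = (f \<ltimes> ?Y) \<Zsemi> ((Dom D f' \<rtimes> g) \<Zsemi> (f' \<ltimes> ?Y'))"
    using comp(5) by (simp add: commutes_def)
  also have "\<dots> = ((f \<ltimes> ?Y) \<Zsemi> (Cod D f \<rtimes> g)) \<Zsemi> (f' \<ltimes> ?Y')"
    by (simp add: D.arr_comp_assoc)
  also have "\<dots> = (Dom D f \<rtimes> g) \<Zsemi> (f \<ltimes> ?Y') \<Zsemi> (f' \<ltimes> ?Y')"
    using comp(4) by (simp add: commutes_def)
  also have "\<dots> = (Dom D f \<rtimes> g) \<Zsemi> ((f \<Zsemi> f') \<ltimes> ?Y')"
    by (simp add: rtimes_comp D.arr_comp_assoc)
  finally show ?case by (simp add: commutes_def)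
next
  case (tensor f f')
  then show ?case
    by (simp add: commutes_def rtimes_plus ltimes_plus_left D.tensor_arr_comp)
next
  case (trace S X X' f)
  note [simp] = trace(1-6)
  let ?Y = "Dom D g" and ?Y' = "Cod D g"
  let ?l = "(f \<ltimes> ?Y) \<Zsemi> (\<i> (S \<otimes> ?Y) \<oplus>\<^sub>a X' \<rtimes> g)"
  let ?r = "(\<i> (S \<otimes> ?Y') \<oplus>\<^sub>a X \<rtimes> g) \<Zsemi> (f \<ltimes> ?Y')"
  have lhs: "(tr S X X' f \<ltimes> ?Y) \<Zsemi> (X' \<rtimes> g) = tr (S \<otimes> ?Y) (X \<otimes> ?Y) (X' \<otimes> ?Y') ?l"
    using D.tightening[of "S \<otimes> ?Y" "\<i> (X \<otimes> ?Y)" "X \<otimes> ?Y" "X \<otimes> ?Y" "f \<ltimes> ?Y" "X' \<otimes> ?Y"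
        "X' \<rtimes> g" "X' \<otimes> ?Y'"]
    by (simp add: rtimes_trace D.in_hom_iff)
  have rhs: "(X \<rtimes> g) \<Zsemi> (tr S X X' f \<ltimes> ?Y') = tr (S \<otimes> ?Y') (X \<otimes> ?Y) (X' \<otimes> ?Y') ?r"
    using D.tightening[of "S \<otimes> ?Y'" "X \<rtimes> g" "X \<otimes> ?Y" "X \<otimes> ?Y'" "f \<ltimes> ?Y'" "X' \<otimes> ?Y'"
        "\<i> (X' \<otimes> ?Y')" "X' \<otimes> ?Y'"]
    by (simp add: rtimes_trace D.in_hom_iff)
  have "tr (S \<otimes> ?Y) (X \<otimes> ?Y) (X' \<otimes> ?Y') ?l = tr (S \<otimes> ?Y') (X \<otimes> ?Y) (X' \<otimes> ?Y') ?r"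
  proof (rule D.uniformity[where r = "S \<rtimes> g"])
    \<comment> \<open>By \<open>ltimes_plus_left\<close> the whiskerings of \<open>g\<close> by
      \<open>S\<close> and by \<open>X'\<close> combine into one by \<open>S \<oplus> X'\<close>,
      the codomain of \<open>f\<close>, so the induction hypothesis applies.\<close>
    have "?l \<Zsemi> (S \<rtimes> g \<oplus>\<^sub>a \<i> (X' \<otimes> ?Y')) = (f \<ltimes> ?Y) \<Zsemi> ((S \<oplus> X') \<rtimes> g)"
      by (simp add: D.arr_comp_assoc D.tensor_arr_comp ltimes_plus_left)
    also have "\<dots> = ((S \<oplus> X) \<rtimes> g) \<Zsemi> (f \<ltimes> ?Y')"
      using trace(7) by (simp add: commutes_def)
    also have "\<dots> = (S \<rtimes> g \<oplus>\<^sub>a \<i> (X \<otimes> ?Y)) \<Zsemi> ?r"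
      by (simp add: D.arr_comp_assoc[symmetric] D.tensor_arr_comp ltimes_plus_left)
    finally show "?l \<Zsemi> (S \<rtimes> g \<oplus>\<^sub>a \<i> (X' \<otimes> ?Y')) = (S \<rtimes> g \<oplus>\<^sub>a \<i> (X \<otimes> ?Y)) \<Zsemi> ?r" .
  qed (simp_all add: D.in_hom_iff)
  then show ?case using lhs rhs by (simp add: commutes_def)
qed

text \<open>Two inductions: the first one, after a swap, makes \<open>g\<close> arbitrary while the
  other arrow is still an image; the second one makes \<open>f\<close> arbitrary. The base case, two
  images, is bifunctoriality of \<open>\<otimes>\<close> in \<open>A\<close>.\<close>

lemma interchange:
  assumes f: "f \<in> Ar D" and g: "g \<in> Ar D"
  shows "(f \<ltimes> Dom D g) \<Zsemi> (Cod D f \<rtimes> g) = (Dom D f \<rtimes> g) \<Zsemi> (f \<ltimes> Cod D g)"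
proof -
  have base: "commutes (FAr h f0) (FAr h g0)" if "f0 \<in> Ar A" "g0 \<in> Ar A" for f0 g0
    using that by (simp add: commutes_def h_simps h_ltimes C.multiplicative.tensor_arr_comp)
  have "commutes (FAr h f0) g" if f0: "f0 \<in> Ar A" for f0
  proof (rule commutes_sym[OF g])
    show "commutes g (FAr h f0)"
      using f0 base by (intro commutes_if_commutes_base[OF g]) simp_all
  qed (use f0 in simp)
  then have "commutes f g"
    by (rule commutes_if_commutes_base[OF f g])
  then show ?thesis by (simp add: commutes_def)
qed

text \<open>Interchange in the middle of a right-nested composite. The endpoints enter as equations,
  so that instances match objects already normalised by the simplifier.\<close>

lemma interchange_comp:
  assumes "f \<in> Ar D" "g \<in> Ar D" "X = Dom D f" "X' = Cod D f" "Y = Dom D g" "Y' = Cod D g"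
    and "u \<in> Ar D" "Dom D u = X' \<otimes> Y'"
  shows "(f \<ltimes> Y) \<Zsemi> ((X' \<rtimes> g) \<Zsemi> u) = (X \<rtimes> g) \<Zsemi> ((f \<ltimes> Y') \<Zsemi> u)"
proof -
  have "((f \<ltimes> Y) \<Zsemi> (X' \<rtimes> g)) \<Zsemi> u = ((X \<rtimes> g) \<Zsemi> (f \<ltimes> Y')) \<Zsemi> u"
    using interchange[of f g] assms by simp
  then show ?thesis using assms by (simp add: D.arr_comp_assoc)
qed

section \<open>The multiplicative bifunctor and its laws\<close>

lemma times_arr [simp]:
  assumes "f \<in> Ar D" "g \<in> Ar D"
  shows "f \<otimes>\<^sub>a g \<in> Ar D" "Dom D (f \<otimes>\<^sub>a g) = Dom D f \<otimes> Dom D g" "Cod D (f \<otimes>\<^sub>a g) = Cod D f \<otimes> Cod D g"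
  using assms by (simp_all add: times_ar_def)

lemma times_ident_right: "\<lbrakk>f \<in> Ar D; Z \<in> Ob D\<rbrakk> \<Longrightarrow> f \<otimes>\<^sub>a \<i> Z = f \<ltimes> Z"
  by (simp add: times_ar_def ltimes_ident)

lemma times_ident_left: "\<lbrakk>g \<in> Ar D; X \<in> Ob D\<rbrakk> \<Longrightarrow> \<i> X \<otimes>\<^sub>a g = X \<rtimes> g"
  by (simp add: times_ar_def rtimes_ident)

lemma times_comp:
  assumes [simp]: "f \<in> Ar D" "f' \<in> Ar D" "g \<in> Ar D" "g' \<in> Ar D" "Cod D f = Dom D f'" "Cod D g = Dom D g'"
  shows "(f \<Zsemi> f') \<otimes>\<^sub>a (g \<Zsemi> g') = (f \<otimes>\<^sub>a g) \<Zsemi> (f' \<otimes>\<^sub>a g')"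
  by (simp add: times_ar_def rtimes_comp ltimes_comp D.arr_comp_assoc
      interchange_comp[of f' g "Dom D f'" "Cod D f'" "Dom D g" "Dom D g'"])

text \<open>The symmetry passes the two whiskerings one at a time, which leaves them in the wrong
  order for \<open>g \<otimes>\<^sub>a f\<close>; interchange restores it.\<close>

lemma times_symm:
  assumes [simp]: "f \<in> Ar D" "g \<in> Ar D"
  shows "(f \<otimes>\<^sub>a g) \<Zsemi> \<s> (Cod D f) (Cod D g) = \<s> (Dom D f) (Dom D g) \<Zsemi> (g \<otimes>\<^sub>a f)"
proof -
  have "(f \<otimes>\<^sub>a g) \<Zsemi> \<s> (Cod D f) (Cod D g)
      = ((f \<ltimes> Dom D g) \<Zsemi> \<s> (Cod D f) (Dom D g)) \<Zsemi> (g \<ltimes> Cod D f)"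
    by (simp add: times_ar_def D.arr_comp_assoc ltimes_symm)
  also have "\<dots> = \<s> (Dom D f) (Dom D g) \<Zsemi> ((Dom D g \<rtimes> f) \<Zsemi> (g \<ltimes> Cod D f))"
    by (simp add: rtimes_symm D.arr_comp_assoc)
  finally show ?thesis by (simp add: times_ar_def interchange)
qed

lemma symm_times_right:
  "\<lbrakk>X \<in> Ob D; Y \<in> Ob D; Z \<in> Ob D\<rbrakk> \<Longrightarrow> \<s> X (Y \<otimes> Z) = (\<s> X Y \<ltimes> Z) \<Zsemi> (Y \<rtimes> \<s> X Z)"
  by (auto elim!: ob_cases simp: h_simps h_ltimes C.multiplicative.symm_tensor_right)

lemma symm_times_left:
  "\<lbrakk>X \<in> Ob D; Y \<in> Ob D; Z \<in> Ob D\<rbrakk> \<Longrightarrow> \<s> (X \<otimes> Y) Z = (X \<rtimes> \<s> Y Z) \<Zsemi> (\<s> X Z \<ltimes> Y)"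
  by (auto elim!: ob_cases simp: h_simps h_ltimes C.multiplicative.symm_tensor_left)

lemma symm_braid:
  "\<lbrakk>X \<in> Ob D; Y \<in> Ob D; Z \<in> Ob D\<rbrakk> \<Longrightarrow> \<s> X (Y \<otimes> Z) \<Zsemi> (\<s> Y Z \<ltimes> X) = \<s> (X \<otimes> Y) Z \<Zsemi> (Z \<rtimes> \<s> X Y)"
  by (auto elim!: ob_cases simp: h_simps h_ltimes C.multiplicative.symm_braid)

lemma symm_braid':
  "\<lbrakk>X \<in> Ob D; Y \<in> Ob D; Z \<in> Ob D\<rbrakk> \<Longrightarrow> (\<s> Z Y \<ltimes> X) \<Zsemi> \<s> (Y \<otimes> Z) X = (Z \<rtimes> \<s> Y X) \<Zsemi> \<s> Z (X \<otimes> Y)"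
  by (auto elim!: ob_cases simp: h_simps h_ltimes C.multiplicative.symm_braid')

lemma ltimes_symm_invol:
  assumes [simp]: "X \<in> Ob D" "Y \<in> Ob D" "Z \<in> Ob D" "u \<in> Ar D" "Dom D u = X \<otimes> Y \<otimes> Z"
  shows "(X \<rtimes> \<s> Y Z) \<Zsemi> ((X \<rtimes> \<s> Z Y) \<Zsemi> u) = u"
proof -
  have "(X \<rtimes> \<s> Y Z) \<Zsemi> ((X \<rtimes> \<s> Z Y) \<Zsemi> u) = (X \<rtimes> (\<s> Y Z \<Zsemi> \<s> Z Y)) \<Zsemi> u"
    by (subst ltimes_comp) (simp_all add: D.arr_comp_assoc)
  then show ?thesis by (simp add: ltimes_ident)
qed

text \<open>The hexagon splits the symmetry of \<open>X\<close> with a product. Interchange moves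
  \<open>g\<close> past the part that swaps \<open>X\<close> and \<open>Z\<close>, which then meets
  its inverse; what remains is the conjugate defining the left side, whiskered by
  \<open>Z\<close>.\<close>

lemma rtimes_ltimes:
  assumes [simp]: "X \<in> Ob D" "g \<in> Ar D" "Z \<in> Ob D"
  shows "(X \<rtimes> g) \<ltimes> Z = X \<rtimes> (g \<ltimes> Z)"
proof -
  let ?Y = "Dom D g" and ?Y' = "Cod D g"
  have "X \<rtimes> (g \<ltimes> Z)
      = (\<s> X ?Y \<ltimes> Z) \<Zsemi> ((?Y \<rtimes> \<s> X Z) \<Zsemi> ((g \<ltimes> (Z \<otimes> X)) \<Zsemi> ((?Y' \<rtimes> \<s> Z X) \<Zsemi> (\<s> ?Y' X \<ltimes> Z))))"
    by (simp add: ltimes_def[of X] rtimes_rtimes symm_times_right[of X] symm_times_left[of _ _ X] D.arr_comp_assoc)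
  also have "\<dots> = (\<s> X ?Y \<ltimes> Z) \<Zsemi> ((g \<ltimes> (X \<otimes> Z)) \<Zsemi> (\<s> ?Y' X \<ltimes> Z))"
    by (simp add: interchange_comp[of g "\<s> Z X" ?Y _ _ "X \<otimes> Z"] ltimes_symm_invol)
  also have "\<dots> = (X \<rtimes> g) \<ltimes> Z"
    by (simp add: ltimes_def rtimes_comp rtimes_rtimes D.arr_comp_assoc)
  finally show ?thesis by simp
qed

text \<open>Same mechanism: the braid equations replace the outer symmetries by symmetries with
  \<open>X \<otimes> Y\<close>, at the cost of a swap of \<open>X\<close> and \<open>Y\<close> on
  either side of \<open>g\<close>. Interchange brings these swaps together and they cancel.\<close>

lemma ltimes_ltimes:
  assumes [simp]: "X \<in> Ob D" "Y \<in> Ob D" "g \<in> Ar D"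
  shows "(X \<otimes> Y) \<rtimes> g = X \<rtimes> Y \<rtimes> g"
proof -
  let ?Z = "Dom D g" and ?Z' = "Cod D g"
  have "X \<rtimes> Y \<rtimes> g = (\<s> X (Y \<otimes> ?Z) \<Zsemi> (\<s> Y ?Z \<ltimes> X)) \<Zsemi> (g \<ltimes> (Y \<otimes> X)) \<Zsemi> ((\<s> ?Z' Y \<ltimes> X) \<Zsemi> \<s> (Y \<otimes> ?Z') X)"
    by (simp add: ltimes_def rtimes_comp rtimes_rtimes D.arr_comp_assoc)
  also have "\<dots> = \<s> (X \<otimes> Y) ?Z \<Zsemi> ((?Z \<rtimes> \<s> X Y) \<Zsemi> ((g \<ltimes> (Y \<otimes> X)) \<Zsemi> ((?Z' \<rtimes> \<s> Y X) \<Zsemi> \<s> ?Z' (X \<otimes> Y))))"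
    by (simp only: symm_braid symm_braid' assms D.arr_ob) (simp add: D.arr_comp_assoc)
  also have "\<dots> = \<s> (X \<otimes> Y) ?Z \<Zsemi> ((g \<ltimes> (X \<otimes> Y)) \<Zsemi> \<s> ?Z' (X \<otimes> Y))"
    by (simp add: interchange_comp[of g "\<s> Y X" ?Z _ _ "X \<otimes> Y"] ltimes_symm_invol)
  also have "\<dots> = (X \<otimes> Y) \<rtimes> g"
    by (simp add: ltimes_def D.arr_comp_assoc)
  finally show ?thesis by simp
qed

text \<open>Both sides expand to \<open>f\<close>, \<open>g\<close>, \<open>u\<close> applied in
  this order, each whiskered by the same two objects; the three rules for iterated whiskerings
  identify the factors.\<close>

lemma times_assoc:
  assumes [simp]: "f \<in> Ar D" "g \<in> Ar D" "u \<in> Ar D"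
  shows "(f \<otimes>\<^sub>a g) \<otimes>\<^sub>a u = f \<otimes>\<^sub>a g \<otimes>\<^sub>a u"
  by (simp add: times_ar_def rtimes_comp ltimes_comp rtimes_rtimes rtimes_ltimes ltimes_ltimes D.arr_comp_assoc)

lemma times_one:
  "f \<in> Ar D \<Longrightarrow> \<i> \<one> \<otimes>\<^sub>a f = f" "f \<in> Ar D \<Longrightarrow> f \<otimes>\<^sub>a \<i> \<one> = f"
  by (simp_all add: times_ident_left times_ident_right ltimes_def rtimes_one)

lemma times_zero:
  "f \<in> Ar D \<Longrightarrow> \<i> \<zero> \<otimes>\<^sub>a f = \<i> \<zero>" "f \<in> Ar D \<Longrightarrow> f \<otimes>\<^sub>a \<i> \<zero> = \<i> \<zero>"
  by (simp_all add: times_ident_left times_ident_right ltimes_def rtimes_zero)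

lemma times_plus_left:
  "\<lbrakk>f \<in> Ar D; g \<in> Ar D; u \<in> Ar D\<rbrakk> \<Longrightarrow> (f \<oplus>\<^sub>a g) \<otimes>\<^sub>a u = f \<otimes>\<^sub>a u \<oplus>\<^sub>a g \<otimes>\<^sub>a u"
  by (simp add: times_ar_def rtimes_plus ltimes_plus_left D.tensor_arr_comp)

text \<open>No induction: right whiskering is additive by construction, and \<open>symm_dist\<close>
  converts the distributor after the symmetry into a sum of symmetries.\<close>

lemma ltimes_dist:
  assumes [simp]: "X \<in> Ob D" "g \<in> Ar D" "u \<in> Ar D"
  shows "(X \<rtimes> (g \<oplus>\<^sub>a u)) \<Zsemi> \<d> X (Cod D g) (Cod D u)
    = \<d> X (Dom D g) (Dom D u) \<Zsemi> (X \<rtimes> g \<oplus>\<^sub>a X \<rtimes> u)"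
proof -
  let ?Y = "Dom D g" and ?Y' = "Cod D g" and ?Z = "Dom D u" and ?Z' = "Cod D u"
  have "(X \<rtimes> (g \<oplus>\<^sub>a u)) \<Zsemi> \<d> X ?Y' ?Z'
      = \<s> X (?Y \<oplus> ?Z) \<Zsemi> ((g \<ltimes> X \<oplus>\<^sub>a u \<ltimes> X) \<Zsemi> (\<s> (?Y' \<oplus> ?Z') X \<Zsemi> \<d> X ?Y' ?Z'))"
    by (simp add: ltimes_def rtimes_plus D.arr_comp_assoc)
  also have "\<dots> = \<s> X (?Y \<oplus> ?Z) \<Zsemi> ((\<s> ?Y X \<oplus>\<^sub>a \<s> ?Z X) \<Zsemi> (X \<rtimes> g \<oplus>\<^sub>a X \<rtimes> u))"
    by (simp add: symm_dist D.tensor_arr_comp rtimes_symm)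
  also have "\<dots> = \<s> X (?Y \<oplus> ?Z) \<Zsemi> (\<s> (?Y \<oplus> ?Z) X \<Zsemi> (\<d> X ?Y ?Z \<Zsemi> (X \<rtimes> g \<oplus>\<^sub>a X \<rtimes> u)))"
    by (simp add: symm_dist[symmetric] D.arr_comp_assoc)
  also have "\<dots> = \<d> X ?Y ?Z \<Zsemi> (X \<rtimes> g \<oplus>\<^sub>a X \<rtimes> u)"
    by (rule symm_symm_comp) simp_all
  finally show ?thesis .
qed

lemma times_dist:
  assumes [simp]: "f \<in> Ar D" "g \<in> Ar D" "u \<in> Ar D"
  shows "(f \<otimes>\<^sub>a (g \<oplus>\<^sub>a u)) \<Zsemi> \<d> (Cod D f) (Cod D g) (Cod D u)
    = \<d> (Dom D f) (Dom D g) (Dom D u) \<Zsemi> (f \<otimes>\<^sub>a g \<oplus>\<^sub>a f \<otimes>\<^sub>a u)"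
proof -
  let ?Y = "Dom D g" and ?Z = "Dom D u"
  have "(f \<otimes>\<^sub>a (g \<oplus>\<^sub>a u)) \<Zsemi> \<d> (Cod D f) (Cod D g) (Cod D u)
      = ((f \<ltimes> (?Y \<oplus> ?Z)) \<Zsemi> \<d> (Cod D f) ?Y ?Z) \<Zsemi> (Cod D f \<rtimes> g \<oplus>\<^sub>a Cod D f \<rtimes> u)"
    by (simp add: times_ar_def D.arr_comp_assoc ltimes_dist)
  also have "\<dots> = \<d> (Dom D f) ?Y ?Z \<Zsemi> (f \<otimes>\<^sub>a g \<oplus>\<^sub>a f \<otimes>\<^sub>a u)"
    by (simp add: dist_natural_first D.arr_comp_assoc D.tensor_arr_comp times_ar_def)
  finally show ?thesis .
qed

section \<open>Verification of the rig axioms\<close>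

lemma rig_truncate: "cat.truncate rig = cat.truncate D"
  by (simp add: rig_def cat.defs)

lemma rig_simps [simp]:
  "Ob rig = Ob D" "Ar rig = Ar D" "Dom rig = Dom D" "Cod rig = Cod D" "Idt rig = Idt D" "Cmp rig = Cmp D"
  "Plus rig = Plus D" "RTrace rig = Trace D"
  "TOb (Times rig) = (\<otimes>)" "TAr (Times rig) = (\<otimes>\<^sub>a)" "TUnit (Times rig) = \<one>" "Symm (Times rig) = \<s>"
  "DistL rig = \<d>"
  by (simp_all add: rig_def)

lemma rig_hom [simp]: "hom rig = hom D" "iso_hom rig = iso_hom D" "inv_arrow rig = inv_arrow D"
  using cat_truncate_eqD(7)[OF rig_truncate] iso_hom_cong[OF rig_truncate]
  by (simp_all add: inv_arrow_def inverse_arrows_def fun_eq_iff)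

lemma rig_strict [simp]:
  "\<lbrakk>X \<in> Ob D; Y \<in> Ob D; Z \<in> Ob D\<rbrakk> \<Longrightarrow> Assoc (Times rig) X Y Z = \<i> (X \<otimes> Y \<otimes> Z)"
  "X \<in> Ob D \<Longrightarrow> LUnit (Times rig) X = \<i> X" "X \<in> Ob D \<Longrightarrow> RUnit (Times rig) X = \<i> X"
  "\<lbrakk>X \<in> Ob D; Y \<in> Ob D; Z \<in> Ob D\<rbrakk> \<Longrightarrow> DistR rig X Y Z = \<i> (X \<otimes> Z \<oplus> Y \<otimes> Z)"
  "X \<in> Ob D \<Longrightarrow> AnnL rig X = \<i> \<zero>" "X \<in> Ob D \<Longrightarrow> AnnR rig X = \<i> \<zero>"
  by (auto elim!: ob_cases simp: rig_def h_simps)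

lemma h_iso:
  assumes "f \<in> iso_hom A X Y"
  shows "FAr h f \<in> iso_hom D (FOb h X) (FOb h Y)"
proof -
  obtain g where "inverse_arrows A f g" and f: "f \<in> hom A X Y"
    using assms by (auto simp: iso_hom_def)
  then have "inverse_arrows D (FAr h f) (FAr h g)"
    by (auto simp: inverse_arrows_def C.additive.in_hom_iff D.in_hom_iff h_simps)
  then show ?thesis
    using f functor_hom[OF h_functor f] by (auto simp: iso_hom_def)
qed

lemmas image_simps = h_simps h_ltimes h_times_ar one_def

lemma rig_times_strict: "strict_symmetric_monoidal rig (Times rig)"
proof -
  have "category rig" using category_cong[OF rig_truncate] D.category_axioms by simp
  then interpret E: category rig .
  show ?thesis
    apply unfold_locales
    subgoal by simp
    subgoal by simp
    subgoal by (auto simp: D.in_hom_iff)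
    subgoal by (simp add: times_ident_left ltimes_ident)
    subgoal by (auto simp: D.in_hom_iff times_comp)
    subgoal by simp
    subgoal by (auto simp: D.in_hom_iff times_assoc)
    subgoal by simp
    subgoal by (auto simp: D.in_hom_iff times_one)
    subgoal by simp
    subgoal by (auto simp: D.in_hom_iff times_one)
    subgoal by (simp add: D.in_hom_iff)
    subgoal by (auto simp: D.in_hom_iff times_symm)
    subgoal by simp
    subgoal by (simp add: times_ident_left times_ident_right rtimes_ident ltimes_ident)
    subgoal by (simp add: times_ident_left times_ident_right rtimes_ident ltimes_ident)
    subgoal by (simp add: times_ident_left times_ident_right symm_times_right)
    subgoal by simp
    subgoal by simp
    subgoal by simp
    done
qed

lemma rig_right_strict: "right_strict_rig rig"
proof -
  interpret plus: strict_symmetric_monoidal rig "Plus rig"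
    using strict_symmetric_monoidal_cong[OF rig_truncate] D.strict_symmetric_monoidal_axioms by simp
  interpret times: strict_symmetric_monoidal rig "Times rig"
    by (rule rig_times_strict)
  note [simp] = D.assoc_strict D.lunit_strict D.runit_strict
  show ?thesis
    apply unfold_locales
    subgoal for X Y Z
      using h_iso[OF C.dist_l_iso[of "k X" "k Y" "k Z"]] by (auto elim!: ob_cases simp: image_simps)
    subgoal by (auto simp: D.in_hom_iff times_dist)
    subgoal by simp
    subgoal by (auto simp: D.in_hom_iff times_plus_left)
    subgoal by simp
    subgoal by (auto simp: D.in_hom_iff times_zero)
    subgoal by simp
    subgoal by (auto simp: D.in_hom_iff times_zero)
    \<comment> \<open>From here to axiom (XXIV) each goal is the image under \<open>h\<close> of the
      same axiom of \<open>A\<close>, taken at the preimages of its objects.\<close>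
    subgoal for X Y Z using C.laplaza1[of "k X" "k Y" "k Z"] by (auto elim!: ob_cases simp: image_simps)
    subgoal for X Y Z using C.laplaza2[of "k X" "k Y" "k Z"] by (auto elim!: ob_cases simp: image_simps)
    subgoal for X Y Z using C.laplaza3[of "k X" "k Y" "k Z"] by (auto elim!: ob_cases simp: image_simps)
    subgoal for W X Y Z using C.laplaza4[of "k W" "k X" "k Y" "k Z"] by (auto elim!: ob_cases simp: image_simps)
    subgoal for W X Y Z using C.laplaza5[of "k W" "k X" "k Y" "k Z"] by (auto elim!: ob_cases simp: image_simps)
    subgoal for W X Y Z using C.laplaza6[of "k W" "k X" "k Y" "k Z"] by (auto elim!: ob_cases simp: image_simps)
    subgoal for W X Y Z using C.laplaza7[of "k W" "k X" "k Y" "k Z"] by (auto elim!: ob_cases simp: image_simps)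
    subgoal for W X Y Z using C.laplaza8[of "k W" "k X" "k Y" "k Z"] by (auto elim!: ob_cases simp: image_simps)
    subgoal for W X Y Z using C.laplaza9[of "k W" "k X" "k Y" "k Z"] by (auto elim!: ob_cases simp: image_simps)
    subgoal using C.laplaza10 by (auto elim!: ob_cases simp: image_simps)
    subgoal for X Y using C.laplaza11[of "k X" "k Y"] by (auto elim!: ob_cases simp: image_simps)
    subgoal for X Y using C.laplaza12[of "k X" "k Y"] by (auto elim!: ob_cases simp: image_simps)
    subgoal using C.laplaza13 by (auto elim!: ob_cases simp: image_simps)
    subgoal using C.laplaza14 by (auto elim!: ob_cases simp: image_simps)
    subgoal for X using C.laplaza15[of "k X"] by (auto elim!: ob_cases simp: image_simps)
    subgoal for X Y using C.laplaza16[of "k X" "k Y"] by (auto elim!: ob_cases simp: image_simps)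
    subgoal for X Y using C.laplaza17[of "k X" "k Y"] by (auto elim!: ob_cases simp: image_simps)
    subgoal for X Y using C.laplaza18[of "k X" "k Y"] by (auto elim!: ob_cases simp: image_simps)
    subgoal for X Y using C.laplaza19[of "k X" "k Y"] by (auto elim!: ob_cases simp: image_simps)
    subgoal for X Y using C.laplaza20[of "k X" "k Y"] by (auto elim!: ob_cases simp: image_simps)
    subgoal for X Y using C.laplaza21[of "k X" "k Y"] by (auto elim!: ob_cases simp: image_simps)
    subgoal for X Y using C.laplaza22[of "k X" "k Y"] by (auto elim!: ob_cases simp: image_simps)
    subgoal for X Y using C.laplaza23[of "k X" "k Y"] by (auto elim!: ob_cases simp: image_simps)
    subgoal for X Y using C.laplaza24[of "k X" "k Y"] by (auto elim!: ob_cases simp: image_simps)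
    subgoal by simp
    subgoal by simp
    subgoal by simp
    done
qed

text \<open>Compatibility of \<open>\<otimes>\<close> with the trace is built in: tensoring with an
  identity on the right is \<open>R\<close>, which preserves traces.\<close>

lemma rig_uniformly_traced: "uniformly_traced_rig rig"
proof -
  have "preserves_trace rig (Plus rig) (RTrace rig) (RTrace rig)
      \<lparr>FOb = \<lambda>X. TOb (Times rig) X Z, FAr = \<lambda>f. TAr (Times rig) f (Idt rig Z)\<rparr>" if "Z \<in> Ob D" for Z
    using that by (simp add: preserves_trace_def D.in_hom_iff times_ident_right rtimes_trace)
  then show ?thesis
    using rig_right_strict uniformly_traced_cong[OF rig_truncate] D.uniformly_traced_axioms
    by (simp add: uniformly_traced_rig_def tensor_preserves_trace_def)
qed

lemma h_rig_functor: "right_strict_rig_functor A rig h"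
proof -
  have "category rig" using category_cong[OF rig_truncate] D.category_axioms by simp
  then have "is_functor A rig h"
    using h_functor by (simp add: is_functor_def)
  then have "strict_sm_functor A (Times A) rig (Times rig) h"
    unfolding strict_sm_functor_def by (simp add: h_simps h_times_ar one_def)
  then show ?thesis
    using h by (simp add: right_strict_rig_functor_def h_simps strict_sm_functor_cong[OF refl rig_truncate])
qed

text \<open>For an additive \<open>G\<close> that restricts along \<open>h\<close> to a rig functor,
  right whiskering by objects is all that remains to be checked. Left whiskering is a conjugate by
  images, and every tensor of arrows is a composite of whiskerings.\<close>

lemma rig_functorI:
  assumes T: "right_strict_rig T"
    and G: "strict_sm_functor D (Plus D) T (Plus T) G"
    and F: "right_strict_rig_functor A T F"
    and Gh_ob: "\<And>X. X \<in> Ob A \<Longrightarrow> FOb G (FOb h X) = FOb F X"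
    and Gh_ar: "\<And>f. f \<in> Ar A \<Longrightarrow> FAr G (FAr h f) = FAr F f"
    and G_rtimes: "\<And>f Z. \<lbrakk>f \<in> Ar D; Z \<in> Ob A\<rbrakk> \<Longrightarrow>
      FAr G (f \<ltimes> FOb h Z) = TAr (Times T) (FAr G f) (Idt T (FOb F Z))"
  shows "right_strict_rig_functor rig T G"
proof -
  interpret T: right_strict_rig T by (rule T)
  note Ft = rig_functor_times[OF F]
  note FF = strict_sm_functor[OF Ft] and GF = strict_sm_functor[OF G]
  have category: "category rig" using category_cong[OF rig_truncate] D.category_axioms by simp
  have GR: "is_functor rig T G"
    using GF category by (simp add: is_functor_def)
  have G_ob: "FOb G X = FOb F (k X)" if "X \<in> Ob D" for X
    using that by (auto elim!: ob_cases simp: Gh_ob)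
  have G_symm: "FAr G (\<s> X Y) = Symm (Times T) (FOb G X) (FOb G Y)" if "X \<in> Ob D" "Y \<in> Ob D" for X Y
    using that by (auto elim!: ob_cases simp: h_simps Gh_ob Gh_ar sm_symm[OF Ft])
  have G_rt: "FAr G (f \<ltimes> Z) = TAr (Times T) (FAr G f) (Idt T (FOb G Z))" if "f \<in> Ar D" "Z \<in> Ob D" for f Z
    using that by (auto elim!: ob_cases simp: G_rtimes Gh_ob)
  have G_tensor_ob: "FOb G (X \<otimes> Y) = TOb (Times T) (FOb G X) (FOb G Y)" if "X \<in> Ob D" "Y \<in> Ob D" for X Y
    using that by (auto elim!: ob_cases simp: h_simps Gh_ob sm_tensor_ob[OF Ft])
  note [simp] = functor_ob[OF GF] functor_arr[OF GF]
  \<comment> \<open>\<open>G\<close> preserves the conjugation that defines left whiskering, and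
    naturality of the symmetry in \<open>T\<close> undoes it.\<close>
  have G_lt: "FAr G (X \<rtimes> g) = TAr (Times T) (Idt T (FOb G X)) (FAr G g)" if [simp]: "X \<in> Ob D" "g \<in> Ar D" for X g
  proof -
    let ?s = "Symm (Times T)" and ?X = "FOb G X" and ?g = "FAr G g"
    have "FAr G (X \<rtimes> g)
        = Cmp T (Cmp T (?s ?X (Dom T ?g)) (TAr (Times T) ?g (Idt T ?X))) (?s (Cod T ?g) ?X)"
      by (simp add: ltimes_def functor_comp[OF GF] G_symm G_rt)
    also have "\<dots> = Cmp T (Cmp T (TAr (Times T) (Idt T ?X) ?g) (?s ?X (Cod T ?g))) (?s (Cod T ?g) ?X)"
      using T.multiplicative.symm_arr_natural[of "Idt T ?X" ?g] by simp
    also have "\<dots> = TAr (Times T) (Idt T ?X) ?g"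
      by (simp add: T.additive.arr_comp_assoc)
    finally show ?thesis .
  qed
  have G_tensor: "FAr G (f \<otimes>\<^sub>a g) = TAr (Times T) (FAr G f) (FAr G g)" if "f \<in> Ar D" "g \<in> Ar D" for f g
    using that by (simp add: times_ar_def functor_comp[OF GF] G_rt G_lt T.multiplicative.tensor_arr_comp)
  have G_one: "FOb G \<one> = TUnit (Times T)"
    by (simp add: one_def Gh_ob sm_unit[OF Ft])
  have "strict_sm_functor rig (Times rig) T (Times T) G"
    unfolding strict_sm_functor_def using GR
    by (simp add: G_tensor_ob G_tensor G_one G_symm functor_ident[OF GF])
  moreover have "strict_sm_functor rig (Plus rig) T (Plus T) G"
    using G by (simp add: strict_sm_functor_cong[OF rig_truncate refl])
  moreover have "FAr G (\<d> X Y Z) = DistL T (FOb G X) (FOb G Y) (FOb G Z)"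
    if "X \<in> Ob D" "Y \<in> Ob D" "Z \<in> Ob D" for X Y Z
    using that by (auto elim!: ob_cases simp: h_simps Gh_ob Gh_ar rig_functor_dist[OF F])
  ultimately show ?thesis
    by (simp add: right_strict_rig_functor_def)
qed

end

section \<open>The lifted adjunction\<close>

text \<open>Restricted to the carriers, unlike the functor in \<open>tensor_preserves_trace\<close>,
  so that it can be part of an arrow of \<open>SMC\<close> or \<open>UTSMC\<close>.\<close>

definition right_times :: "('o, 'a, 'm) rigcat_scheme \<Rightarrow> 'o \<Rightarrow> ('o, 'a, 'o, 'a) fnctr" where
  "right_times C Z = \<lparr>FOb = \<lambda>X\<in>Ob C. TOb (Times C) X Z, FAr = \<lambda>f\<in>Ar C. TAr (Times C) f (Idt C Z)\<rparr>"

context free_uniform_trace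
begin

section \<open>The adjunction in terms of underlying functors\<close>

lemma unit_natural_Fun:
  assumes m: "m \<in> hom SMC C C'"
  shows "X \<in> Ob C \<Longrightarrow> FOb (Fun (FAr L m)) (FOb (Fun (\<eta> C)) X) = FOb (Fun (\<eta> C')) (FOb (Fun m) X)"
    and "f \<in> Ar C \<Longrightarrow> FAr (Fun (FAr L m)) (FAr (Fun (\<eta> C)) f) = FAr (Fun (\<eta> C')) (FAr (Fun m) f)"
proof -
  have C: "strict_symmetric_monoidal C (Plus C)" using m by (simp add: SMC_hom)
  have "Src m = C" "Src (\<eta> C) = C" using m unit_hom_SMC[OF C] by (simp_all add: SMC_hom)
  then have eq: "compose (Ob C) (FOb (Fun (\<eta> C'))) (FOb (Fun m)) = compose (Ob C) (FOb (Fun (FAr L m))) (FOb (Fun (\<eta> C)))"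
    "compose (Ar C) (FAr (Fun (\<eta> C'))) (FAr (Fun m)) = compose (Ar C) (FAr (Fun (FAr L m))) (FAr (Fun (\<eta> C)))"
    using unit_natural[OF adj m] by (simp_all add: SMC_def UTSMC_to_SMC_def)
  show "X \<in> Ob C \<Longrightarrow> FOb (Fun (FAr L m)) (FOb (Fun (\<eta> C)) X) = FOb (Fun (\<eta> C')) (FOb (Fun m) X)"
    using fun_cong[OF eq(1), of X] by (simp add: compose_eq)
  show "f \<in> Ar C \<Longrightarrow> FAr (Fun (FAr L m)) (FAr (Fun (\<eta> C)) f) = FAr (Fun (\<eta> C')) (FAr (Fun m) f)"
    using fun_cong[OF eq(2), of f] by (simp add: compose_eq)
qed

lemma L_hom: "m \<in> hom SMC C C' \<Longrightarrow> FAr L m \<in> hom UTSMC (FOb L C) (FOb L C')"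
  by (rule functor_hom[OF adjunction_left[OF adj]])

lemma L_comp_Fun:
  assumes m: "m \<in> hom SMC C C'" and n: "n \<in> hom SMC C' C''" and f: "f \<in> Ar (FOb L C)"
  shows "FAr (Fun (FAr L (Cmp SMC m n))) f = FAr (Fun (FAr L n)) (FAr (Fun (FAr L m)) f)"
  using f L_hom[OF m] functor_comp_hom[OF adjunction_left[OF adj] m n]
  by (simp add: UTSMC_def struct_cat_hom compose_def)

lemma counit_Fun:
  assumes D: "uniformly_traced D (Plus D) (Trace D)"
  shows "X \<in> Ob D \<Longrightarrow> FOb (Fun (\<epsilon> D)) (FOb (Fun (\<eta> (smcat.truncate D))) X) = X"
    and "f \<in> Ar D \<Longrightarrow> FAr (Fun (\<epsilon> D)) (FAr (Fun (\<eta> (smcat.truncate D))) f) = f"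
proof -
  have "strict_symmetric_monoidal (smcat.truncate D) (Plus (smcat.truncate D))"
    using D by (simp add: strict_symmetric_monoidal_cong[of "smcat.truncate D" D] uniformly_traced_def)
  then have "Src (\<eta> (smcat.truncate D)) = smcat.truncate D"
    using unit_hom_SMC by (simp add: SMC_hom)
  then have eq: "compose (Ob D) (FOb (Fun (\<epsilon> D))) (FOb (Fun (\<eta> (smcat.truncate D)))) = (\<lambda>X\<in>Ob D. X)"
    "compose (Ar D) (FAr (Fun (\<epsilon> D))) (FAr (Fun (\<eta> (smcat.truncate D)))) = (\<lambda>f\<in>Ar D. f)"
    using triangle_right[OF adj, of D] D by (simp_all add: Ob_UTSMC UTSMC_to_SMC_def) (simp_all add: SMC_def)
  show "X \<in> Ob D \<Longrightarrow> FOb (Fun (\<epsilon> D)) (FOb (Fun (\<eta> (smcat.truncate D))) X) = X"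
    using fun_cong[OF eq(1), of X] by (simp add: compose_eq)
  show "f \<in> Ar D \<Longrightarrow> FAr (Fun (\<epsilon> D)) (FAr (Fun (\<eta> (smcat.truncate D))) f) = f"
    using fun_cong[OF eq(2), of f] by (simp add: compose_eq)
qed

lemma counit_natural_Fun:
  assumes g: "g \<in> hom UTSMC D D'" and f: "f \<in> Ar (FOb L (smcat.truncate D))"
  shows "FAr (Fun (\<epsilon> D')) (FAr (Fun (FAr L (FAr UTSMC_to_SMC g))) f) = FAr (Fun g) (FAr (Fun (\<epsilon> D)) f)"
proof -
  have D: "D \<in> Ob UTSMC" using g by (simp add: UTSMC_hom Ob_UTSMC)
  note e = counit_hom[OF adj D]
  have src: "Src (\<epsilon> D) = FOb L (smcat.truncate D)"
    using e by (simp add: UTSMC_hom UTSMC_to_SMC_def)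
  note g' = L_hom[OF functor_hom[OF adjunction_right[OF adj] g]]
  have src': "Src (FAr L (FAr UTSMC_to_SMC g)) = FOb L (smcat.truncate D)"
    using g' by (simp add: UTSMC_hom UTSMC_to_SMC_def)
  have eq: "compose (Ar (FOb L (smcat.truncate D))) (FAr (Fun (\<epsilon> D'))) (FAr (Fun (FAr L (FAr UTSMC_to_SMC g))))
    = compose (Ar (FOb L (smcat.truncate D))) (FAr (Fun g)) (FAr (Fun (\<epsilon> D)))"
    using counit_natural[OF adj g] src src' by (simp add: UTSMC_def)
  show ?thesis using f fun_cong[OF eq, of f] by (simp add: compose_eq)
qed

abbreviation right_times_arrow where
  "right_times_arrow C Z \<equiv> \<lparr>Src = smcat.truncate C, Trg = smcat.truncate C, Fun = right_times C Z\<rparr>"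

lemma right_times_arrow_hom:
  assumes C: "right_strict_rig C" and Z: "Z \<in> Ob C"
  shows "right_times_arrow C Z \<in> hom SMC (smcat.truncate C) (smcat.truncate C)"
proof -
  interpret right_strict_rig C by (rule C)
  show ?thesis
    using right_times_functor[OF Z] additive.strict_symmetric_monoidal_axioms
    by (simp add: SMC_hom right_times_def strict_symmetric_monoidal_cong[of "smcat.truncate C" C]
        strict_sm_functor_cong[of "smcat.truncate C" C "smcat.truncate C" C])
qed

definition free_rig :: "('o, 'a) rigcat \<Rightarrow> ('o, 'a) utrigcat" where
  "free_rig C = free_rig_data.rig C (FOb L (smcat.truncate C)) (Fun (\<eta> (smcat.truncate C)))
     (\<lambda>Z. Fun (FAr L (right_times_arrow C Z)))"

lemma free_rig_data_unit:
  assumes C: "right_strict_rig C"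
  shows "free_rig_data C (FOb L (smcat.truncate C)) (Fun (\<eta> (smcat.truncate C)))
     (\<lambda>Z. Fun (FAr L (right_times_arrow C Z)))"
proof -
  interpret C: right_strict_rig C by (rule C)
  have U: "strict_symmetric_monoidal (smcat.truncate C) (Plus (smcat.truncate C))"
    using C.additive.strict_symmetric_monoidal_axioms
    by (simp add: strict_symmetric_monoidal_cong[of "smcat.truncate C" C])
  note m = right_times_arrow_hom[OF C]
  have R: "FAr L (right_times_arrow C Z) \<in> hom UTSMC (FOb L (smcat.truncate C)) (FOb L (smcat.truncate C))"
    if "Z \<in> Ob C" for Z
    using L_hom[OF m[OF that]] by simp
  show ?thesis
  proof (rule free_rig_data.intro)
    show "strict_sm_functor C (Plus C) (FOb L (smcat.truncate C)) (Plus (FOb L (smcat.truncate C)))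
        (Fun (\<eta> (smcat.truncate C)))"
      using incl_functor[OF U] by (simp add: strict_sm_functor_cong[of "smcat.truncate C" C, OF _ refl])
    show "bij_betw (FOb (Fun (\<eta> (smcat.truncate C)))) (Ob C) (Ob (FOb L (smcat.truncate C)))"
      using incl_bij[OF U] by simp
  next
    fix X Z assume "X \<in> Ob C" "Z \<in> Ob C"
    then show "FOb (Fun (FAr L (right_times_arrow C Z))) (FOb (Fun (\<eta> (smcat.truncate C))) X)
        = FOb (Fun (\<eta> (smcat.truncate C))) (TOb (Times C) X Z)"
      using unit_natural_Fun(1)[OF m[of Z], of X] by (simp add: right_times_def)
  next
    fix f Z assume "f \<in> Ar C" "Z \<in> Ob C"
    then show "FAr (Fun (FAr L (right_times_arrow C Z))) (FAr (Fun (\<eta> (smcat.truncate C))) f)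
        = FAr (Fun (\<eta> (smcat.truncate C))) (TAr (Times C) f (Idt C Z))"
      using unit_natural_Fun(2)[OF m[of Z], of f] by (simp add: right_times_def)
  next
    fix P :: "'a \<Rightarrow> bool" and f
    let ?D = "FOb L (smcat.truncate C)"
    assume "f \<in> Ar ?D" "\<And>f. f \<in> Ar C \<Longrightarrow> P (FAr (Fun (\<eta> (smcat.truncate C))) f)"
      "\<And>f g. \<lbrakk>f \<in> Ar ?D; g \<in> Ar ?D; Cod ?D f = Dom ?D g; P f; P g\<rbrakk> \<Longrightarrow> P (Cmp ?D f g)"
      "\<And>f g. \<lbrakk>f \<in> Ar ?D; g \<in> Ar ?D; P f; P g\<rbrakk> \<Longrightarrow> P (TAr (Plus ?D) f g)"
      "\<And>S X Y f. \<lbrakk>S \<in> Ob ?D; X \<in> Ob ?D; Y \<in> Ob ?D; f \<in> Ar ?D; Dom ?D f = TOb (Plus ?D) S X;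
          Cod ?D f = TOb (Plus ?D) S Y; P f\<rbrakk> \<Longrightarrow> P (Trace ?D S X Y f)"
    then show "P f" by (intro generated(2)[OF U, of P f]) simp_all
  qed (use R C free_uniformly_traced[OF U] in \<open>auto simp: UTSMC_hom\<close>)
qed

section \<open>The forgetful functors and the lifted arrows\<close>

lemma RIG_hom: "m \<in> hom RIG C D \<longleftrightarrow> Src m = C \<and> Trg m = D \<and> right_strict_rig C \<and> right_strict_rig D
    \<and> right_strict_rig_functor C D (Fun m)
    \<and> FOb (Fun m) \<in> extensional (Ob C) \<and> FAr (Fun m) \<in> extensional (Ar C)"
  by (simp add: RIG_def struct_cat_hom)

lemma RIGUTr_hom: "m \<in> hom RIGUTr C D \<longleftrightarrow> Src m = C \<and> Trg m = D
    \<and> uniformly_traced_rig C \<and> uniformly_traced_rig D \<and> right_strict_rig_functor C D (Fun m)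
    \<and> preserves_trace C (Plus C) (RTrace C) (RTrace D) (Fun m)
    \<and> FOb (Fun m) \<in> extensional (Ob C) \<and> FAr (Fun m) \<in> extensional (Ar C)"
  by (auto simp: RIGUTr_def struct_cat_hom)

lemma RIG_to_SMC_functor: "is_functor (RIG :: (('o, 'a) rigcat, _) cat) SMC RIG_to_SMC"
  unfolding RIG_to_SMC_def RIG_def SMC_def
proof (rule forget_functor)
  fix C D :: "('o, 'a) rigcat" and F
  show "strict_symmetric_monoidal (smcat.truncate C) (Plus (smcat.truncate C))" if "right_strict_rig C"
    using that by (simp add: strict_symmetric_monoidal_cong[of "smcat.truncate C" C] right_strict_rig_def)
  show "strict_sm_functor (smcat.truncate C) (Plus (smcat.truncate C)) (smcat.truncate D) (Plus (smcat.truncate D)) F"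
    if "right_strict_rig_functor C D F"
    using rig_functor_plus[OF that]
    by (simp add: strict_sm_functor_cong[of "smcat.truncate C" C "smcat.truncate D" D])
qed (use RIG_category SMC_category in \<open>simp_all add: RIG_def SMC_def\<close>)

lemma RIGUTr_to_RIG_functor: "is_functor (RIGUTr :: (('o, 'a) utrigcat, _) cat) RIG RIGUTr_to_RIG"
  unfolding RIGUTr_to_RIG_def RIGUTr_def RIG_def
  by (rule forget_functor)
    (use RIG_category RIGUTr_category in \<open>simp_all add: RIG_def RIGUTr_def uniformly_traced_rig_def\<close>)

lemma RIGUTr_to_UTSMC_functor: "is_functor (RIGUTr :: (('o, 'a) utrigcat, _) cat) UTSMC RIGUTr_to_UTSMC"
  unfolding RIGUTr_to_UTSMC_def RIGUTr_def UTSMC_def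
proof (rule forget_functor)
  let ?U = "\<lambda>C :: ('o, 'a) utrigcat. \<lparr>Ob = Ob C, Ar = Ar C, Dom = Dom C, Cod = Cod C, Idt = Idt C,
      Cmp = Cmp C, Plus = Plus C, Trace = RTrace C\<rparr>"
  have U: "cat.truncate (?U C) = cat.truncate C" for C
    by (simp add: cat.defs)
  fix C D :: "('o, 'a) utrigcat" and F
  show "uniformly_traced (?U C) (Plus (?U C)) (Trace (?U C))" if "uniformly_traced_rig C"
    using that by (simp add: uniformly_traced_cong[OF U] uniformly_traced_rig_def)
  show "strict_sm_functor (?U C) (Plus (?U C)) (?U D) (Plus (?U D)) F
      \<and> preserves_trace (?U C) (Plus (?U C)) (Trace (?U C)) (Trace (?U D)) F"
    if "right_strict_rig_functor C D F \<and> preserves_trace C (Plus C) (RTrace C) (RTrace D) F"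
    using that rig_functor_plus[of C D F]
    by (simp add: strict_sm_functor_cong[OF U U] preserves_trace_cong[OF U])
qed (use RIGUTr_category UTSMC_category in \<open>simp_all add: RIGUTr_def UTSMC_def\<close>)

lemma free_rig_fields:
  assumes C: "right_strict_rig C"
  shows "FOb RIGUTr_to_UTSMC (free_rig C) = FOb L (smcat.truncate C)"
    and "uniformly_traced_rig (free_rig C)"
    and "tensor_agrees_on_objects C (free_rig C) (Fun (\<eta> (smcat.truncate C)))"
    and "structural_isos_are_images C (free_rig C) (Fun (\<eta> (smcat.truncate C)))"
proof -
  interpret F: free_rig_data C "FOb L (smcat.truncate C)" "Fun (\<eta> (smcat.truncate C))"
    "\<lambda>Z. Fun (FAr L (right_times_arrow C Z))"
    by (rule free_rig_data_unit[OF C])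
  show "FOb RIGUTr_to_UTSMC (free_rig C) = FOb L (smcat.truncate C)"
    by (simp add: RIGUTr_to_UTSMC_def free_rig_def)
  show "uniformly_traced_rig (free_rig C)"
    unfolding free_rig_def by (rule F.rig_uniformly_traced)
  show "tensor_agrees_on_objects C (free_rig C) (Fun (\<eta> (smcat.truncate C)))"
    using F.h_bij by (simp add: free_rig_def tensor_agrees_on_objects_def F.h_simps F.one_def)
  show "structural_isos_are_images C (free_rig C) (Fun (\<eta> (smcat.truncate C)))"
    unfolding structural_isos_are_images_def free_rig_def
    by (auto simp: F.rig_def F.h_simps simp flip: sm_assoc[OF F.h] sm_lunit[OF F.h] sm_runit[OF F.h])
qed

text \<open>Since \<open>m\<close> preserves \<open>\<otimes>\<close>, multiplying by
  \<open>Z\<close> and then applying \<open>m\<close> is the same as applying \<open>m\<close> and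
  then multiplying by the image of \<open>Z\<close>. Applying \<open>L\<close> to this commuting
  square gives the condition on right whiskering in \<open>rig_functorI\<close>.\<close>

lemma free_rig_arrow:
  assumes m: "m \<in> hom RIG C C'"
  shows "\<lparr>Src = free_rig C, Trg = free_rig C', Fun = Fun (FAr L (FAr RIG_to_SMC m))\<rparr>
    \<in> hom RIGUTr (free_rig C) (free_rig C')"
proof -
  have C: "right_strict_rig C" and C': "right_strict_rig C'" and mF: "right_strict_rig_functor C C' (Fun m)"
    using m by (simp_all add: RIG_hom)
  interpret C: right_strict_rig C by (rule C)
  interpret F: free_rig_data C "FOb L (smcat.truncate C)" "Fun (\<eta> (smcat.truncate C))"
    "\<lambda>Z. Fun (FAr L (right_times_arrow C Z))"
    by (rule free_rig_data_unit[OF C])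
  interpret F': free_rig_data C' "FOb L (smcat.truncate C')" "Fun (\<eta> (smcat.truncate C'))"
    "\<lambda>Z. Fun (FAr L (right_times_arrow C' Z))"
    by (rule free_rig_data_unit[OF C'])
  let ?m = "FAr RIG_to_SMC m" and ?D = "FOb L (smcat.truncate C)" and ?D' = "FOb L (smcat.truncate C')"
  let ?G = "Fun (FAr L ?m)" and ?h = "Fun (\<eta> (smcat.truncate C))" and ?h' = "Fun (\<eta> (smcat.truncate C'))"
  have Um: "?m \<in> hom SMC (smcat.truncate C) (smcat.truncate C')"
    using functor_hom[OF RIG_to_SMC_functor m] by (simp add: RIG_to_SMC_def)
  have Fm: "Fun ?m = Fun m" by (simp add: RIG_to_SMC_def)
  have G: "strict_sm_functor ?D (Plus ?D) ?D' (Plus ?D') ?G"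
    "preserves_trace ?D (Plus ?D) (Trace ?D) (Trace ?D') ?G"
    "FOb ?G \<in> extensional (Ob ?D)" "FAr ?G \<in> extensional (Ar ?D)"
    using L_hom[OF Um] by (simp_all add: UTSMC_hom)
  note GF = strict_sm_functor[OF G(1)]
  note mf = strict_sm_functor[OF rig_functor_plus[OF mF]]
  have "right_strict_rig_functor F.rig F'.rig ?G"
  proof (rule F.rig_functorI[OF F'.rig_right_strict])
    show "strict_sm_functor ?D (Plus ?D) F'.rig (Plus F'.rig) ?G"
      using G(1) by (simp add: strict_sm_functor_cong[OF refl F'.rig_truncate])
    show "right_strict_rig_functor C F'.rig
        \<lparr>FOb = compose (Ob C) (FOb ?h') (FOb (Fun m)), FAr = compose (Ar C) (FAr ?h') (FAr (Fun m))\<rparr>"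
      by (rule right_strict_rig_functor_compose[OF mF F'.h_rig_functor C])
  next
    fix f Z assume f: "f \<in> Ar ?D" and Z: "Z \<in> Ob C"
    let ?r = "right_times_arrow C Z" and ?r' = "right_times_arrow C' (FOb (Fun m) Z)"
    have Z': "FOb (Fun m) Z \<in> Ob C'" using functor_ob[OF mf Z] .
    note r = right_times_arrow_hom[OF C Z] and r' = right_times_arrow_hom[OF C' Z']
    have "Cmp SMC ?r ?m = Cmp SMC ?m ?r'"
      using Um Z rig_functor_times[OF mF]
      by (auto simp: SMC_def struct_cat_hom Fm right_times_def compose_def fun_eq_iff RIG_to_SMC_def
          sm_tensor_ob sm_tensor_ar functor_ob[OF mf] functor_arr[OF mf] functor_ident[OF mf])
    then have "FAr ?G (FAr (Fun (FAr L ?r)) f) = FAr (Fun (FAr L ?r')) (FAr ?G f)"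
      using L_comp_Fun[OF r Um f] L_comp_Fun[OF Um r' f] by simp
    then show "FAr ?G (F.rtimes f (FOb ?h Z)) = TAr (Times F'.rig) (FAr ?G f)
        (Idt F'.rig (FOb \<lparr>FOb = compose (Ob C) (FOb ?h') (FOb (Fun m)),
           FAr = compose (Ar C) (FAr ?h') (FAr (Fun m))\<rparr> Z))"
      using f Z Z' functor_arr[OF GF f]
      by (simp add: F.rtimes_def F'.rtimes_def F'.times_ident_right compose_eq)
  qed (simp_all add: unit_natural_Fun[OF Um] Fm compose_eq)
  then show ?thesis
    using G free_rig_fields(2)[OF C] free_rig_fields(2)[OF C']
    by (simp add: RIGUTr_hom free_rig_def preserves_trace_cong[OF F.rig_truncate])
qed

lemma free_rig_unit:
  assumes C: "right_strict_rig C"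
  shows "\<lparr>Src = C, Trg = rigcat.truncate (free_rig C), Fun = Fun (\<eta> (smcat.truncate C))\<rparr>
    \<in> hom RIG C (rigcat.truncate (free_rig C))"
proof -
  interpret C: right_strict_rig C by (rule C)
  interpret F: free_rig_data C "FOb L (smcat.truncate C)" "Fun (\<eta> (smcat.truncate C))"
    "\<lambda>Z. Fun (FAr L (right_times_arrow C Z))"
    by (rule free_rig_data_unit[OF C])
  have "strict_symmetric_monoidal (smcat.truncate C) (Plus (smcat.truncate C))"
    using C.additive.strict_symmetric_monoidal_axioms
    by (simp add: strict_symmetric_monoidal_cong[of "smcat.truncate C" C])
  from unit_hom_SMC[OF this] show ?thesis
    using C F.rig_right_strict F.h_rig_functor
    by (simp add: RIG_hom SMC_hom free_rig_def right_strict_rig_functor_truncate_target)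
qed

text \<open>This is where the trace condition on \<open>\<otimes>\<close> in \<open>Y\<close>
  enters: it makes \<open>- \<otimes> Z\<close> an arrow of \<open>UTSMC\<close>, so naturality of
  the counit applies to it and yields compatibility with right whiskering.\<close>

lemma free_rig_counit:
  assumes Y: "uniformly_traced_rig Y"
  shows "\<lparr>Src = free_rig (rigcat.truncate Y), Trg = Y, Fun = Fun (\<epsilon> (FOb RIGUTr_to_UTSMC Y))\<rparr>
    \<in> hom RIGUTr (free_rig (rigcat.truncate Y)) Y"
proof -
  let ?C = "rigcat.truncate Y" and ?Y = "FOb RIGUTr_to_UTSMC Y"
  have Yr: "right_strict_rig Y" and C: "right_strict_rig ?C"
    using Y by (simp_all add: uniformly_traced_rig_def)
  interpret Y: right_strict_rig Y by (rule Yr)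
  interpret F: free_rig_data ?C "FOb L (smcat.truncate ?C)" "Fun (\<eta> (smcat.truncate ?C))"
    "\<lambda>Z. Fun (FAr L (right_times_arrow ?C Z))"
    by (rule free_rig_data_unit[OF C])
  have trunc: "smcat.truncate ?C = smcat.truncate ?Y" "cat.truncate ?Y = cat.truncate Y"
    by (simp_all add: RIGUTr_to_UTSMC_def smcat.defs rigcat.defs cat.defs)
  have Y_fields [simp]: "Ob ?Y = Ob Y" "Ar ?Y = Ar Y" "Plus ?Y = Plus Y" "Trace ?Y = RTrace Y"
    by (simp_all add: RIGUTr_to_UTSMC_def)
  have UY: "uniformly_traced ?Y (Plus ?Y) (Trace ?Y)"
    using Y by (simp add: uniformly_traced_rig_def uniformly_traced_cong[OF trunc(2)])
  let ?D = "FOb L (smcat.truncate ?Y)" and ?G = "Fun (\<epsilon> ?Y)" and ?h = "Fun (\<eta> (smcat.truncate ?Y))"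
  have "\<epsilon> ?Y \<in> hom UTSMC ?D ?Y"
    using counit_hom[OF adj, of ?Y] UY by (simp add: Ob_UTSMC UTSMC_to_SMC_def)
  then have G: "strict_sm_functor ?D (Plus ?D) Y (Plus Y) ?G"
    "preserves_trace ?D (Plus ?D) (Trace ?D) (RTrace Y) ?G"
    "FOb ?G \<in> extensional (Ob ?D)" "FAr ?G \<in> extensional (Ar ?D)"
    by (simp_all add: UTSMC_hom strict_sm_functor_cong[OF refl trunc(2)])
  note GF = strict_sm_functor[OF G(1)]
  have "right_strict_rig_functor F.rig Y ?G"
  proof (rule F.rig_functorI[OF Yr])
    show "strict_sm_functor (FOb L (smcat.truncate ?C)) (Plus (FOb L (smcat.truncate ?C))) Y (Plus Y) ?G"
      using G(1) by (simp only: trunc)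
    \<comment> \<open>By the triangle identity the unit followed by the counit is the identity, so
      the functor with which \<open>?G\<close> is compared on images is the extensional
      identity.\<close>
    show "right_strict_rig_functor ?C Y \<lparr>FOb = \<lambda>X\<in>Ob ?C. X, FAr = \<lambda>f\<in>Ar ?C. f\<rparr>"
      using right_strict_rig_functor_ident[OF C] right_strict_rig_functor_truncate_target by blast
    fix X assume "X \<in> Ob ?C"
    then show "FOb ?G (FOb (Fun (\<eta> (smcat.truncate ?C))) X) = FOb \<lparr>FOb = \<lambda>X\<in>Ob ?C. X, FAr = \<lambda>f\<in>Ar ?C. f\<rparr> X"
      using counit_Fun(1)[OF UY, of X] unfolding trunc by simp
  next
    fix f assume "f \<in> Ar ?C"
    then show "FAr ?G (FAr (Fun (\<eta> (smcat.truncate ?C))) f) = FAr \<lparr>FOb = \<lambda>X\<in>Ob ?C. X, FAr = \<lambda>f\<in>Ar ?C. f\<rparr> f"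
      using counit_Fun(2)[OF UY, of f] unfolding trunc by simp
  next
    fix f Z assume f: "f \<in> Ar (FOb L (smcat.truncate ?C))" and Z: "Z \<in> Ob ?C"
    let ?g = "\<lparr>Src = ?Y, Trg = ?Y, Fun = right_times Y Z\<rparr>"
    have "preserves_trace Y (Plus Y) (RTrace Y) (RTrace Y)
        \<lparr>FOb = \<lambda>X. TOb (Times Y) X Z, FAr = \<lambda>f. TAr (Times Y) f (Idt Y Z)\<rparr>"
      using Y Z by (simp add: uniformly_traced_rig_def tensor_preserves_trace_def)
    \<comment> \<open>Passage to the restricted functor: its value on a trace is the intended one
      because traces are again arrows of \<open>Y\<close>.\<close>
    then have "preserves_trace Y (Plus Y) (RTrace Y) (RTrace Y) (right_times Y Z)"
      using Y by (auto simp: uniformly_traced_rig_def preserves_trace_def right_times_def Y.additive.in_hom_iff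
          uniformly_traced.trace_arr)
    then have g: "?g \<in> hom UTSMC ?Y ?Y"
      using UY Z Y.right_times_functor[of Z]
      by (simp add: UTSMC_hom strict_sm_functor_cong[OF trunc(2) trunc(2)] preserves_trace_cong[OF trunc(2)]
          right_times_def)
    have "right_times ?C Z = right_times Y Z"
      by (simp add: right_times_def rigcat.defs)
    then have "FAr UTSMC_to_SMC ?g = right_times_arrow ?C Z"
      using trunc(1) by (simp add: UTSMC_to_SMC_def)
    then have "FAr ?G (FAr (Fun (FAr L (right_times_arrow ?C Z))) f) = FAr (right_times Y Z) (FAr ?G f)"
      using counit_natural_Fun[OF g, of f] f trunc(1) by simp
    moreover have "F.rtimes f (FOb (Fun (\<eta> (smcat.truncate ?C))) Z) = FAr (Fun (FAr L (right_times_arrow ?C Z))) f"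
      by (simp only: F.rtimes_def F.k_h[OF Z])
    moreover have "FAr ?G f \<in> Ar Y"
      using functor_arr(1)[OF GF, of f] f trunc(1) by simp
    ultimately show "FAr ?G (F.rtimes f (FOb (Fun (\<eta> (smcat.truncate ?C))) Z))
        = TAr (Times Y) (FAr ?G f) (Idt Y (FOb \<lparr>FOb = \<lambda>X\<in>Ob ?C. X, FAr = \<lambda>f\<in>Ar ?C. f\<rparr> Z))"
      using Z by (simp only:) (simp add: right_times_def)
  qed
  then show ?thesis
    using G Y F.rig_uniformly_traced
    unfolding RIGUTr_hom free_rig_def preserves_trace_cong[OF F.rig_truncate] F.rig_simps
    unfolding trunc(1) by simp
qed

end

theorem theorem4p18:
  fixes L :: "(('o, 'a) smcat, (('o, 'a) smcat, 'o, 'a) marr,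
               ('o, 'a) utsmcat, (('o, 'a) utsmcat, 'o, 'a) marr) fnctr"
    and \<eta> :: "('o, 'a) smcat \<Rightarrow> (('o, 'a) smcat, 'o, 'a) marr"
    and \<epsilon> :: "('o, 'a) utsmcat \<Rightarrow> (('o, 'a) utsmcat, 'o, 'a) marr"
  assumes universe: "infinite (UNIV :: 'a set)"
    and adj: "adjunction SMC UTSMC L UTSMC_to_SMC \<eta> \<epsilon>"
  shows "\<exists>L' \<eta>' \<epsilon>'.
      adjunction RIG RIGUTr L' RIGUTr_to_RIG \<eta>' \<epsilon>'
    \<and> (\<forall>C\<in>Ob RIG.
          FOb RIGUTr_to_UTSMC (FOb L' C) = FOb L (FOb RIG_to_SMC C)
        \<and> tensor_agrees_on_objects C (FOb L' C) (Fun (\<eta> (FOb RIG_to_SMC C)))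
        \<and> structural_isos_are_images C (FOb L' C) (Fun (\<eta> (FOb RIG_to_SMC C)))
        \<and> FAr RIG_to_SMC (\<eta>' C) = \<eta> (FOb RIG_to_SMC C))
    \<and> (\<forall>m\<in>Ar RIG. FAr RIGUTr_to_UTSMC (FAr L' m) = FAr L (FAr RIG_to_SMC m))
    \<and> (\<forall>D\<in>Ob RIGUTr. FAr RIGUTr_to_UTSMC (\<epsilon>' D) = \<epsilon> (FOb RIGUTr_to_UTSMC D))"
proof -
  interpret free_uniform_trace L \<eta> \<epsilon>
    using universe adj by unfold_locales
  have U: "FOb RIG_to_SMC C = smcat.truncate C" for C :: "('o, 'a) rigcat"
    by (simp add: RIG_to_SMC_def)
  have Ob_RIG: "C \<in> Ob RIG \<longleftrightarrow> right_strict_rig C" for C :: "('o, 'a) rigcat"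
    by (simp add: RIG_def)
  have Ob_RIGUTr: "D \<in> Ob RIGUTr \<longleftrightarrow> uniformly_traced_rig D" for D :: "('o, 'a) utrigcat"
    by (simp add: RIGUTr_def)
  have "\<exists>L' \<eta>' \<epsilon>'. adjunction RIG RIGUTr L' RIGUTr_to_RIG \<eta>' \<epsilon>' \<and> FOb L' = free_rig
    \<and> (\<forall>f\<in>Ar RIG. FAr RIGUTr_to_UTSMC (FAr L' f) = FAr L (FAr RIG_to_SMC f))
    \<and> (\<forall>X\<in>Ob RIG. FAr RIG_to_SMC (\<eta>' X) = \<eta> (FOb RIG_to_SMC X))
    \<and> (\<forall>Y\<in>Ob RIGUTr. FAr RIGUTr_to_UTSMC (\<epsilon>' Y) = \<epsilon> (FOb RIGUTr_to_UTSMC Y))"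
  proof (rule lift_adjunction[OF adj RIG_to_SMC_functor RIGUTr_to_UTSMC_functor RIGUTr_to_RIG_functor])
    show "f = g" if "f \<in> hom RIG X Y" "g \<in> hom RIG X Y" "FAr RIG_to_SMC f = FAr RIG_to_SMC g"
      for f g and X Y :: "('o, 'a) rigcat"
      using forget_faithful that unfolding RIG_def RIG_to_SMC_def by blast
    show "f = g" if "f \<in> hom RIGUTr X Y" "g \<in> hom RIGUTr X Y" "FAr RIGUTr_to_UTSMC f = FAr RIGUTr_to_UTSMC g"
      for f g and X Y :: "('o, 'a) utrigcat"
      using forget_faithful that unfolding RIGUTr_def RIGUTr_to_UTSMC_def by blast
    show "FOb RIG_to_SMC (FOb RIGUTr_to_RIG Y) = FOb UTSMC_to_SMC (FOb RIGUTr_to_UTSMC Y)"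
      for Y :: "('o, 'a) utrigcat"
      by (simp add: RIG_to_SMC_def RIGUTr_to_RIG_def UTSMC_to_SMC_def RIGUTr_to_UTSMC_def smcat.defs rigcat.defs)
    show "FAr RIG_to_SMC (FAr RIGUTr_to_RIG g) = FAr UTSMC_to_SMC (FAr RIGUTr_to_UTSMC g)"
      for g :: "(('o, 'a) utrigcat, 'o, 'a) marr"
      by (simp add: RIG_to_SMC_def RIGUTr_to_RIG_def UTSMC_to_SMC_def RIGUTr_to_UTSMC_def smcat.defs rigcat.defs)
    fix X Y :: "('o, 'a) rigcat"
    show "free_rig X \<in> Ob RIGUTr" "FOb RIGUTr_to_UTSMC (free_rig X) = FOb L (FOb RIG_to_SMC X)"
      if "X \<in> Ob RIG"
      using that free_rig_fields by (simp_all add: Ob_RIG Ob_RIGUTr U)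
    show "\<exists>m'\<in>hom RIGUTr (free_rig X) (free_rig Y). FAr RIGUTr_to_UTSMC m' = FAr L (FAr RIG_to_SMC m)"
      if m: "m \<in> hom RIG X Y" for m
    proof (rule bexI[OF _ free_rig_arrow[OF m]])
      have "right_strict_rig X" "right_strict_rig Y" using m by (simp_all add: RIG_hom)
      then show "FAr RIGUTr_to_UTSMC \<lparr>Src = free_rig X, Trg = free_rig Y, Fun = Fun (FAr L (FAr RIG_to_SMC m))\<rparr>
          = FAr L (FAr RIG_to_SMC m)"
        using L_hom[OF functor_hom[OF RIG_to_SMC_functor m]] free_rig_fields(1)[of X] free_rig_fields(1)[of Y]
        by (intro marr.equality) (simp_all add: RIGUTr_to_UTSMC_def UTSMC_hom U)
    qed
    show "\<exists>u\<in>hom RIG X (FOb RIGUTr_to_RIG (free_rig X)). FAr RIG_to_SMC u = \<eta> (FOb RIG_to_SMC X)"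
      if X: "X \<in> Ob RIG"
    proof (rule bexI)
      have Xr: "right_strict_rig X" using X by (simp add: Ob_RIG)
      \<comment> \<open>Arrows record their source and target, so the lifted unit lies over
        \<open>\<eta>\<close> only if the underlying monoidal categories are equal as
        records.\<close>
      then have "smcat.truncate (free_rig X) = smcat.truncate (FOb L (smcat.truncate X))"
        using free_rig_fields(1)[OF Xr, symmetric] by (simp add: RIGUTr_to_UTSMC_def smcat.defs)
      then show "FAr RIG_to_SMC \<lparr>Src = X, Trg = rigcat.truncate (free_rig X), Fun = Fun (\<eta> (smcat.truncate X))\<rparr>
          = \<eta> (FOb RIG_to_SMC X)"
        using unit_hom_SMC[of "smcat.truncate X"] functor_ob[OF RIG_to_SMC_functor X]
        by (intro marr.equality) (simp_all add: RIG_to_SMC_def Ob_SMC SMC_hom)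
      show "\<lparr>Src = X, Trg = rigcat.truncate (free_rig X), Fun = Fun (\<eta> (smcat.truncate X))\<rparr>
          \<in> hom RIG X (FOb RIGUTr_to_RIG (free_rig X))"
        using free_rig_unit[OF Xr] by (simp add: RIGUTr_to_RIG_def)
    qed
    fix Y :: "('o, 'a) utrigcat"
    show "\<exists>c\<in>hom RIGUTr (free_rig (FOb RIGUTr_to_RIG Y)) Y. FAr RIGUTr_to_UTSMC c = \<epsilon> (FOb RIGUTr_to_UTSMC Y)"
      if Y: "Y \<in> Ob RIGUTr"
    proof (rule bexI)
      let ?C = "rigcat.truncate Y"
      have Yr: "uniformly_traced_rig Y" "right_strict_rig ?C"
        using Y by (simp_all add: Ob_RIGUTr uniformly_traced_rig_def)
      have "smcat.truncate ?C = FOb UTSMC_to_SMC (FOb RIGUTr_to_UTSMC Y)"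
        by (simp add: UTSMC_to_SMC_def RIGUTr_to_UTSMC_def smcat.defs rigcat.defs)
      then show "FAr RIGUTr_to_UTSMC \<lparr>Src = free_rig ?C, Trg = Y, Fun = Fun (\<epsilon> (FOb RIGUTr_to_UTSMC Y))\<rparr>
          = \<epsilon> (FOb RIGUTr_to_UTSMC Y)"
        using counit_hom[OF adj functor_ob[OF RIGUTr_to_UTSMC_functor Y]] free_rig_fields(1)[OF Yr(2)]
        by (intro marr.equality) (simp_all add: RIGUTr_to_UTSMC_def UTSMC_hom)
      show "\<lparr>Src = free_rig ?C, Trg = Y, Fun = Fun (\<epsilon> (FOb RIGUTr_to_UTSMC Y))\<rparr>
          \<in> hom RIGUTr (free_rig (FOb RIGUTr_to_RIG Y)) Y"
        using free_rig_counit[OF Yr(1)] by (simp add: RIGUTr_to_RIG_def)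
    qed
  qed
  then obtain L' \<eta>' \<epsilon>' where "adjunction RIG RIGUTr L' RIGUTr_to_RIG \<eta>' \<epsilon>'" "FOb L' = free_rig"
    "\<forall>f\<in>Ar RIG. FAr RIGUTr_to_UTSMC (FAr L' f) = FAr L (FAr RIG_to_SMC f)"
    "\<forall>X\<in>Ob RIG. FAr RIG_to_SMC (\<eta>' X) = \<eta> (FOb RIG_to_SMC X)"
    "\<forall>Y\<in>Ob RIGUTr. FAr RIGUTr_to_UTSMC (\<epsilon>' Y) = \<epsilon> (FOb RIGUTr_to_UTSMC Y)"
    by blast
  then show ?thesis
    using free_rig_fields by (intro exI[of _ L'] exI[of _ \<eta>'] exI[of _ \<epsilon>']) (simp add: Ob_RIG U)
qed

end
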